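(* Let $\Omega\subset\mathbb R^n$ be a bounded domain (open and connected) with piecewise smooth boundary, and let $\mathcal J:L^2(\Omega)\to\mathbb R\cup\{+\infty\}$ be given by $\mathcal J(u)=\|\nabla u\|_\infty$ for $u\in W^{1,\infty}_0(\Omega)$ and $\mathcal J(u)=+\infty$ for $u\in L^2(\Omega)\setminus W^{1,\infty}_0(\Omega)$. Let $u(t)$ be the gradient flow of $\mathcal J$ in $L^2(\Omega)$ with initial datum $f\in\overline{\mathrm{dom}(\mathcal J)}$, $f\ne0$, such that $f\ge0$ a.e. Denote by $T_{\mathrm{ex}}$ the (finite) extinction time of the flow and assume that $u_\infty:=\lim_{t\to\infty}u(t)=0$. Then $u(t)/\|u(t)\|_2$ converges strongly in $L^2(\Omega)$, as $t\nearrow T_{\mathrm{ex}}$, to a multiple of the distance function $d_\Omega(x):=\inf_{y\in\partial\Omega}|x-y|$.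
   Context: $W^{1,\infty}_0(\Omega):=\{u\in W^{1,\infty}(\Omega): u=0\text{ on }\partial\Omega\}$; $\|\nabla u\|_\infty$ is the essential supremum of the Euclidean norm $|\nabla u|$; $\|\cdot\|_2$ is the $L^2(\Omega)$ norm; $\mathrm{dom}(\mathcal J)=\{\mathcal J<\infty\}$, closure taken in $L^2(\Omega)$; $\partial\mathcal J$ is the convex subdifferential in $L^2(\Omega)$. The gradient flow with initial datum $f$ is the unique continuous map $u:[0,\infty)\to L^2(\Omega)$ with $u(0)=f$, Lipschitz on $[\delta,\infty)$ for all $\delta>0$, right-differentiable on $(0,\infty)$, with $-\partial_t^+u(t)$ equal to the minimal-norm element of $\partial\mathcal J(u(t))$ for all $t>0$. The extinction time is $T_{\mathrm{ex}}:=\inf\{t>0:u(t)=u_\infty\}$. *)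

theory Defs
  imports "HOL-Analysis.Analysis" "HOL-Probability.Essential_Supremum"
begin

text \<open>Only used for open \<open>U\<close>, where \<open>at x\<close> and \<open>at x within U\<close> agree for \<open>x \<in> U\<close>.\<close>

fun Ck_on :: "nat \<Rightarrow> 'a::euclidean_space set \<Rightarrow> ('a \<Rightarrow> 'b::real_normed_vector) \<Rightarrow> bool" where
  "Ck_on 0 U f \<longleftrightarrow> continuous_on U f"
| "Ck_on (Suc k) U f \<longleftrightarrow>
     (\<forall>x\<in>U. f differentiable (at x)) \<and>
     (\<forall>b\<in>Basis. Ck_on k U (\<lambda>x. frechet_derivative f (at x) b))"

definition smooth_on :: "'a::euclidean_space set \<Rightarrow> ('a \<Rightarrow> 'b::real_normed_vector) \<Rightarrow> bool" where
  "smooth_on U f \<longleftrightarrow> (\<forall>k. Ck_on k U f)"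

text \<open>
  A piece of a smooth hypersurface in an \<open>n\<close>-dimensional space is parametrised over a compact
  convex polytope \<open>P\<close> of dimension \<open>n - 1\<close>.  As usual for parametrised surfaces, regularity (an
  injective immersion) is required in the relative interior of \<open>P\<close> only, so that for instance
  spherical coordinates and the lateral surface of a cone are admitted.  The parameter polytope
  is placed in the ambient space because there is no type of dimension one less; only the
  restriction of \<open>\<phi>\<close> to \<open>P\<close> matters.  For \<open>n = 1\<close> a piece is a single point.
\<close>

definition smooth_hypersurface_piece :: "'a::euclidean_space set \<Rightarrow> bool" where
  "smooth_hypersurface_piece K \<longleftrightarrow>
     (\<exists>P U (\<phi> :: 'a \<Rightarrow> 'a).
        polytope P \<and> aff_dim P = int DIM('a) - 1 \<and> open U \<and> P \<subseteq> U \<and>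
        smooth_on U \<phi> \<and> inj_on \<phi> (rel_interior P) \<and>
        (\<forall>x\<in>rel_interior P. inj_on (frechet_derivative \<phi> (at x)) (span ((\<lambda>y. y - x) ` P))) \<and>
        K = \<phi> ` P)"

definition piecewise_smooth_boundary :: "'a::euclidean_space set \<Rightarrow> bool" where
  "piecewise_smooth_boundary \<Omega> \<longleftrightarrow>
     (\<exists>F. finite F \<and> (\<forall>K\<in>F. smooth_hypersurface_piece K) \<and> frontier \<Omega> = \<Union>F)"

text \<open>
  Elements of Lebesgue spaces are represented by functions on the whole space; their values
  outside \<open>\<Omega>\<close> and on null sets are irrelevant, and equality in \<open>L\<^sup>2(\<Omega>)\<close> is expressed by
  \<open>AE x in lebesgue_on \<Omega>\<close>.
\<close>

definition L2 :: "'a::euclidean_space set \<Rightarrow> ('a \<Rightarrow> real) set" where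
  "L2 \<Omega> = {u \<in> borel_measurable (lebesgue_on \<Omega>). integrable (lebesgue_on \<Omega>) (\<lambda>x. (u x)\<^sup>2)}"

definition L2_inner :: "'a::euclidean_space set \<Rightarrow> ('a \<Rightarrow> real) \<Rightarrow> ('a \<Rightarrow> real) \<Rightarrow> real" where
  "L2_inner \<Omega> u v = (LINT x|lebesgue_on \<Omega>. u x * v x)"

definition L2_norm :: "'a::euclidean_space set \<Rightarrow> ('a \<Rightarrow> real) \<Rightarrow> real" where
  "L2_norm \<Omega> u = sqrt (LINT x|lebesgue_on \<Omega>. (u x)\<^sup>2)"

text \<open>
  Membership in \<open>L2 \<Omega>\<close> is part of the definition: the Bochner integral in \<open>L2_norm\<close> is \<open>0\<close> when
  the square is not integrable.
\<close>

definition L2_tendsto ::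
    "'a::euclidean_space set \<Rightarrow> ('t \<Rightarrow> 'a \<Rightarrow> real) \<Rightarrow> ('a \<Rightarrow> real) \<Rightarrow> 't filter \<Rightarrow> bool" where
  "L2_tendsto \<Omega> u l F \<longleftrightarrow>
     l \<in> L2 \<Omega> \<and> (\<forall>\<^sub>F t in F. u t \<in> L2 \<Omega>) \<and>
     ((\<lambda>t. L2_norm \<Omega> (\<lambda>x. u t x - l x)) \<longlongrightarrow> 0) F"

definition L2_closure :: "'a::euclidean_space set \<Rightarrow> ('a \<Rightarrow> real) set \<Rightarrow> ('a \<Rightarrow> real) set" where
  "L2_closure \<Omega> A =
     {f \<in> L2 \<Omega>. \<forall>\<epsilon>>0. \<exists>g\<in>A \<inter> L2 \<Omega>. L2_norm \<Omega> (\<lambda>x. f x - g x) < \<epsilon>}"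

definition test_function :: "'a::euclidean_space set \<Rightarrow> ('a \<Rightarrow> real) \<Rightarrow> bool" where
  "test_function \<Omega> \<phi> \<longleftrightarrow>
     smooth_on UNIV \<phi> \<and> compact (closure {x. \<phi> x \<noteq> 0}) \<and> closure {x. \<phi> x \<noteq> 0} \<subseteq> \<Omega>"

definition locally_integrable ::
    "'a::euclidean_space set \<Rightarrow> ('a \<Rightarrow> 'b::euclidean_space) \<Rightarrow> bool" where
  "locally_integrable \<Omega> u \<longleftrightarrow> (\<forall>K. compact K \<and> K \<subseteq> \<Omega> \<longrightarrow> u absolutely_integrable_on K)"

definition has_weak_gradient ::
    "'a::euclidean_space set \<Rightarrow> ('a \<Rightarrow> real) \<Rightarrow> ('a \<Rightarrow> 'a) \<Rightarrow> bool" where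
  "has_weak_gradient \<Omega> u g \<longleftrightarrow>
     locally_integrable \<Omega> u \<and> locally_integrable \<Omega> g \<and>
     (\<forall>\<phi>. test_function \<Omega> \<phi> \<longrightarrow>
        (\<forall>b\<in>Basis. (LINT x|lebesgue_on \<Omega>. u x * frechet_derivative \<phi> (at x) b)
                 = - (LINT x|lebesgue_on \<Omega>. (g x \<bullet> b) * \<phi> x)))"

text \<open>On open \<open>\<Omega>\<close> the weak gradient is unique up to null sets, so the choice is immaterial.\<close>

definition weak_gradient :: "'a::euclidean_space set \<Rightarrow> ('a \<Rightarrow> real) \<Rightarrow> 'a \<Rightarrow> 'a" where
  "weak_gradient \<Omega> u = (SOME g. has_weak_gradient \<Omega> u g)"

definition Linf_norm :: "'a::euclidean_space set \<Rightarrow> ('a \<Rightarrow> 'b::real_normed_vector) \<Rightarrow> ereal" where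
  "Linf_norm \<Omega> f = esssup (lebesgue_on \<Omega>) (\<lambda>x. ereal (norm (f x)))"

definition Linf :: "'a::euclidean_space set \<Rightarrow> ('a \<Rightarrow> 'b::real_normed_vector) set" where
  "Linf \<Omega> = {f \<in> borel_measurable (lebesgue_on \<Omega>). Linf_norm \<Omega> f < \<infinity>}"

definition W1inf :: "'a::euclidean_space set \<Rightarrow> ('a \<Rightarrow> real) set" where
  "W1inf \<Omega> = {u \<in> Linf \<Omega>. \<exists>g\<in>Linf \<Omega>. has_weak_gradient \<Omega> u g}"

text \<open>
  The boundary condition \<open>u = 0\<close> on \<open>\<partial>\<Omega>\<close> is read classically: the continuous representative of
  \<open>u\<close> extends continuously to the closure of \<open>\<Omega>\<close>, with boundary values \<open>0\<close>.
\<close>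

definition W1inf0 :: "'a::euclidean_space set \<Rightarrow> ('a \<Rightarrow> real) set" where
  "W1inf0 \<Omega> = {u \<in> W1inf \<Omega>. \<exists>v. continuous_on (closure \<Omega>) v \<and>
                 (AE x in lebesgue_on \<Omega>. v x = u x) \<and> (\<forall>x\<in>frontier \<Omega>. v x = 0)}"

definition grad_sup_functional :: "'a::euclidean_space set \<Rightarrow> ('a \<Rightarrow> real) \<Rightarrow> ereal" where
  "grad_sup_functional \<Omega> u =
     (if u \<in> W1inf0 \<Omega> then Linf_norm \<Omega> (weak_gradient \<Omega> u) else \<infinity>)"

definition eff_dom :: "'a::euclidean_space set \<Rightarrow> (('a \<Rightarrow> real) \<Rightarrow> ereal) \<Rightarrow> ('a \<Rightarrow> real) set" where
  "eff_dom \<Omega> J = {u \<in> L2 \<Omega>. J u < \<infinity>}"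

definition subdifferential ::
    "'a::euclidean_space set \<Rightarrow> (('a \<Rightarrow> real) \<Rightarrow> ereal) \<Rightarrow> ('a \<Rightarrow> real) \<Rightarrow> ('a \<Rightarrow> real) set" where
  "subdifferential \<Omega> J u =
     {p \<in> L2 \<Omega>. \<forall>v\<in>L2 \<Omega>. J u + ereal (L2_inner \<Omega> p (\<lambda>x. v x - u x)) \<le> J v}"

definition minimal_norm_element ::
    "'a::euclidean_space set \<Rightarrow> ('a \<Rightarrow> real) set \<Rightarrow> ('a \<Rightarrow> real) \<Rightarrow> bool" where
  "minimal_norm_element \<Omega> A p \<longleftrightarrow> p \<in> A \<and> (\<forall>q\<in>A. L2_norm \<Omega> p \<le> L2_norm \<Omega> q)"

definition L2_has_right_derivative ::
    "'a::euclidean_space set \<Rightarrow> (real \<Rightarrow> 'a \<Rightarrow> real) \<Rightarrow> ('a \<Rightarrow> real) \<Rightarrow> real \<Rightarrow> bool" where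
  "L2_has_right_derivative \<Omega> u w t \<longleftrightarrow>
     L2_tendsto \<Omega> (\<lambda>h x. (u (t + h) x - u t x) / h) w (at_right 0)"

definition is_gradient_flow ::
    "'a::euclidean_space set \<Rightarrow> (('a \<Rightarrow> real) \<Rightarrow> ereal) \<Rightarrow> ('a \<Rightarrow> real) \<Rightarrow>
     (real \<Rightarrow> 'a \<Rightarrow> real) \<Rightarrow> bool" where
  "is_gradient_flow \<Omega> J f u \<longleftrightarrow>
     (\<forall>t\<ge>0. u t \<in> L2 \<Omega>) \<and>
     (\<forall>t\<ge>0. L2_tendsto \<Omega> u (u t) (at t within {0..})) \<and>
     (AE x in lebesgue_on \<Omega>. u 0 x = f x) \<and>
     (\<forall>\<delta>>0. \<exists>L. \<forall>s\<ge>\<delta>. \<forall>t\<ge>\<delta>. L2_norm \<Omega> (\<lambda>x. u s x - u t x) \<le> L * \<bar>s - t\<bar>) \<and>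
     (\<forall>t>0. \<exists>w. L2_has_right_derivative \<Omega> u w t \<and>
        minimal_norm_element \<Omega> (subdifferential \<Omega> J (u t)) (\<lambda>x. - w x))"

text \<open>Extended-real valued, so that the value is \<open>\<infinity>\<close> if the limit is never attained.\<close>

definition extinction_time ::
    "'a::euclidean_space set \<Rightarrow> (real \<Rightarrow> 'a \<Rightarrow> real) \<Rightarrow> ('a \<Rightarrow> real) \<Rightarrow> ereal" where
  "extinction_time \<Omega> u u_inf =
     Inf (ereal ` {t. t > 0 \<and> (AE x in lebesgue_on \<Omega>. u t x = u_inf x)})"

end

theory Submission
  imports Defs
begin

text \<open>
  The functional is a Lipschitz constant in disguise.  A function of \<open>W1inf0 \<Omega>\<close> whose weak
  gradient is bounded by \<open>L\<close> becomes \<open>L\<close>-Lipschitz on the whole space when it is extended by \<open>0\<close>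
  (\<open>W1inf0_lipschitz_representative\<close>), and conversely every such Lipschitz function is a uniform
  limit of members of \<open>W1inf0 \<Omega>\<close> at which the functional is at most \<open>L\<close>
  (\<open>lipschitz_approximation\<close>).  A subgradient \<open>p\<close> at \<open>u\<close> can therefore be recognised without any
  reference to weak derivatives: \<open>u\<close> has a representative with Lipschitz constant \<open>\<langle>p, u\<rangle>\<close>, and
  \<open>\<langle>p, z\<rangle> \<le> M\<close> for every \<open>M\<close>-Lipschitz \<open>z\<close> that vanishes outside \<open>\<Omega>\<close>
  (\<open>subgradient_lipschitz_characterization\<close>).

  Let \<open>d\<close> be the distance to the complement, \<open>J t\<close> the value of the functional at \<open>u t\<close>, and
  \<open>p t = - u' t\<close>.  Truncation at \<open>0\<close> does not increase a Lipschitz constant, so the flow stays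
  nonnegative; and \<open>0 \<le> u t \<le> J t * d\<close>, because \<open>d\<close> is the largest \<open>1\<close>-Lipschitz function that
  vanishes outside \<open>\<Omega>\<close>.  Hence \<open>\<parallel>u\<parallel>' = - J / \<parallel>u\<parallel> \<le> - 1 / \<parallel>d\<parallel>\<close>, and the flow is extinct at a
  finite time \<open>T\<close>.

  The quotient \<open>u t / (T - t)\<close> is an average of the subgradients \<open>p s\<close> with \<open>t < s < T\<close>, so it
  satisfies the same inequalities: \<open>\<langle>u t, z\<rangle> \<le> M * (T - t)\<close>.  With \<open>z = u t\<close> this shows that
  \<open>Q t = \<parallel>u t\<parallel>\<^sup>2 / (T - t)\<^sup>2\<close> is nonincreasing; with \<open>z = d\<close> it gives \<open>\<langle>u t, d\<rangle> \<le> T - t\<close>.  As \<open>Q\<close>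
  is bounded below by \<open>1 / \<parallel>d\<parallel>\<^sup>2\<close>, the ratio \<open>J t * (T - t) / \<parallel>u t\<parallel>\<^sup>2 \<ge> 1\<close> comes arbitrarily close
  to \<open>1\<close> (\<open>nearly_eigen_time\<close>).  At such times \<open>w = u t / \<parallel>u t\<parallel>\<close> and \<open>\<Lambda> = J t / \<parallel>u t\<parallel>\<close> make
  \<open>\<integral> w * (\<Lambda> * d - w)\<close> small, so that \<open>w\<close> is close to \<open>0\<close> or to \<open>\<Lambda> * d\<close> at each point.  By
  equicontinuity and connectedness the same alternative holds throughout \<open>\<Omega>\<close>, and \<open>\<parallel>w\<parallel> = 1\<close>
  leaves only the second one (\<open>concentration_on_distance_function\<close>); thus \<open>\<Lambda> \<rightarrow> 1 / \<parallel>d\<parallel>\<close> along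
  suitable times, and \<open>Q t \<rightarrow> 1 / \<parallel>d\<parallel>\<^sup>2\<close> by monotonicity.

  It remains to pass from \<open>\<parallel>u\<parallel>\<^sup>2\<close> to its derivative \<open>- 2 * J\<close>.  Since \<open>J\<close> is nonincreasing
  (\<open>J_nonincreasing\<close>), the asymptotics \<open>\<parallel>u t\<parallel>\<^sup>2 \<sim> (T - t)\<^sup>2 / \<parallel>d\<parallel>\<^sup>2\<close> may be differentiated:
  \<open>J t \<sim> (T - t) / \<parallel>d\<parallel>\<^sup>2\<close> (\<open>J_limit\<close>).  Together with \<open>\<parallel>u\<parallel>\<^sup>2 \<le> J * \<langle>u, d\<rangle>\<close> this makes the cosine of
  the angle between \<open>u t\<close> and \<open>d\<close> tend to \<open>1\<close>, which is the claim.
\<close>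

section \<open>Smooth bump functions\<close>

text \<open>
  For \<open>P = 1\<close> this is Cauchy's function \<open>exp (- 1 / x)\<close>.  The polynomial is carried along because
  all derivatives are again of this form, which makes smoothness a single induction over the order
  with \<open>P\<close> arbitrary.
\<close>

definition flat_exp :: "real poly \<Rightarrow> real \<Rightarrow> real" where
  "flat_exp P x = (if x > 0 then poly P (1 / x) * exp (- (1 / x)) else 0)"

lemma poly_mult_exp_neg_tendsto_0:
  "((\<lambda>y. poly P y * exp (- y)) \<longlongrightarrow> (0::real)) at_top"
proof -
  have "((\<lambda>y. \<Sum>i\<le>degree P. coeff P i * (y ^ i / exp y)) \<longlongrightarrow> (\<Sum>i\<le>degree P. coeff P i * 0)) at_top"
    by (intro tendsto_sum tendsto_mult tendsto_const tendsto_power_div_exp_0)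
  then show ?thesis
    by (simp add: poly_altdef sum_divide_distrib sum_distrib_right exp_minus divide_inverse mult.assoc)
qed

lemma flat_exp_at_right_0: "(flat_exp P \<longlongrightarrow> 0) (at_right 0)"
proof -
  have "((\<lambda>x. poly P (inverse x) * exp (- inverse x)) \<longlongrightarrow> 0) (at_right (0::real))"
    using filterlim_compose[OF poly_mult_exp_neg_tendsto_0 filterlim_inverse_at_top_right, of P] .
  then show ?thesis
    by (rule Lim_transform_eventually)
       (auto simp: flat_exp_def eventually_at_right_less inverse_eq_divide
          intro!: eventually_mono[OF eventually_at_right_less])
qed

text \<open>
  At \<open>0\<close>, the difference quotient from the right is the function with \<open>P\<close> multiplied by the
  variable, so it tends to \<open>0\<close> as well.
\<close>

lemma flat_exp_DERIV:
  "(flat_exp P has_real_derivative flat_exp ([:0, 0, 1:] * (P - pderiv P)) x) (at x)"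
proof (cases x "0 :: real" rule: linorder_cases)
  case less
  have "((\<lambda>x. 0) has_real_derivative 0) (at x)" by simp
  then have "(flat_exp P has_real_derivative 0) (at x)"
    using less by (elim DERIV_cong_ev[THEN iffD1, rotated -1])
      (auto simp: flat_exp_def intro: eventually_mono[OF eventually_nhds_in_open[of "{..<0}" x]])
  then show ?thesis using less by (simp add: flat_exp_def)
next
  case greater
  have "((\<lambda>x. poly P (1 / x) * exp (- (1 / x))) has_real_derivative
      poly ([:0, 0, 1:] * (P - pderiv P)) (1 / x) * exp (- (1 / x))) (at x)"
    using greater
    by (auto intro!: derivative_eq_intros DERIV_chain'[OF _ poly_DERIV] simp: field_simps power2_eq_square)
  then have "(flat_exp P has_real_derivative poly ([:0, 0, 1:] * (P - pderiv P)) (1 / x) * exp (- (1 / x))) (at x)"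
    using greater by (elim DERIV_cong_ev[THEN iffD1, rotated -1])
      (auto simp: flat_exp_def intro: eventually_mono[OF eventually_nhds_in_open[of "{0<..}" x]])
  then show ?thesis using greater by (simp add: flat_exp_def)
next
  case equal
  have "((\<lambda>y. (flat_exp P y - flat_exp P 0) / (y - 0)) \<longlongrightarrow> 0) (at_right 0)"
    by (rule Lim_transform_eventually[OF flat_exp_at_right_0[of "[:0,1:] * P"]])
       (auto simp: flat_exp_def intro!: eventually_mono[OF eventually_at_right_less])
  moreover have "((\<lambda>y. (flat_exp P y - flat_exp P 0) / (y - 0)) \<longlongrightarrow> 0) (at_left 0)"
    by (rule Lim_transform_eventually[OF tendsto_const])
       (auto simp: flat_exp_def eventually_at_filter)
  ultimately show ?thesis
    unfolding has_field_derivative_iff equal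
    by (simp add: filterlim_at_split flat_exp_def)
qed

lemma flat_exp_eq_0: "x \<le> 0 \<Longrightarrow> flat_exp P x = 0" by (simp add: flat_exp_def)

lemma flat_exp_1_pos: "x > 0 \<Longrightarrow> flat_exp 1 x > 0" by (simp add: flat_exp_def)
lemma flat_exp_1_nonneg: "flat_exp 1 x \<ge> 0" by (simp add: flat_exp_def)
lemma flat_exp_1_le: "flat_exp 1 x \<le> 1" by (simp add: flat_exp_def)

lemma flat_exp_1_tendsto:
  "(\<lambda>k. flat_exp 1 (real k * x)) \<longlonglongrightarrow> (if x > 0 then 1 else 0)"
proof (cases "x > 0")
  case True
  have "(\<lambda>k. exp (- (1 / x * (1 / real k)))) \<longlonglongrightarrow> exp (- (1 / x * 0 :: real))"
    by (intro tendsto_intros lim_1_over_n)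
  then have "(\<lambda>k. exp (- (1 / x * (1 / real k)))) \<longlonglongrightarrow> 1" by simp
  then show ?thesis
    using True
    by (auto simp: flat_exp_def mult.commute
        elim!: Lim_transform_eventually intro!: eventually_mono[OF eventually_gt_at_top[of 0]])
next
  case False
  then show ?thesis by (simp add: flat_exp_def zero_less_mult_iff)
qed

lemma Ck_on_Suc_UNIV_I:
  fixes f :: "'a::euclidean_space \<Rightarrow> real"
  assumes "\<And>x. (f has_derivative F x) (at x)"
    and "\<And>b. b \<in> Basis \<Longrightarrow> Ck_on k UNIV (\<lambda>x. F x b)"
  shows "Ck_on (Suc k) UNIV f"
proof -
  have "frechet_derivative f (at x) = F x" for x
    using frechet_derivative_at[OF assms(1)[of x]] by simp
  then show ?thesis using assms by (auto simp: differentiable_def)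
qed

lemma Ck_on_SucD: "Ck_on (Suc k) UNIV f \<Longrightarrow> Ck_on k UNIV f"
proof (induction k arbitrary: f)
  case 0
  then show ?case
    by (auto intro!: differentiable_imp_continuous_on simp: differentiable_on_def)
next
  case (Suc k)
  then show ?case by (metis Ck_on.simps(2))
qed

lemma Ck_on_const: "Ck_on k UNIV (\<lambda>x::'a::euclidean_space. c :: real)"
proof (induction k arbitrary: c)
  case (Suc k)
  then show ?case by (intro Ck_on_Suc_UNIV_I[where F="\<lambda>_ _. 0"]) auto
qed auto

lemma Ck_on_add:
  fixes f g :: "'a::euclidean_space \<Rightarrow> real"
  shows "Ck_on k UNIV f \<Longrightarrow> Ck_on k UNIV g \<Longrightarrow> Ck_on k UNIV (\<lambda>x. f x + g x)"
proof (induction k arbitrary: f g)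
  case 0
  then show ?case by (auto intro: continuous_intros)
next
  case (Suc k)
  show ?case
    by (rule Ck_on_Suc_UNIV_I[where
          F="\<lambda>x b. frechet_derivative f (at x) b + frechet_derivative g (at x) b"])
      (use Suc in \<open>auto intro!: has_derivative_add simp: frechet_derivative_works[symmetric]\<close>)
qed

lemma Ck_on_mult:
  fixes f g :: "'a::euclidean_space \<Rightarrow> real"
  shows "Ck_on k UNIV f \<Longrightarrow> Ck_on k UNIV g \<Longrightarrow> Ck_on k UNIV (\<lambda>x. f x * g x)"
proof (induction k arbitrary: f g)
  case 0
  then show ?case by (auto intro: continuous_intros)
next
  case (Suc k)
  have "Ck_on k UNIV f" "Ck_on k UNIV g" using Suc.prems by (auto intro: Ck_on_SucD)
  then show ?case
    by (intro Ck_on_Suc_UNIV_I[where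
          F="\<lambda>x b. f x * frechet_derivative g (at x) b + frechet_derivative f (at x) b * g x"])
      (use Suc in \<open>auto intro!: has_derivative_mult Ck_on_add simp: frechet_derivative_works[symmetric]\<close>)
qed

lemma Ck_on_prod:
  fixes f :: "'i \<Rightarrow> 'a::euclidean_space \<Rightarrow> real"
  shows "finite I \<Longrightarrow> (\<And>i. i \<in> I \<Longrightarrow> Ck_on k UNIV (f i)) \<Longrightarrow> Ck_on k UNIV (\<lambda>x. \<Prod>i\<in>I. f i x)"
  by (induction I rule: finite_induct) (auto intro: Ck_on_mult Ck_on_const)

lemma Ck_on_flat_exp_affine:
  "Ck_on k UNIV (\<lambda>x::'a::euclidean_space. flat_exp P (a \<bullet> x + c))"
proof (induction k arbitrary: P)
  case 0
  have "continuous_on UNIV (flat_exp P)"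
    by (rule DERIV_continuous_on) (auto intro: flat_exp_DERIV has_field_derivative_at_within)
  then have "continuous_on UNIV (\<lambda>x. flat_exp P (a \<bullet> x + c))"
    by (rule continuous_on_compose2) (auto intro!: continuous_intros)
  then show ?case by simp
next
  case (Suc k)
  let ?Q = "[:0, 0, 1:] * (P - pderiv P)"
  show ?case
  proof (rule Ck_on_Suc_UNIV_I[where F="\<lambda>x b. flat_exp ?Q (a \<bullet> x + c) * (a \<bullet> b)"])
    fix x :: 'a
    have "((\<lambda>x. a \<bullet> x + c) has_derivative (\<lambda>b. a \<bullet> b)) (at x)"
      by (auto intro!: derivative_eq_intros)
    from has_derivative_compose[OF this has_field_derivative_imp_has_derivative[OF flat_exp_DERIV]]
    show "((\<lambda>x. flat_exp P (a \<bullet> x + c)) has_derivative (\<lambda>b. flat_exp ?Q (a \<bullet> x + c) * (a \<bullet> b))) (at x)"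
      by simp
  next
    fix b :: 'a
    show "Ck_on k UNIV (\<lambda>x. flat_exp ?Q (a \<bullet> x + c) * (a \<bullet> b))"
      by (intro Ck_on_mult Suc.IH Ck_on_const)
  qed
qed

text \<open>
  The steepness \<open>c\<close> allows two uses: a fixed \<open>c\<close> gives a mollifier, and \<open>c \<rightarrow> \<infinity>\<close> approximates
  the indicator function of the box from inside.
\<close>

definition box_bump :: "real \<Rightarrow> 'a::euclidean_space \<Rightarrow> 'a \<Rightarrow> 'a \<Rightarrow> real" where
  "box_bump c a b x =
     (\<Prod>i\<in>Basis. flat_exp 1 (c * ((x - a) \<bullet> i)) * flat_exp 1 (c * ((b - x) \<bullet> i)))"

lemma smooth_box_bump: "smooth_on UNIV (box_bump c a b)"
  unfolding smooth_on_def
proof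
  fix k
  have eq: "c * ((x - a) \<bullet> i) = (c *\<^sub>R i) \<bullet> x + (- c * (a \<bullet> i))"
     "c * ((b - x) \<bullet> i) = (- c *\<^sub>R i) \<bullet> x + c * (b \<bullet> i)" for x i
    by (simp_all add: inner_diff_left inner_commute algebra_simps)
  show "Ck_on k UNIV (box_bump c a b)"
    unfolding box_bump_def[abs_def] eq
    by (intro Ck_on_prod Ck_on_mult Ck_on_flat_exp_affine) auto
qed

lemma box_bump_nonneg: "0 \<le> box_bump c a b x"
  unfolding box_bump_def by (intro prod_nonneg ballI mult_nonneg_nonneg flat_exp_1_nonneg)

lemma box_bump_le_1: "box_bump c a b x \<le> 1"
  unfolding box_bump_def
  by (intro prod_le_1 conjI mult_nonneg_nonneg flat_exp_1_nonneg mult_le_one flat_exp_1_le)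

lemma box_bump_pos: "c > 0 \<Longrightarrow> x \<in> box a b \<Longrightarrow> 0 < box_bump c a b x"
  unfolding box_bump_def
  by (intro prod_pos) (auto simp: mem_box inner_diff_left intro!: mult_pos_pos flat_exp_1_pos)

lemma box_bump_eq_0: "c > 0 \<Longrightarrow> x \<notin> box a b \<Longrightarrow> box_bump c a b x = 0"
  unfolding box_bump_def
  by (auto simp: mem_box inner_diff_left not_less intro!: flat_exp_eq_0 mult_nonneg_nonpos)

lemma box_bump_shift: "box_bump c a b (x - y) = box_bump c (a + y) (b + y) x"
  by (simp add: box_bump_def algebra_simps)

lemma box_bump_tendsto:
  "(\<lambda>k. box_bump (real k) a b x) \<longlonglongrightarrow> indicator (box a b) x"
proof -
  have "(\<lambda>k. box_bump (real k) a b x) \<longlonglongrightarrow>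
     (\<Prod>i\<in>Basis. (if (x - a) \<bullet> i > 0 then 1 else 0) * (if (b - x) \<bullet> i > 0 then 1 else 0))"
    unfolding box_bump_def by (intro tendsto_prod tendsto_mult flat_exp_1_tendsto)
  moreover have "(\<Prod>i\<in>Basis. (if (x - a) \<bullet> i > 0 then 1 else 0) * (if (b - x) \<bullet> i > 0 then 1 else 0))
    = (indicator (box a b) x :: real)"
    by (auto simp: indicator_def mem_box inner_diff_left intro!: prod.neutral)
  ultimately show ?thesis by simp
qed

lemma test_function_box_bump:
  assumes "c > 0" "cbox a b \<subseteq> \<Omega>"
  shows "test_function \<Omega> (box_bump c a b)"
proof -
  have "{x. box_bump c a b x \<noteq> 0} \<subseteq> cbox a b"
    using box_bump_eq_0[OF assms(1)] box_subset_cbox by blast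
  then have *: "closure {x. box_bump c a b x \<noteq> 0} \<subseteq> cbox a b"
    by (intro closure_minimal closed_cbox)
  then have "compact (closure {x. box_bump c a b x \<noteq> 0})"
    by (meson bounded_cbox bounded_subset closed_closure compact_eq_bounded_closed)
  then show ?thesis using * assms by (auto simp: test_function_def smooth_box_bump)
qed

lemma smooth_has_derivative:
  "smooth_on UNIV f \<Longrightarrow> (f has_derivative frechet_derivative f (at x)) (at x)"
  unfolding smooth_on_def
  by (metis Ck_on.simps(2) UNIV_I frechet_derivative_works)

lemma smooth_continuous: "smooth_on UNIV f \<Longrightarrow> continuous_on UNIV f"
  unfolding smooth_on_def by (metis Ck_on.simps(1))

lemma smooth_linear_derivative: "smooth_on UNIV f \<Longrightarrow> linear (frechet_derivative f (at x))"
  using smooth_has_derivative has_derivative_linear by blast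

lemma frechet_derivative_basis_expansion:
  assumes "linear (D :: 'a::euclidean_space \<Rightarrow> real)"
  shows "D e = (\<Sum>b\<in>Basis. (e \<bullet> b) * D b)"
proof -
  have "D e = D (\<Sum>b\<in>Basis. (e \<bullet> b) *\<^sub>R b)" by (simp add: euclidean_representation)
  also have "\<dots> = (\<Sum>b\<in>Basis. (e \<bullet> b) * D b)"
    using assms by (simp add: linear_sum linear_cmul)
  finally show ?thesis .
qed

lemma smooth_continuous_derivative:
  fixes f :: "'a::euclidean_space \<Rightarrow> real"
  assumes "smooth_on UNIV f"
  shows "continuous_on UNIV (\<lambda>x. frechet_derivative f (at x) e)"
proof -
  have "continuous_on UNIV (\<lambda>x. frechet_derivative f (at x) b)" if "b \<in> Basis" for b
    using assms that unfolding smooth_on_def by (metis Ck_on.simps)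
  then show ?thesis
    by (subst frechet_derivative_basis_expansion[OF smooth_linear_derivative[OF assms]])
       (auto intro!: continuous_intros)
qed

section \<open>Differentiation under the integral and mollification\<close>

lemma continuous_compact_support_integrable:
  fixes F :: "'a::euclidean_space \<Rightarrow> real"
  assumes "continuous_on UNIV F" "\<And>y. y \<notin> cbox A B \<Longrightarrow> F y = 0"
  shows "integrable lborel F" "(LINT y|lborel. F y) = integral (cbox A B) F"
proof -
  have "set_integrable lborel (cbox A B) F"
    unfolding set_integrable_def
    by (rule borel_integrable_compact[OF compact_cbox continuous_on_subset[OF assms(1)]]) simp
  moreover have eq: "(\<lambda>y. indicator (cbox A B) y *\<^sub>R F y) = F"
    using assms(2) by (auto simp: fun_eq_iff indicator_def)
  ultimately show "integrable lborel F" by (simp add: set_integrable_def eq)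
  have "(LINT y:cbox A B|lborel. F y) = integral (cbox A B) F"
    by (rule set_borel_integral_eq_integral) fact
  then show "(LINT y|lborel. F y) = integral (cbox A B) F"
    unfolding set_lebesgue_integral_def eq .
qed

lemma integral_lebesgue_on_eq_lborel:
  fixes F :: "'a::euclidean_space \<Rightarrow> real"
  assumes "open \<Omega>" "F \<in> borel_measurable borel" "\<And>y. y \<notin> \<Omega> \<Longrightarrow> F y = 0"
  shows "(LINT y|lebesgue_on \<Omega>. F y) = (LINT y|lborel. F y)"
proof -
  have eq: "(\<lambda>y. indicator \<Omega> y *\<^sub>R F y) = F"
    using assms(3) by (auto simp: fun_eq_iff indicator_def)
  have "(LINT y|lebesgue_on \<Omega>. F y) = (LINT y|lebesgue. indicator \<Omega> y *\<^sub>R F y)"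
    using assms(1) by (intro integral_restrict_space) auto
  also have "\<dots> = (LINT y|lborel. F y)"
    unfolding eq using assms(2) by (intro integral_completion) simp
  finally show ?thesis .
qed

text \<open>
  The common support lies in one box, so the Leibniz rule for continuous integrands on a box
  applies.  The parameter ranges over a set \<open>U\<close> only, because the support of the translates of a
  function stays in one box only for bounded translations.
\<close>

lemma DERIV_integral_lborel:
  fixes F :: "real \<Rightarrow> 'a::euclidean_space \<Rightarrow> real"
  assumes U: "open U" "convex U" "s \<in> U"
    and der: "\<And>s y. s \<in> U \<Longrightarrow> ((\<lambda>s. F s y) has_real_derivative F' s y) (at s)"
    and cont': "continuous_on (U \<times> UNIV) (\<lambda>(s, y). F' s y)"
    and cont: "\<And>s. s \<in> U \<Longrightarrow> continuous_on UNIV (F s)"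
    and zero: "\<And>s y. s \<in> U \<Longrightarrow> y \<notin> cbox A B \<Longrightarrow> F s y = 0"
  shows "((\<lambda>s. LINT y|lborel. F s y) has_real_derivative (LINT y|lborel. F' s y)) (at s)"
proof -
  have zero': "F' s y = 0" if "s \<in> U" "y \<notin> cbox A B" for s y
  proof -
    have "((\<lambda>s. F s y) has_real_derivative 0) (at s)"
      by (rule has_field_derivative_transform_within_open[of "\<lambda>_. 0" _ _ U])
        (use zero that U(1) in auto)
    with der[OF that(1), of y] show ?thesis by (metis DERIV_unique)
  qed
  have cont_y: "continuous_on UNIV (F' s)" if "s \<in> U" for s
    by (rule continuous_on_compose2[OF cont', of _ "\<lambda>y. (s, y)", simplified])
      (use that in \<open>auto intro!: continuous_intros\<close>)
  have "((\<lambda>s. integral (cbox A B) (F s)) has_vector_derivative integral (cbox A B) (F' s)) (at s within U)"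
  proof (rule leibniz_rule_vector_derivative[where U=U])
    show "((\<lambda>s. F s y) has_vector_derivative F' s y) (at s within U)" if "s \<in> U" for s y
      using der[OF that, of y]
      by (auto simp: has_real_derivative_iff_has_vector_derivative intro: has_vector_derivative_at_within)
    show "F s integrable_on cbox A B" if "s \<in> U" for s
      using cont[OF that] by (intro integrable_continuous) (auto intro: continuous_on_subset)
    show "continuous_on (U \<times> cbox A B) (\<lambda>(s, y). F' s y)"
      using cont' by (rule continuous_on_subset) auto
  qed (use U in auto)
  then have "((\<lambda>s. integral (cbox A B) (F s)) has_real_derivative integral (cbox A B) (F' s)) (at s)"
    unfolding at_within_open[OF U(3) U(1)] has_real_derivative_iff_has_vector_derivative .
  then have "((\<lambda>s. LINT y|lborel. F s y) has_real_derivative integral (cbox A B) (F' s)) (at s)"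
    by (rule has_field_derivative_transform_within_open[OF _ U(1) U(3)])
      (use continuous_compact_support_integrable(2)[OF cont zero] in simp)
  then show ?thesis
    using continuous_compact_support_integrable(2)[OF cont_y zero'] U(3) by simp
qed

lemma integral_lborel_shift:
  fixes F :: "'a::euclidean_space \<Rightarrow> real"
  assumes "F \<in> borel_measurable borel"
  shows "(LINT y|lborel. F (z + y)) = (LINT y|lborel. F y)"
proof -
  have "(LINT y|lborel. F y) = (LINT y|distr lborel borel ((+) z). F y)"
    by (simp add: lborel_distr_plus)
  also have "\<dots> = (LINT y|lborel. F (z + y))"
    using assms by (intro integral_distr) auto
  finally show ?thesis ..
qed

text \<open>
  Integration by parts: the integral of \<open>\<psi>\<close> does not change when \<open>\<psi>\<close> is translated along \<open>e\<close>, so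
  its derivative with respect to the translation vanishes.
\<close>

lemma integral_directional_derivative_eq_0:
  fixes \<psi> :: "'a::euclidean_space \<Rightarrow> real"
  assumes der: "\<And>x s. ((\<lambda>s. \<psi> (x + s *\<^sub>R e)) has_real_derivative \<psi>' (x + s *\<^sub>R e)) (at s)"
    and cont: "continuous_on UNIV \<psi>" "continuous_on UNIV \<psi>'"
    and supp: "\<And>x. x \<notin> K \<Longrightarrow> \<psi> x = 0" "bounded K"
  shows "(LINT x|lborel. \<psi>' x) = 0"
proof -
  have "bounded ((\<lambda>(s, x). x - s *\<^sub>R e) ` ({-1..1} \<times> K))"
  proof -
    have "((\<lambda>(s, x). x - s *\<^sub>R e) ` ({-1..1} \<times> K)) \<subseteq> ((\<lambda>(s, x). x - s *\<^sub>R e) ` ({-1..1} \<times> closure K))"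
      using closure_subset by (intro image_mono) auto
    moreover have "compact ((\<lambda>(s::real, x). x - s *\<^sub>R e) ` ({-1..1} \<times> closure K))"
      using supp(2) by (intro compact_continuous_image compact_Times)
        (auto intro!: continuous_intros simp: split_beta)
    ultimately show ?thesis using bounded_subset compact_imp_bounded by blast
  qed
  then obtain A B where AB: "((\<lambda>(s::real, x). x - s *\<^sub>R e) ` ({-1..1} \<times> K)) \<subseteq> cbox A B"
    using bounded_subset_cbox_symmetric by metis
  have zero: "\<psi> (x + s *\<^sub>R e) = 0" if "s \<in> {-1<..<1}" "x \<notin> cbox A B" for s x
  proof (rule ccontr)
    assume "\<psi> (x + s *\<^sub>R e) \<noteq> 0"
    then have "x + s *\<^sub>R e \<in> K" using supp by blast
    then have "(\<lambda>(s::real, x). x - s *\<^sub>R e) (s, x + s *\<^sub>R e) \<in> cbox A B"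
      using that AB by (intro subsetD[OF AB] imageI) auto
    then show False using that by simp
  qed
  have "((\<lambda>s. LINT x|lborel. \<psi> (x + s *\<^sub>R e)) has_real_derivative (LINT x|lborel. \<psi>' (x + 0 *\<^sub>R e))) (at 0)"
  proof (rule DERIV_integral_lborel[where U="{-1<..<1}" and A=A and B=B])
    show "continuous_on ({- 1<..<1} \<times> UNIV) (\<lambda>(s, y). \<psi>' (y + s *\<^sub>R e))"
      by (auto intro!: continuous_intros continuous_on_compose2[OF cont(2)] simp: split_beta)
    show "continuous_on UNIV (\<lambda>y. \<psi> (y + s *\<^sub>R e))" for s
      by (auto intro!: continuous_intros continuous_on_compose2[OF cont(1)])
  qed (use der zero in auto)
  moreover have "(LINT x|lborel. \<psi> (x + s *\<^sub>R e)) = (LINT x|lborel. \<psi> x)" for s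
    using integral_lborel_shift[of \<psi> "s *\<^sub>R e"] cont(1)
    by (simp add: add.commute borel_measurable_continuous_onI)
  ultimately have "((\<lambda>s::real. LINT x|lborel. \<psi> x) has_real_derivative (LINT x|lborel. \<psi>' x)) (at 0)"
    by simp
  then show ?thesis by (metis DERIV_const DERIV_unique)
qed

lemma smooth_DERIV_line:
  fixes \<eta> :: "'a::euclidean_space \<Rightarrow> real"
  assumes "smooth_on UNIV \<eta>"
  shows "((\<lambda>s. \<eta> (x + s *\<^sub>R e)) has_real_derivative frechet_derivative \<eta> (at (x + s *\<^sub>R e)) e) (at s)"
proof -
  have "((\<lambda>s. x + s *\<^sub>R e) has_derivative (\<lambda>h. h *\<^sub>R e)) (at s)"
    by (auto intro!: derivative_eq_intros)
  from has_derivative_compose[OF this smooth_has_derivative[OF assms]]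
  have "((\<lambda>s. \<eta> (x + s *\<^sub>R e)) has_derivative (\<lambda>h. frechet_derivative \<eta> (at (x + s *\<^sub>R e)) (h *\<^sub>R e))) (at s)" .
  then show ?thesis
    using linear_cmul[OF smooth_linear_derivative[OF assms]]
    by (simp add: has_field_derivative_def mult.commute[of _ "frechet_derivative _ _ _"])
qed

text \<open>
  With the argument \<open>y - x\<close> instead of \<open>x - y\<close>, the kernel as a function of the integration
  variable is a translate of \<open>\<eta>\<close>, that is, a test function for weak gradients.
\<close>

definition mollify :: "('a::euclidean_space \<Rightarrow> real) \<Rightarrow> ('a \<Rightarrow> real) \<Rightarrow> 'a \<Rightarrow> real" where
  "mollify \<eta> S x = (LINT y|lborel. S y * \<eta> (y - x))"

lemma mollify_DERIV_line:
  fixes S \<eta> :: "'a::euclidean_space \<Rightarrow> real"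
  assumes \<eta>: "smooth_on UNIV \<eta>" and S: "continuous_on UNIV S" "\<And>y. y \<notin> cbox A B \<Longrightarrow> S y = 0"
  shows "((\<lambda>s. mollify \<eta> S (x + s *\<^sub>R e)) has_real_derivative
     - (LINT y|lborel. S y * frechet_derivative \<eta> (at (y - (x + s *\<^sub>R e))) e)) (at s)"
proof -
  have d: "((\<lambda>s. \<eta> (y - (x + s *\<^sub>R e))) has_real_derivative - frechet_derivative \<eta> (at (y - (x + s *\<^sub>R e))) e) (at s)" for y s
    using smooth_DERIV_line[OF \<eta>, of "y - x" "- e" s] linear_neg[OF smooth_linear_derivative[OF \<eta>]]
    by (simp add: algebra_simps)
  have "((\<lambda>s. LINT y|lborel. S y * \<eta> (y - (x + s *\<^sub>R e))) has_real_derivative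
      (LINT y|lborel. S y * - frechet_derivative \<eta> (at (y - (x + s *\<^sub>R e))) e)) (at s)"
  proof (rule DERIV_integral_lborel[where U=UNIV and A=A and B=B])
    show "((\<lambda>s. S y * \<eta> (y - (x + s *\<^sub>R e))) has_real_derivative S y * - frechet_derivative \<eta> (at (y - (x + s *\<^sub>R e))) e) (at s)" for s y
      by (rule DERIV_cmult[OF d])
    show "continuous_on UNIV (\<lambda>y. S y * \<eta> (y - (x + s *\<^sub>R e)))" for s
      by (auto intro!: continuous_intros S continuous_on_compose2[OF smooth_continuous[OF \<eta>]])
    show "continuous_on (UNIV \<times> UNIV) (\<lambda>(s, y). S y * - frechet_derivative \<eta> (at (y - (x + s *\<^sub>R e))) e)"
      by (auto intro!: continuous_intros continuous_on_compose2[OF S(1)]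
          continuous_on_compose2[OF smooth_continuous_derivative[OF \<eta>]] simp: split_beta)
  qed (use S in auto)
  then show ?thesis by (simp add: mollify_def)
qed

text \<open>
  A cube of half-width \<open>\<rho> / DIM('a)\<close> fits into the ball of radius \<open>\<rho>\<close>.
\<close>

definition ball_bump :: "real \<Rightarrow> 'a::euclidean_space \<Rightarrow> real" where
  "ball_bump \<rho> = box_bump 1 (- (\<rho> / real DIM('a)) *\<^sub>R One) ((\<rho> / real DIM('a)) *\<^sub>R One)"

lemma One_inner_Basis: "i \<in> Basis \<Longrightarrow> (One :: 'a::euclidean_space) \<bullet> i = 1"
  by (simp add: inner_sum_left inner_Basis if_distrib sum.delta cong: if_cong)

lemma cbox_One_subset_cball:
  "cbox (z - (\<rho> / real DIM('a)) *\<^sub>R One) (z + (\<rho> / real DIM('a)) *\<^sub>R One) \<subseteq> cball (z::'a::euclidean_space) \<rho>"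
proof
  fix y assume y: "y \<in> cbox (z - (\<rho> / real DIM('a)) *\<^sub>R One) (z + (\<rho> / real DIM('a)) *\<^sub>R One)"
  have "norm (y - z) \<le> (\<Sum>i\<in>Basis. \<bar>(y - z) \<bullet> i\<bar>)" by (rule norm_le_l1)
  also have "\<dots> \<le> (\<Sum>i\<in>(Basis::'a set). \<rho> / real DIM('a))"
  proof (rule sum_mono)
    fix i :: 'a assume "i \<in> Basis"
    then show "\<bar>(y - z) \<bullet> i\<bar> \<le> \<rho> / real DIM('a)"
      using y[unfolded mem_box, rule_format, OF \<open>i \<in> Basis\<close>]
      by (simp add: inner_diff_left inner_add_left One_inner_Basis abs_le_iff)
  qed
  also have "\<dots> = \<rho>" by simp
  finally show "y \<in> cball z \<rho>" by (simp add: dist_norm norm_minus_commute)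
qed

lemma ball_bump_smooth: "smooth_on UNIV (ball_bump \<rho>)"
  by (simp add: ball_bump_def smooth_box_bump)

lemma ball_bump_continuous: "continuous_on UNIV (ball_bump \<rho>)"
  by (rule smooth_continuous[OF ball_bump_smooth])

lemma ball_bump_nonneg: "ball_bump \<rho> y \<ge> 0"
  by (simp add: ball_bump_def box_bump_nonneg)

lemma ball_bump_eq_0: "\<rho> < norm y \<Longrightarrow> ball_bump \<rho> (y::'a::euclidean_space) = 0"
  unfolding ball_bump_def
proof (rule box_bump_eq_0)
  assume "\<rho> < norm y"
  then have "y \<notin> cball 0 \<rho>" by simp
  then show "y \<notin> box (- (\<rho> / real DIM('a)) *\<^sub>R One) ((\<rho> / real DIM('a)) *\<^sub>R One)"
    using cbox_One_subset_cball[of "0::'a" \<rho>] box_subset_cbox by fastforce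
qed simp

lemma test_function_ball_bump:
  assumes "cball z \<rho> \<subseteq> \<Omega>"
  shows "test_function \<Omega> (\<lambda>y. ball_bump \<rho> (y - z))"
  unfolding ball_bump_def box_bump_shift
  by (rule test_function_box_bump)
    (use cbox_One_subset_cball[of z \<rho>] assms in \<open>auto simp: add.commute\<close>)

lemma ball_bump_integrable: "integrable lborel (ball_bump \<rho> :: 'a::euclidean_space \<Rightarrow> real)"
  unfolding ball_bump_def
  by (rule continuous_compact_support_integrable(1)[where
      A="- (\<rho> / real DIM('a)) *\<^sub>R One" and B="(\<rho> / real DIM('a)) *\<^sub>R One"])
    (auto intro: smooth_continuous[OF smooth_box_bump] box_bump_eq_0 subsetD[OF box_subset_cbox])

lemma ball_bump_integral_pos:
  assumes "\<rho> > 0"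
  shows "(LINT y|lborel. ball_bump \<rho> (y::'a::euclidean_space)) > 0"
proof -
  let ?B = "box (- (\<rho> / real DIM('a)) *\<^sub>R One) ((\<rho> / real DIM('a)) *\<^sub>R One) :: 'a set"
  have "(LINT y|lborel. ball_bump \<rho> (y::'a)) \<noteq> 0"
  proof
    assume "(LINT y|lborel. ball_bump \<rho> (y::'a)) = 0"
    then have "AE y in lborel. ball_bump \<rho> (y::'a) = 0"
      using integral_nonneg_eq_0_iff_AE[OF ball_bump_integrable] by (auto simp: ball_bump_nonneg)
    then have "AE y in lborel. y \<notin> ?B"
      by eventually_elim (use box_bump_pos[of 1] in \<open>force simp: ball_bump_def\<close>)
    then have "?B \<in> null_sets lborel"
      by (subst AE_iff_null_sets) auto
    then have "negligible ?B"
      by (simp add: negligible_iff_null_sets null_sets_completionI)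
    moreover have "0 \<in> ?B" using assms
      by (auto simp: mem_box One_inner_Basis)
    ultimately show False
      using open_not_negligible[OF open_box] by blast
  qed
  moreover have "(LINT y|lborel. ball_bump \<rho> (y::'a)) \<ge> 0"
    by (simp add: ball_bump_nonneg)
  ultimately show ?thesis by linarith
qed

lemma ball_bump_mult_integrable:
  fixes w :: "'a::euclidean_space \<Rightarrow> real"
  assumes "continuous_on UNIV w"
  shows "integrable lborel (\<lambda>y. w y * ball_bump \<rho> (y - z))"
proof -
  obtain A B where AB: "cball z \<rho> \<subseteq> cbox A B"
    using bounded_subset_cbox_symmetric[OF bounded_cball] by metis
  show ?thesis
  proof (rule continuous_compact_support_integrable(1))
    show "continuous_on UNIV (\<lambda>y. w y * ball_bump \<rho> (y - z))"
      by (auto intro!: continuous_intros assms continuous_on_compose2[OF ball_bump_continuous])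
    fix y assume "y \<notin> cbox A B"
    then have "y \<notin> cball z \<rho>" using AB by blast
    then have "ball_bump \<rho> (y - z) = 0"
      by (intro ball_bump_eq_0) (simp add: dist_norm norm_minus_commute)
    then show "w y * ball_bump \<rho> (y - z) = 0" by simp
  qed
qed

lemma ball_bump_integral_shift:
  "(LINT y|lborel. ball_bump \<rho> (y - z :: 'a)) = (LINT y|lborel. ball_bump \<rho> (y :: 'a::euclidean_space))"
  using integral_lborel_shift[of "ball_bump \<rho>" "- z"]
  by (simp add: borel_measurable_continuous_onI[OF ball_bump_continuous])

lemma mollify_close:
  fixes v :: "'a::euclidean_space \<Rightarrow> real"
  assumes v: "continuous_on UNIV v"
    and close: "\<And>y. y \<in> cball z \<rho> \<Longrightarrow> \<bar>v y - v z\<bar> \<le> \<epsilon>"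
  shows "\<bar>mollify (ball_bump \<rho>) v z - v z * (LINT y|lborel. ball_bump \<rho> (y::'a))\<bar>
    \<le> \<epsilon> * (LINT y|lborel. ball_bump \<rho> (y::'a))"
proof -
  note int = ball_bump_mult_integrable[of _ \<rho> z]
  have "mollify (ball_bump \<rho>) v z - v z * (LINT y|lborel. ball_bump \<rho> (y::'a))
      = (LINT y|lborel. v y * ball_bump \<rho> (y - z)) - (LINT y|lborel. v z * ball_bump \<rho> (y - z))"
    by (simp add: mollify_def ball_bump_integral_shift)
  also have "\<dots> = (LINT y|lborel. (v y - v z) * ball_bump \<rho> (y - z))"
    unfolding left_diff_distrib
    by (rule Bochner_Integration.integral_diff[symmetric]; intro int continuous_intros v)
  finally have "\<bar>mollify (ball_bump \<rho>) v z - v z * (LINT y|lborel. ball_bump \<rho> (y::'a))\<bar>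
      \<le> (LINT y|lborel. \<bar>(v y - v z) * ball_bump \<rho> (y - z)\<bar>)"
    by simp
  also have "\<dots> \<le> (LINT y|lborel. \<epsilon> * ball_bump \<rho> (y - z))"
  proof (rule integral_mono)
    show "integrable lborel (\<lambda>y. \<bar>(v y - v z) * ball_bump \<rho> (y - z)\<bar>)"
      by (intro integrable_abs int continuous_intros v)
    show "integrable lborel (\<lambda>y. \<epsilon> * ball_bump \<rho> (y - z))"
      by (intro int continuous_intros)
    fix y
    show "\<bar>(v y - v z) * ball_bump \<rho> (y - z)\<bar> \<le> \<epsilon> * ball_bump \<rho> (y - z)"
    proof (cases "y \<in> cball z \<rho>")
      case True
      then show ?thesis using close[OF True]
        by (simp add: abs_mult ball_bump_nonneg mult_right_mono)
    next
      case False
      then have "ball_bump \<rho> (y - z) = 0"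
        by (intro ball_bump_eq_0) (simp add: dist_norm norm_minus_commute)
      then show ?thesis by simp
    qed
  qed
  finally show ?thesis by (simp add: ball_bump_integral_shift)
qed

section \<open>Bounded weak gradients give Lipschitz functions\<close>

lemma locally_integrable_mult_compact_support:
  fixes h \<psi> :: "'a::euclidean_space \<Rightarrow> real"
  assumes "open \<Omega>" "locally_integrable \<Omega> h" "compact K" "K \<subseteq> \<Omega>"
    and \<psi>: "continuous_on UNIV \<psi>" "\<And>x. x \<notin> K \<Longrightarrow> \<psi> x = 0"
  shows "integrable (lebesgue_on \<Omega>) (\<lambda>x. h x * \<psi> x)"
proof -
  have "(\<lambda>x. \<psi> x * h x) absolutely_integrable_on K"
  proof (rule absolutely_integrable_bounded_measurable_product[OF bilinear_times])
    show "K \<in> sets lebesgue" using assms(3) by (simp add: borel_compact)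
    then show "\<psi> \<in> borel_measurable (lebesgue_on K)"
      using \<psi>(1) by (intro continuous_imp_measurable_on_sets_lebesgue) (auto intro: continuous_on_subset)
    show "bounded (\<psi> ` K)"
      using \<psi>(1) assms(3) by (intro compact_imp_bounded compact_continuous_image) (auto intro: continuous_on_subset)
    show "h absolutely_integrable_on K" using assms by (auto simp: locally_integrable_def)
  qed
  moreover have "(\<lambda>x. indicator \<Omega> x *\<^sub>R (h x * \<psi> x)) = (\<lambda>x. indicator K x *\<^sub>R (\<psi> x * h x))"
    using assms(4) \<psi>(2) by (auto simp: fun_eq_iff indicator_def)
  ultimately show ?thesis using assms(1)
    by (simp add: integrable_restrict_space set_integrable_def)
qed

lemma locally_integrable_inner:
  "locally_integrable \<Omega> g \<Longrightarrow> locally_integrable \<Omega> (\<lambda>x. g x \<bullet> e)"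
  by (auto simp: locally_integrable_def intro: absolutely_integrable_component)

lemma test_function_not_in_support: "x \<notin> closure {x. \<phi> x \<noteq> (0::real)} \<Longrightarrow> \<phi> x = 0"
  using subsetD[OF closure_subset, of x "{x. \<phi> x \<noteq> 0}"] by blast

lemma test_function_derivative_eq_0:
  assumes "x \<notin> closure {x. \<phi> x \<noteq> (0::real)}"
  shows "frechet_derivative \<phi> (at x) e = 0"
proof -
  have "((\<lambda>_. 0) has_derivative (\<lambda>_. 0)) (at x)" by simp
  then have "(\<phi> has_derivative (\<lambda>_. 0)) (at x)"
  proof (rule has_derivative_transform_within_open)
    show "open (- closure {x. \<phi> x \<noteq> 0})" by (rule open_Compl) (rule closed_closure)
    show "x \<in> - closure {x. \<phi> x \<noteq> 0}" using assms by simp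
    show "0 = \<phi> y" if "y \<in> - closure {x. \<phi> x \<noteq> 0}" for y
      using test_function_not_in_support[of y \<phi>] that by simp
  qed
  then show ?thesis using frechet_derivative_at[of \<phi> "\<lambda>_. 0" x] by (metis)
qed

lemma weak_gradient_direction:
  fixes u :: "'a::euclidean_space \<Rightarrow> real"
  assumes "open \<Omega>" and g: "has_weak_gradient \<Omega> u g" and \<phi>: "test_function \<Omega> \<phi>"
  shows "(LINT x|lebesgue_on \<Omega>. u x * frechet_derivative \<phi> (at x) e)
     = - (LINT x|lebesgue_on \<Omega>. (g x \<bullet> e) * \<phi> x)"
proof -
  let ?K = "closure {x. \<phi> x \<noteq> 0}"
  have K: "compact ?K" "?K \<subseteq> \<Omega>" and sm: "smooth_on UNIV \<phi>" using \<phi> by (auto simp: test_function_def)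
  have loc: "locally_integrable \<Omega> u" "locally_integrable \<Omega> g"
    using g by (auto simp: has_weak_gradient_def)
  have int1: "integrable (lebesgue_on \<Omega>) (\<lambda>x. u x * frechet_derivative \<phi> (at x) b)" for b
    by (rule locally_integrable_mult_compact_support[OF assms(1) loc(1) K])
      (use sm in \<open>auto intro: smooth_continuous_derivative test_function_derivative_eq_0\<close>)
  have int2: "integrable (lebesgue_on \<Omega>) (\<lambda>x. (g x \<bullet> b) * \<phi> x)" for b
    by (rule locally_integrable_mult_compact_support[OF assms(1) locally_integrable_inner[OF loc(2)] K])
      (use sm in \<open>auto intro: smooth_continuous test_function_not_in_support\<close>)
  have "(LINT x|lebesgue_on \<Omega>. u x * frechet_derivative \<phi> (at x) e)
      = (LINT x|lebesgue_on \<Omega>. (\<Sum>b\<in>Basis. (e \<bullet> b) * (u x * frechet_derivative \<phi> (at x) b)))"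
    by (subst frechet_derivative_basis_expansion[OF smooth_linear_derivative[OF sm]])
      (simp add: sum_distrib_left algebra_simps)
  also have "\<dots> = (\<Sum>b\<in>Basis. (e \<bullet> b) * (LINT x|lebesgue_on \<Omega>. u x * frechet_derivative \<phi> (at x) b))"
    using int1 by (simp add: Bochner_Integration.integral_sum)
  also have "\<dots> = (\<Sum>b\<in>Basis. (e \<bullet> b) * - (LINT x|lebesgue_on \<Omega>. (g x \<bullet> b) * \<phi> x))"
    using g \<phi> by (auto simp: has_weak_gradient_def intro!: sum.cong)
  also have "\<dots> = - (LINT x|lebesgue_on \<Omega>. (\<Sum>b\<in>Basis. (e \<bullet> b) * ((g x \<bullet> b) * \<phi> x)))"
    using int2 by (simp add: Bochner_Integration.integral_sum sum_negf)
  also have "(\<lambda>x. \<Sum>b\<in>Basis. (e \<bullet> b) * ((g x \<bullet> b) * \<phi> x)) = (\<lambda>x. (g x \<bullet> e) * \<phi> x)"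
    by (simp add: euclidean_inner[of "g _" e] sum_distrib_right sum_distrib_left mult_ac)
  finally show ?thesis .
qed

lemma frechet_derivative_shift:
  assumes "smooth_on UNIV \<eta>"
  shows "frechet_derivative (\<lambda>y. \<eta> (y - z)) (at y) = frechet_derivative \<eta> (at (y - z :: 'a::euclidean_space))"
proof -
  have "((\<lambda>y. y - z) has_derivative (\<lambda>h. h)) (at y)"
    by (auto intro!: derivative_eq_intros)
  from has_derivative_compose[OF this smooth_has_derivative[OF assms]]
  show ?thesis using frechet_derivative_at by metis
qed

text \<open>
  Along the segment, the derivative of the mollification of \<open>v\<close> is the integral of the weak
  gradient in that direction against a translate of the bump.  It is at most \<open>L\<close> times the length
  of the direction times the mass of the bump, and as the radius of the bump tends to \<open>0\<close> the
  mollification divided by this mass tends to \<open>v\<close>.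
\<close>

lemma weak_gradient_segment_bound:
  fixes u :: "'a::euclidean_space \<Rightarrow> real"
  assumes \<Omega>: "open \<Omega>" "bounded \<Omega>"
    and g: "has_weak_gradient \<Omega> u g" "AE x in lebesgue_on \<Omega>. norm (g x) \<le> L"
    and v: "continuous_on UNIV v" "\<And>x. x \<notin> \<Omega> \<Longrightarrow> v x = 0" "AE x in lebesgue_on \<Omega>. v x = u x"
    and seg: "closed_segment x y \<subseteq> \<Omega>"
  shows "\<bar>v x - v y\<bar> \<le> L * dist x y"
proof (rule field_le_epsilon)
  fix \<epsilon> :: real assume "\<epsilon> > 0"
  obtain A B where AB: "\<Omega> \<subseteq> cbox A B"
    using bounded_subset_cbox_symmetric[OF \<Omega>(2)] by metis
  obtain r0 where r0: "r0 > 0" "(\<Union>z\<in>closed_segment x y. cball z r0) \<subseteq> \<Omega>"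
    using compact_subset_open_imp_cball_epsilon_subset[OF compact_segment \<Omega>(1) seg] by metis
  have "\<exists>r>0. \<forall>y. dist y z < r \<longrightarrow> dist (v y) (v z) < \<epsilon> / 2" for z
    using v(1) \<open>\<epsilon> > 0\<close> by (metis continuous_on_iff UNIV_I half_gt_zero)
  then obtain r where r: "\<And>z. r z > 0" "\<And>z y. dist y z < r z \<Longrightarrow> dist (v y) (v z) < \<epsilon> / 2"
    by metis
  define \<rho> where "\<rho> = min r0 (min (r x) (r y) / 2)"
  have "\<rho> > 0" using r0 r by (simp add: \<rho>_def)
  have sub: "cball z \<rho> \<subseteq> \<Omega>" if "z \<in> closed_segment x y" for z
    using r0(2) that by (fastforce simp: \<rho>_def)
  define \<eta> where "\<eta> = (ball_bump \<rho> :: 'a \<Rightarrow> real)"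
  note \<eta>s = ball_bump_smooth[of \<rho>, where 'a='a, folded \<eta>_def]
  define I where "I = (LINT y|lborel. \<eta> y)"
  have "I > 0" unfolding I_def \<eta>_def by (rule ball_bump_integral_pos) fact
  define e where "e = y - x"
  define D where "D s = - (LINT y|lborel. v y * frechet_derivative \<eta> (at (y - (x + s *\<^sub>R e))) e)" for s
  have bound: "\<bar>D s\<bar> \<le> L * norm e * I" if "s \<in> {0..1}" for s
  proof -
    define z where "z = x + s *\<^sub>R e"
    define \<phi> where "\<phi> = (\<lambda>y. \<eta> (y - z))"
    have "z \<in> closed_segment x y"
      using that by (auto simp: z_def e_def in_segment algebra_simps intro!: exI[of _ s])
    then have test: "test_function \<Omega> \<phi>"
      unfolding \<phi>_def \<eta>_def by (intro test_function_ball_bump sub)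
    let ?K = "closure {x. \<phi> x \<noteq> 0}"
    have K: "compact ?K" "?K \<subseteq> \<Omega>" and sm: "smooth_on UNIV \<phi>" using test by (auto simp: test_function_def)
    have \<phi>zero: "\<phi> y = 0" if "y \<notin> \<Omega>" for y
      using test_function_not_in_support[of y \<phi>] K that by blast
    have contD: "continuous_on UNIV (\<lambda>y. frechet_derivative \<phi> (at y) e)"
      by (rule smooth_continuous_derivative[OF sm])
    have "(LINT y|lborel. v y * frechet_derivative \<phi> (at y) e)
        = (LINT y|lebesgue_on \<Omega>. v y * frechet_derivative \<phi> (at y) e)"
      by (rule integral_lebesgue_on_eq_lborel[symmetric])
         (use \<Omega> v contD in \<open>auto intro!: borel_measurable_continuous_onI continuous_intros\<close>)
    also have "\<dots> = (LINT y|lebesgue_on \<Omega>. u y * frechet_derivative \<phi> (at y) e)"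
    proof (rule Bochner_Integration.integral_cong_AE)
      have [measurable]: "v \<in> borel_measurable (lebesgue_on \<Omega>)"
        "(\<lambda>y. frechet_derivative \<phi> (at y) e) \<in> borel_measurable (lebesgue_on \<Omega>)"
        using \<Omega>(1) v(1) contD
        by (auto intro!: continuous_imp_measurable_on_sets_lebesgue intro: continuous_on_subset)
      show "(\<lambda>y. v y * frechet_derivative \<phi> (at y) e) \<in> borel_measurable (lebesgue_on \<Omega>)"
        by measurable
      show "(\<lambda>y. u y * frechet_derivative \<phi> (at y) e) \<in> borel_measurable (lebesgue_on \<Omega>)"
        by (rule borel_measurable_integrable,
            rule locally_integrable_mult_compact_support[OF \<Omega>(1) _ K contD])
           (use g(1) in \<open>auto simp: has_weak_gradient_def intro: test_function_derivative_eq_0\<close>)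
      show "AE y in lebesgue_on \<Omega>. v y * frechet_derivative \<phi> (at y) e = u y * frechet_derivative \<phi> (at y) e"
        using v(3) by eventually_elim simp
    qed
    also have "\<dots> = - (LINT y|lebesgue_on \<Omega>. (g y \<bullet> e) * \<phi> y)"
      by (rule weak_gradient_direction[OF \<Omega>(1) g(1) test])
    finally have "D s = (LINT y|lebesgue_on \<Omega>. (g y \<bullet> e) * \<phi> y)"
      by (simp add: D_def \<phi>_def frechet_derivative_shift[OF \<eta>s] z_def)
    then have "\<bar>D s\<bar> \<le> (LINT y|lebesgue_on \<Omega>. \<bar>(g y \<bullet> e) * \<phi> y\<bar>)"
      by simp
    also have "\<dots> \<le> (LINT y|lebesgue_on \<Omega>. (L * norm e) * \<phi> y)"
    proof (rule integral_mono_AE)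
      show "integrable (lebesgue_on \<Omega>) (\<lambda>y. \<bar>(g y \<bullet> e) * \<phi> y\<bar>)"
        by (rule integrable_abs,
            rule locally_integrable_mult_compact_support[OF \<Omega>(1) locally_integrable_inner K smooth_continuous[OF sm]])
           (use g(1) in \<open>auto simp: has_weak_gradient_def intro: test_function_not_in_support\<close>)
      have "locally_integrable \<Omega> (\<lambda>y. L * norm e)"
        by (auto simp: locally_integrable_def intro!: absolutely_integrable_on_const lmeasurable_compact)
      then show "integrable (lebesgue_on \<Omega>) (\<lambda>y. (L * norm e) * \<phi> y)"
        by (rule locally_integrable_mult_compact_support[OF \<Omega>(1) _ K smooth_continuous[OF sm]])
           (auto intro: test_function_not_in_support)
      show "AE y in lebesgue_on \<Omega>. \<bar>(g y \<bullet> e) * \<phi> y\<bar> \<le> (L * norm e) * \<phi> y"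
        using g(2)
      proof eventually_elim
        fix y assume "norm (g y) \<le> L"
        then have "\<bar>g y \<bullet> e\<bar> \<le> L * norm e"
          by (meson Cauchy_Schwarz_ineq2 mult_right_mono norm_ge_zero order_trans)
        moreover have "\<phi> y \<ge> 0" by (simp add: \<phi>_def \<eta>_def ball_bump_nonneg)
        ultimately show "\<bar>(g y \<bullet> e) * \<phi> y\<bar> \<le> (L * norm e) * \<phi> y"
          by (simp add: abs_mult mult_right_mono)
      qed
    qed
    also have "\<dots> = L * norm e * (LINT y|lebesgue_on \<Omega>. \<phi> y)" by simp
    also have "(LINT y|lebesgue_on \<Omega>. \<phi> y) = (LINT y|lborel. \<phi> y)"
      by (rule integral_lebesgue_on_eq_lborel)
         (use \<Omega> \<phi>zero smooth_continuous[OF sm] in \<open>auto intro!: borel_measurable_continuous_onI\<close>)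
    also have "\<dots> = I"
      by (simp add: \<phi>_def \<eta>_def I_def ball_bump_integral_shift)
    finally show ?thesis .
  qed
  have "norm (mollify \<eta> v (x + 1 *\<^sub>R e) - mollify \<eta> v (x + 0 *\<^sub>R e)) \<le> L * norm e * I * norm (1 - 0 :: real)"
  proof (rule field_differentiable_bound[where S="{0..1}" and f="\<lambda>s. mollify \<eta> v (x + s *\<^sub>R e)" and f'=D])
    fix s :: real assume "s \<in> {0..1}"
    show "((\<lambda>s. mollify \<eta> v (x + s *\<^sub>R e)) has_field_derivative D s) (at s within {0..1})"
      unfolding D_def
      by (rule has_field_derivative_at_within, rule mollify_DERIV_line[OF \<eta>s v(1), of A B])
         (use v(2) AB in auto)
    show "norm (D s) \<le> L * norm e * I" using bound[OF \<open>s \<in> _\<close>] by simp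
  qed auto
  then have 1: "\<bar>mollify \<eta> v y - mollify \<eta> v x\<bar> \<le> L * dist x y * I"
    by (simp add: e_def dist_norm norm_minus_commute)
  have 2: "\<bar>mollify \<eta> v z - v z * I\<bar> \<le> \<epsilon> / 2 * I" if "z \<in> {x, y}" for z
    unfolding \<eta>_def I_def
  proof (rule mollify_close[OF v(1)])
    fix w assume "w \<in> cball z \<rho>"
    moreover have "\<rho> < r z" using that r(1)[of x] r(1)[of y] by (auto simp: \<rho>_def)
    ultimately have "dist w z < r z" by (simp add: dist_commute)
    from r(2)[OF this] show "\<bar>v w - v z\<bar> \<le> \<epsilon> / 2" by (simp add: dist_real_def)
  qed
  have "\<bar>v x * I - v y * I\<bar> \<le> (L * dist x y + \<epsilon>) * I"
  proof -
    have "(L * dist x y + \<epsilon>) * I = L * dist x y * I + \<epsilon> / 2 * I + \<epsilon> / 2 * I"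
      by (simp add: algebra_simps)
    moreover have "\<bar>mollify \<eta> v x - v x * I\<bar> \<le> \<epsilon> / 2 * I" "\<bar>mollify \<eta> v y - v y * I\<bar> \<le> \<epsilon> / 2 * I"
      using 2 by blast+
    ultimately show ?thesis using 1 by linarith
  qed
  then have "\<bar>v x - v y\<bar> * I \<le> (L * dist x y + \<epsilon>) * I"
    using \<open>I > 0\<close> by (simp add: left_diff_distrib[symmetric] abs_mult)
  then show "\<bar>v x - v y\<bar> \<le> L * dist x y + \<epsilon>" using \<open>I > 0\<close> by simp
qed

text \<open>
  If the segment from \<open>x\<close> to \<open>y\<close> leaves \<open>\<Omega>\<close>, let \<open>x'\<close> and \<open>y'\<close> be the points of the segment
  outside \<open>\<Omega>\<close> that are nearest to \<open>x\<close> and to \<open>y\<close>.  The function vanishes there, and the two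
  outer pieces of the segment are disjoint, so \<open>\<bar>v x\<bar> + \<bar>v y\<bar> \<le> L * dist x y\<close>.
\<close>

lemma lipschitz_from_segments:
  fixes v :: "'a::euclidean_space \<Rightarrow> real"
  assumes "open \<Omega>" "0 \<le> L"
    and v: "continuous_on UNIV v" "\<And>x. x \<notin> \<Omega> \<Longrightarrow> v x = 0"
    and seg: "\<And>x y. closed_segment x y \<subseteq> \<Omega> \<Longrightarrow> \<bar>v x - v y\<bar> \<le> L * dist x y"
  shows "L-lipschitz_on UNIV v"
proof -
  have exit: "\<bar>v x\<bar> \<le> L * dist x x'"
    if x': "x' \<in> D" "\<And>z. z \<in> D \<Longrightarrow> dist x x' \<le> dist x z" and D: "D = closed_segment x y - \<Omega>" for x x' y D
  proof (cases "x = x'")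
    case True
    then show ?thesis using that v(2) by simp
  next
    case False
    have in_seg: "x' \<in> closed_segment x y" "x' \<notin> \<Omega>" using that by auto
    have sub: "closed_segment x z \<subseteq> \<Omega>" if z: "z \<in> open_segment x x'" for z
    proof
      fix w assume w: "w \<in> closed_segment x z"
      have "z \<in> closed_segment x y"
        using z in_seg(1) closed_segment_subset[OF ends_in_segment(1) in_seg(1)] segment_open_subset_closed[of x x'] by auto
      then have "w \<in> closed_segment x y"
        using w closed_segment_subset[OF ends_in_segment(1), of z] by auto
      moreover have "dist x w < dist x x'"
        using dist_in_closed_segment[OF w] dist_in_open_segment[OF z] by (simp add: dist_commute)
      ultimately show "w \<in> \<Omega>" using x'(2)[of w] D by force
    qed
    have "x' \<in> closure (open_segment x x')" using False by (simp add: closure_open_segment)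
    moreover have "closure (open_segment x x') \<subseteq> {z. \<bar>v x - v z\<bar> \<le> L * dist x z}"
    proof (rule closure_minimal)
      show "closed {z. \<bar>v x - v z\<bar> \<le> L * dist x z}"
        by (intro closed_Collect_le continuous_intros v(1))
    qed (use sub seg in auto)
    ultimately show ?thesis using v(2) in_seg by auto
  qed
  show ?thesis
  proof (rule lipschitz_onI)
    fix x y :: 'a
    show "dist (v x) (v y) \<le> L * dist x y"
    proof (cases "closed_segment x y \<subseteq> \<Omega>")
      case True
      then show ?thesis using seg by (simp add: dist_real_def)
    next
      case False
      define D where "D = closed_segment x y - \<Omega>"
      have D: "compact D" "D \<noteq> {}" "D = closed_segment y x - \<Omega>"
        using False assms(1) by (auto simp: D_def closed_segment_commute intro: compact_diff)
      obtain x' where x': "x' \<in> D" "\<And>z. z \<in> D \<Longrightarrow> dist x x' \<le> dist x z"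
        using distance_attains_inf[OF compact_imp_closed[OF D(1)] D(2), of x] by metis
      obtain y' where y': "y' \<in> D" "\<And>z. z \<in> D \<Longrightarrow> dist y y' \<le> dist y z"
        using distance_attains_inf[OF compact_imp_closed[OF D(1)] D(2), of y] by metis
      have "\<bar>v x\<bar> \<le> L * dist x x'" "\<bar>v y\<bar> \<le> L * dist y y'"
        using exit[OF x' D_def] exit[OF y' D(3)] by auto
      then have "\<bar>v x - v y\<bar> \<le> L * (dist x x' + dist y y')" by (simp add: algebra_simps)
      also have "dist x x' + dist y y' \<le> dist x y' + dist y' y"
        using x'(2)[OF y'(1)] by (simp add: dist_commute)
      also have "\<dots> = dist x y"
        using y'(1) between between_mem_segment by (metis D_def DiffD1)
      finally show ?thesis using assms(2) by (simp add: dist_real_def mult_left_mono)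
    qed
  qed fact
qed

lemma zero_extension_continuous:
  fixes v :: "'a::euclidean_space \<Rightarrow> real"
  assumes "continuous_on (closure \<Omega>) v" "\<And>x. x \<in> frontier \<Omega> \<Longrightarrow> v x = 0" "open \<Omega>"
  shows "continuous_on UNIV (\<lambda>x. if x \<in> \<Omega> then v x else 0)"
proof -
  have "continuous_on (closure \<Omega> \<union> - \<Omega>) (\<lambda>x. if x \<in> \<Omega> then v x else 0)"
    by (rule continuous_on_cases) (use assms in \<open>auto simp: frontier_def interior_open closed_Compl\<close>)
  moreover have "closure \<Omega> \<union> - \<Omega> = UNIV" using closure_subset by fast
  ultimately show ?thesis by simp
qed

lemma W1inf0_lipschitz_representative:
  fixes u :: "'a::euclidean_space \<Rightarrow> real"
  assumes \<Omega>: "open \<Omega>" "bounded \<Omega>" and u: "u \<in> W1inf0 \<Omega>"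
    and L: "Linf_norm \<Omega> (weak_gradient \<Omega> u) \<le> ereal L" "0 \<le> L"
  obtains v where "L-lipschitz_on UNIV v" "\<And>x. x \<notin> \<Omega> \<Longrightarrow> v x = 0" "AE x in lebesgue_on \<Omega>. u x = v x"
proof -
  obtain v where v: "continuous_on (closure \<Omega>) v" "AE x in lebesgue_on \<Omega>. v x = u x"
      "\<forall>x\<in>frontier \<Omega>. v x = 0"
    using u by (auto simp: W1inf0_def)
  define w where "w = (\<lambda>x. if x \<in> \<Omega> then v x else 0)"
  have w: "continuous_on UNIV w" "\<And>x. x \<notin> \<Omega> \<Longrightarrow> w x = 0"
    unfolding w_def using zero_extension_continuous[OF v(1) _ \<Omega>(1)] v(3) by auto
  have wu: "AE x in lebesgue_on \<Omega>. w x = u x"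
    using v(2) AE_space[of "lebesgue_on \<Omega>"] by eventually_elim (simp add: w_def)
  obtain g where "has_weak_gradient \<Omega> u g" using u by (auto simp: W1inf0_def W1inf_def)
  then have g: "has_weak_gradient \<Omega> u (weak_gradient \<Omega> u)"
    unfolding weak_gradient_def by (rule someI[of "has_weak_gradient \<Omega> u"])
  have "AE x in lebesgue_on \<Omega>. ereal (norm (weak_gradient \<Omega> u x)) \<le> Linf_norm \<Omega> (weak_gradient \<Omega> u)"
    unfolding Linf_norm_def by (rule esssup_AE)
  then have "AE x in lebesgue_on \<Omega>. norm (weak_gradient \<Omega> u x) \<le> L"
    by eventually_elim (use L(1) in \<open>metis ereal_less_eq(3) order_trans\<close>)
  then have "L-lipschitz_on UNIV w"
    by (intro lipschitz_from_segments[OF \<Omega>(1) L(2) w] weak_gradient_segment_bound[OF \<Omega> g _ w wu])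
  then show ?thesis using that w(2) wu by (metis (mono_tags, lifting) AE_cong)
qed

section \<open>Uniqueness of weak gradients\<close>

text \<open>
  The open boxes are stable under intersection and generate the Borel sets, so the integral
  vanishes over every Borel set.
\<close>

lemma AE_eq_0_from_box_integrals:
  fixes F :: "'a::euclidean_space \<Rightarrow> real"
  assumes int: "integrable lborel F"
    and total: "(LINT x|lborel. F x) = 0"
    and box: "\<And>a b. (LINT x:box a b|lborel. F x) = 0"
  shows "AE x in lborel. F x = 0"
proof (rule sigma_finite_measure.density_zero[OF sigma_finite_lborel int])
  fix A assume "A \<in> sets (lborel :: 'a measure)"
  then have "A \<in> sigma_sets UNIV (range (\<lambda>(a, b). box a b :: 'a set))"
    by (simp add: borel_eq_box)
  have seti: "set_integrable lborel B F" if "B \<in> sets borel" for B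
    using int that by (simp add: set_integrable_def integrable_mult_indicator del: indicator_scaleR_eq_if real_scaleR_def)
  have sets: "B \<in> sets borel" if "B \<in> sigma_sets UNIV (range (\<lambda>(a, b). box a b :: 'a set))" for B
    using that by (simp add: borel_eq_box)
  have "Int_stable (range (\<lambda>(a, b). box a b :: 'a set))"
    by (auto simp: Int_stable_def box_Int_box)
  then show "(LINT x:A|lborel. F x) = 0"
    using _ \<open>A \<in> sigma_sets _ _\<close>
  proof (rule sigma_sets_induct_disjoint)
    show "(LINT x:{}|lborel. F x) = 0" by (simp add: set_lebesgue_integral_def)
    show "(LINT x:B|lborel. F x) = 0" if "B \<in> range (\<lambda>(a, b). box a b)" for B
      using that box by auto
    fix B assume B: "B \<in> sigma_sets UNIV (range (\<lambda>(a, b). box a b :: 'a set))" "(LINT x:B|lborel. F x) = 0"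
    have "(LINT x:UNIV|lborel. F x) = (LINT x:B|lborel. F x) + (LINT x:UNIV - B|lborel. F x)"
      using set_integral_Un[of B "UNIV - B" lborel F] seti sets[OF B(1)] by simp
    then show "(LINT x:UNIV - B|lborel. F x) = 0"
      using B(2) total by (simp add: set_lebesgue_integral_def)
  next
    fix B :: "nat \<Rightarrow> 'a set"
    assume B: "disjoint_family B" "range B \<subseteq> sigma_sets UNIV (range (\<lambda>(a, b). box a b))"
      "\<And>i. (LINT x:B i|lborel. F x) = 0"
    have "(LINT x:(\<Union>i. B i)|lborel. F x) = (\<Sum>i. (LINT x:(B i)|lborel. F x))"
    proof (rule lebesgue_integral_countable_add)
      show "B i \<in> sets lborel" for i using B(2) sets[of "B i"] by auto
      then show "set_integrable lborel (\<Union>i. B i) F" by (intro seti) auto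
    qed (use B(1) in \<open>auto simp: disjoint_family_on_def\<close>)
    then show "(LINT x:(\<Union>i. B i)|lborel. F x) = 0" using B(3) by simp
  qed simp
qed

text \<open>
  The bumps converge to the indicator function of the open box as their steepness grows.
\<close>

lemma fundamental_lemma_box:
  fixes h :: "'a::euclidean_space \<Rightarrow> real"
  assumes "open \<Omega>" and h: "locally_integrable \<Omega> h"
    and zero: "\<And>\<phi>. test_function \<Omega> \<phi> \<Longrightarrow> (LINT x|lebesgue_on \<Omega>. h x * \<phi> x) = 0"
    and sub: "cbox a b \<subseteq> \<Omega>"
  shows "(LINT x|lebesgue. indicator (box a b) x * h x) = 0"
proof -
  have int: "integrable lebesgue (\<lambda>x. indicator (cbox a b) x * h x)"
    using h sub by (auto simp: locally_integrable_def set_integrable_def)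
  define s where "s k x = box_bump (real (Suc k)) a b x * (indicator (cbox a b) x * h x)" for k x
  have "(\<lambda>k. LINT x|lebesgue. s k x) \<longlonglongrightarrow> (LINT x|lebesgue. indicator (box a b) x * (indicator (cbox a b) x * h x))"
  proof (rule integral_dominated_convergence)
    show "(\<lambda>x. indicator (box a b) x * (indicator (cbox a b) x * h x)) \<in> borel_measurable lebesgue"
      using int by (intro borel_measurable_times[OF borel_measurable_indicator] borel_measurable_integrable) auto
    show "s k \<in> borel_measurable lebesgue" for k
      unfolding s_def
      by (intro borel_measurable_times borel_measurable_integrable[OF int] continuous_imp_measurable_on_sets_lebesgue[where S=UNIV, simplified lebesgue_on_UNIV_eq]
          smooth_continuous[OF smooth_box_bump]) auto
    show "integrable lebesgue (\<lambda>x. \<bar>indicator (cbox a b) x * h x\<bar>)"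
      by (rule integrable_abs[OF int])
    show "AE x in lebesgue. (\<lambda>k. s k x) \<longlonglongrightarrow> indicator (box a b) x * (indicator (cbox a b) x * h x)"
      unfolding s_def by (intro AE_I2 tendsto_mult tendsto_const LIMSEQ_Suc[OF box_bump_tendsto])
    show "AE x in lebesgue. norm (s k x) \<le> \<bar>indicator (cbox a b) x * h x\<bar>" for k
    proof (rule AE_I2)
      fix x
      have "\<bar>box_bump (real (Suc k)) a b x\<bar> * \<bar>indicator (cbox a b) x * h x\<bar> \<le> 1 * \<bar>indicator (cbox a b) x * h x\<bar>"
        using box_bump_le_1[of "real (Suc k)" a b x] box_bump_nonneg[of "real (Suc k)" a b x]
        by (intro mult_right_mono) auto
      then show "norm (s k x) \<le> \<bar>indicator (cbox a b) x * h x\<bar>"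
        by (simp only: s_def real_norm_def abs_mult mult_1)
    qed
  qed
  moreover have "(LINT x|lebesgue. s k x) = 0" for k
  proof -
    have "(LINT x|lebesgue_on \<Omega>. h x * box_bump (real (Suc k)) a b x)
        = (LINT x|lebesgue. indicator \<Omega> x *\<^sub>R (h x * box_bump (real (Suc k)) a b x))"
      using assms(1) by (intro integral_restrict_space) auto
    also have "(\<lambda>x. indicator \<Omega> x *\<^sub>R (h x * box_bump (real (Suc k)) a b x)) = s k"
    proof
      fix x
      show "indicator \<Omega> x *\<^sub>R (h x * box_bump (real (Suc k)) a b x) = s k x"
        using sub box_bump_eq_0[of "real (Suc k)" x a b] box_subset_cbox[of a b]
        by (cases "x \<in> cbox a b") (auto simp: s_def indicator_def)
    qed
    finally show ?thesis using zero[OF test_function_box_bump[OF _ sub, of "real (Suc k)"]] by simp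
  qed
  moreover have "(\<lambda>x. indicator (box a b) x * (indicator (cbox a b) x * h x)) = (\<lambda>x. indicator (box a b) x * h x)"
    using box_subset_cbox[of a b] by (auto simp: fun_eq_iff indicator_def)
  ultimately show ?thesis by (simp add: LIMSEQ_const_iff)
qed

text \<open>
  An open set is a countable union of closed boxes, and on each of them the previous two lemmas
  apply.  As \<open>h\<close> is Lebesgue measurable only, it is first replaced by a Borel function.
\<close>

lemma fundamental_lemma_calculus_variations:
  fixes h :: "'a::euclidean_space \<Rightarrow> real"
  assumes \<Omega>: "open \<Omega>" and h: "locally_integrable \<Omega> h"
    and zero: "\<And>\<phi>. test_function \<Omega> \<phi> \<Longrightarrow> (LINT x|lebesgue_on \<Omega>. h x * \<phi> x) = 0"
  shows "AE x in lebesgue_on \<Omega>. h x = 0"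
proof -
  have fb: "(LINT x|lebesgue. indicator (box a b) x * h x) = 0" if "cbox a b \<subseteq> \<Omega>" for a b
    by (rule fundamental_lemma_box[OF \<Omega> h zero that])
  have on_box: "AE x in lebesgue. x \<in> cbox a b \<longrightarrow> h x = 0" if sub: "cbox a b \<subseteq> \<Omega>" for a b
  proof -
    let ?H = "\<lambda>x. indicator (box a b) x * h x"
    have "integrable lebesgue (\<lambda>x. indicator (cbox a b) x * h x)"
      using h sub by (auto simp: locally_integrable_def set_integrable_def)
    from integrable_mult_indicator[OF _ this, of "box a b"]
    have "integrable lebesgue (\<lambda>x. indicator (box a b) x * (indicator (cbox a b) x * h x))" by simp
    moreover have "(\<lambda>x. indicator (box a b) x * (indicator (cbox a b) x * h x)) = ?H"
      using box_subset_cbox[of a b] by (auto simp: fun_eq_iff indicator_def)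
    ultimately have intH: "integrable lebesgue ?H" by simp
    then obtain F where F: "F \<in> borel_measurable lborel" "AE x in lborel. ?H x = F x"
      using completion_ex_borel_measurable_real[of ?H lborel] by auto
    have F': "AE x in lebesgue. ?H x = F x" using F(2) by (rule AE_completion)
    have Fm: "F \<in> borel_measurable lebesgue" using F(1) by (rule measurable_completion)
    have "integrable lebesgue F"
      using intH F' Fm by (subst integrable_cong_AE[of _ _ ?H]) auto
    then have intF: "integrable lborel F" using F(1) by (simp add: integrable_completion)
    have tot: "(LINT x|lborel. F x) = 0"
    proof -
      have "(LINT x|lborel. F x) = (LINT x|lebesgue. F x)"
        using F(1) by (simp add: integral_completion)
      also have "\<dots> = (LINT x|lebesgue. ?H x)"
        using intH F' Fm by (intro integral_cong_AE) auto
      finally show ?thesis using fb[OF sub] by simp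
    qed
    have "AE x in lborel. F x = 0"
    proof (rule AE_eq_0_from_box_integrals[OF intF tot])
      fix c d :: 'a
      obtain p q where pq: "box a b \<inter> box c d = box p q" by (rule that[OF box_Int_box])
      have "(LINT x:box c d|lborel. F x) = (LINT x|lebesgue. indicator (box c d) x * F x)"
        unfolding set_lebesgue_integral_def using F(1)
        by (subst integral_completion) auto
      also have "\<dots> = (LINT x|lebesgue. indicator (box p q) x * h x)"
      proof (rule integral_cong_AE)
        show "(\<lambda>x. indicator (box c d) x * F x) \<in> borel_measurable lebesgue"
          using Fm by (intro borel_measurable_times borel_measurable_indicator) auto
        have "(\<lambda>x. indicator (box c d) x * ?H x) \<in> borel_measurable lebesgue"
          by (intro borel_measurable_times[OF borel_measurable_indicator] borel_measurable_integrable[OF intH]) auto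
        also have "(\<lambda>x. indicator (box c d) x * ?H x) = (\<lambda>x. indicator (box p q) x * h x)"
          unfolding pq[symmetric] indicator_inter_arith by (simp only: mult_ac)
        finally show "(\<lambda>x. indicator (box p q) x * h x) \<in> borel_measurable lebesgue" .
        show "AE x in lebesgue. indicator (box c d) x * F x = indicator (box p q) x * h x"
          using F'
        proof eventually_elim
          fix x assume "?H x = F x"
          then have e: "F x = ?H x" by (rule sym)
          show "indicator (box c d) x * F x = indicator (box p q) x * h x"
            unfolding e pq[symmetric] indicator_inter_arith by (simp only: mult_ac)
        qed
      qed
      also have "\<dots> = 0"
      proof (cases "box p q = {}")
        case False
        then have "cbox p q = closure (box p q)" by (rule closure_box[symmetric])
        also have "\<dots> \<subseteq> cbox a b"
          unfolding pq[symmetric] using box_subset_cbox[of a b] by (intro closure_minimal) auto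
        finally show ?thesis using sub by (intro fb) auto
      qed simp
      finally show "(LINT x:box c d|lborel. F x) = 0" .
    qed
    then have "AE x in lebesgue. F x = 0" by (rule AE_completion)
    moreover have "AE x in lebesgue. x \<notin> cbox a b - box a b"
      by (rule AE_not_in) (use negligible_frontier_interval in \<open>simp add: negligible_iff_null_sets\<close>)
    ultimately show ?thesis using F'
      by eventually_elim (auto simp: indicator_def split: if_splits)
  qed
  obtain \<D> where D: "countable \<D>" "\<And>X. X \<in> \<D> \<Longrightarrow> X \<subseteq> \<Omega>" "\<And>X. X \<in> \<D> \<Longrightarrow> \<exists>a b. X = cbox a b" "\<Union>\<D> = \<Omega>"
    using open_countable_Union_open_cbox[OF \<Omega>] by (metis PowD subsetD)
  have "AE x in lebesgue. \<forall>X\<in>\<D>. x \<in> X \<longrightarrow> h x = 0"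
    using D by (subst AE_ball_countable[OF D(1)]) (metis on_box)
  then have "AE x in lebesgue. x \<in> \<Omega> \<longrightarrow> h x = 0"
    by eventually_elim (use D(4) in auto)
  then show ?thesis using \<Omega> by (simp add: AE_restrict_space_iff)
qed

text \<open>
  This determines the choice in \<open>weak_gradient\<close> up to null sets.
\<close>

lemma weak_gradient_unique:
  fixes u :: "'a::euclidean_space \<Rightarrow> real"
  assumes \<Omega>: "open \<Omega>" and g: "has_weak_gradient \<Omega> u g" "has_weak_gradient \<Omega> u g'"
  shows "AE x in lebesgue_on \<Omega>. g x = g' x"
proof -
  have loc: "locally_integrable \<Omega> (\<lambda>x. g x \<bullet> b)" "locally_integrable \<Omega> (\<lambda>x. g' x \<bullet> b)" for b
    using g by (auto simp: has_weak_gradient_def intro: locally_integrable_inner)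
  have "AE x in lebesgue_on \<Omega>. g x \<bullet> b - g' x \<bullet> b = 0" if b: "b \<in> Basis" for b
  proof (rule fundamental_lemma_calculus_variations[OF \<Omega>])
    show "locally_integrable \<Omega> (\<lambda>x. g x \<bullet> b - g' x \<bullet> b)"
      using loc[of b] by (auto simp: locally_integrable_def)
    fix \<phi> assume \<phi>: "test_function \<Omega> \<phi>"
    let ?K = "closure {x. \<phi> x \<noteq> 0}"
    have K: "compact ?K" "?K \<subseteq> \<Omega>" and sm: "smooth_on UNIV \<phi>" using \<phi> by (auto simp: test_function_def)
    have int: "integrable (lebesgue_on \<Omega>) (\<lambda>x. (g x \<bullet> b) * \<phi> x)" "integrable (lebesgue_on \<Omega>) (\<lambda>x. (g' x \<bullet> b) * \<phi> x)"
      by (rule locally_integrable_mult_compact_support[OF \<Omega> _ K smooth_continuous[OF sm]];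
          use loc test_function_not_in_support[of _ \<phi>] in blast)+
    have "(LINT x|lebesgue_on \<Omega>. (g x \<bullet> b) * \<phi> x) = (LINT x|lebesgue_on \<Omega>. (g' x \<bullet> b) * \<phi> x)"
      using weak_gradient_direction[OF \<Omega> g(1) \<phi>, of b] weak_gradient_direction[OF \<Omega> g(2) \<phi>, of b] by linarith
    then show "(LINT x|lebesgue_on \<Omega>. (g x \<bullet> b - g' x \<bullet> b) * \<phi> x) = 0"
      unfolding left_diff_distrib by (subst Bochner_Integration.integral_diff[OF int]) auto
  qed
  then have "AE x in lebesgue_on \<Omega>. \<forall>b\<in>Basis. g x \<bullet> b - g' x \<bullet> b = 0"
    by (rule AE_finite_allI[OF finite_Basis])
  then show ?thesis
    by eventually_elim (auto intro: euclidean_eqI)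
qed

section \<open>Approximation of Lipschitz functions\<close>

lemma DERIV_abs_le_of_lipschitz:
  fixes f :: "real \<Rightarrow> real"
  assumes "(f has_real_derivative D) (at s)" "\<And>t. \<bar>f t - f s\<bar> \<le> C * \<bar>t - s\<bar>"
  shows "\<bar>D\<bar> \<le> C"
proof -
  have "((\<lambda>t. \<bar>(f t - f s) / (t - s)\<bar>) \<longlongrightarrow> \<bar>D\<bar>) (at s)"
    using assms(1) by (intro tendsto_rabs) (simp add: has_field_derivative_iff)
  then show ?thesis
    by (rule tendsto_upperbound)
      (use assms(2) in \<open>auto simp: eventually_at_filter abs_divide divide_le_eq\<close>)
qed

lemma continuous_on_mollify:
  fixes S \<kappa> :: "'a::euclidean_space \<Rightarrow> real"
  assumes S: "continuous_on UNIV S" "\<And>y. y \<notin> cbox A B \<Longrightarrow> S y = 0" and \<kappa>: "continuous_on UNIV \<kappa>"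
  shows "continuous_on UNIV (mollify \<kappa> S)"
proof -
  have eq: "mollify \<kappa> S x = integral (cbox A B) (\<lambda>y. S y * \<kappa> (y - x))" for x
    unfolding mollify_def
    by (rule continuous_compact_support_integrable(2))
      (use S(2) in \<open>auto intro!: continuous_intros S continuous_on_compose2[OF \<kappa>]\<close>)
  show ?thesis unfolding eq[abs_def]
    by (rule integral_continuous_on_param)
      (auto simp: split_beta intro!: continuous_intros continuous_on_compose2[OF S(1)] continuous_on_compose2[OF \<kappa>])
qed

lemma mollify_lipschitz:
  fixes S :: "'a::euclidean_space \<Rightarrow> real"
  assumes S: "L-lipschitz_on UNIV S"
  shows "\<bar>mollify (ball_bump \<rho>) S x - mollify (ball_bump \<rho>) S y\<bar>
    \<le> L * dist x y * (LINT z|lborel. ball_bump \<rho> (z::'a))"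
proof -
  have cont: "continuous_on UNIV S" using S by (rule lipschitz_on_continuous_on)
  have eq: "mollify (ball_bump \<rho>) S x = (LINT z|lborel. S (x + z) * ball_bump \<rho> z)" for x
    using integral_lborel_shift[of "\<lambda>y. S y * ball_bump \<rho> (y - x)" x]
    by (simp add: mollify_def borel_measurable_continuous_onI continuous_intros cont
        continuous_on_compose2[OF ball_bump_continuous])
  have int: "integrable lborel (\<lambda>z. w z * ball_bump \<rho> z)" if "continuous_on UNIV w" for w :: "'a \<Rightarrow> real"
    using ball_bump_mult_integrable[OF that, of \<rho> 0] by simp
  have c: "continuous_on UNIV (\<lambda>z. S (x + z))" for x
    by (auto intro!: continuous_on_compose2[OF cont] continuous_intros)
  have "mollify (ball_bump \<rho>) S x - mollify (ball_bump \<rho>) S y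
      = (LINT z|lborel. (S (x + z) - S (y + z)) * ball_bump \<rho> z)"
    unfolding eq left_diff_distrib
    by (rule Bochner_Integration.integral_diff[symmetric]; intro int c)
  also have "\<bar>\<dots>\<bar> \<le> (LINT z|lborel. \<bar>(S (x + z) - S (y + z)) * ball_bump \<rho> z\<bar>)"
    by (rule integral_abs_bound)
  also have "\<dots> \<le> (LINT z|lborel. (L * dist x y) * ball_bump \<rho> (z::'a))"
  proof (rule integral_mono)
    show "integrable lborel (\<lambda>z. \<bar>(S (x + z) - S (y + z)) * ball_bump \<rho> z\<bar>)"
      by (intro integrable_abs int continuous_intros c)
    show "integrable lborel (\<lambda>z::'a. (L * dist x y) * ball_bump \<rho> z)"
      by (intro int continuous_intros)
    fix z :: 'a
    have "\<bar>S (x + z) - S (y + z)\<bar> \<le> L * dist x y"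
      using lipschitz_onD[OF S, of "x + z" "y + z"] by (simp add: dist_real_def)
    then show "\<bar>(S (x + z) - S (y + z)) * ball_bump \<rho> z\<bar> \<le> (L * dist x y) * ball_bump \<rho> z"
      by (simp add: abs_mult ball_bump_nonneg mult_right_mono)
  qed
  finally show ?thesis by simp
qed

text \<open>
  The classical gradient of such a function is a weak gradient by integration by parts, and by
  uniqueness every other weak gradient obeys the same bound.
\<close>

lemma C1_compact_support_W1inf0:
  fixes w :: "'a::euclidean_space \<Rightarrow> real"
  assumes \<Omega>: "open \<Omega>" and K: "compact K" "K \<subseteq> \<Omega>" "\<And>x. x \<notin> K \<Longrightarrow> w x = 0"
    and w: "continuous_on UNIV w" and G: "continuous_on UNIV G" "\<And>x. norm (G x) \<le> L"
    and der: "\<And>x s e. ((\<lambda>s. w (x + s *\<^sub>R e)) has_real_derivative G (x + s *\<^sub>R e) \<bullet> e) (at s)"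
  shows "w \<in> W1inf0 \<Omega>" "grad_sup_functional \<Omega> w \<le> ereal L"
proof -
  have locI: "locally_integrable \<Omega> h" if "continuous_on UNIV h" for h :: "'a \<Rightarrow> 'b::euclidean_space"
    unfolding locally_integrable_def
  proof (intro allI impI)
    fix C assume "compact C \<and> C \<subseteq> \<Omega>"
    then obtain A B where "C \<subseteq> cbox A B" "compact C"
      using bounded_subset_cbox_symmetric compact_imp_bounded by metis
    moreover have "h absolutely_integrable_on cbox A B"
      using that by (intro absolutely_integrable_continuous) (rule continuous_on_subset, auto)
    ultimately show "h absolutely_integrable_on C"
      by (intro set_integrable_subset[of lebesgue "cbox A B" h C]) (auto simp: borel_compact)
  qed
  have grad: "has_weak_gradient \<Omega> w G"
    unfolding has_weak_gradient_def
  proof (intro conjI allI impI ballI locI w G(1))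
    fix \<phi> and b :: 'a assume \<phi>: "test_function \<Omega> \<phi>" and "b \<in> Basis"
    then have sm: "smooth_on UNIV \<phi>" by (simp add: test_function_def)
    let ?K = "closure {x. \<phi> x \<noteq> 0}"
    have K': "compact ?K" "?K \<subseteq> \<Omega>" using \<phi> by (auto simp: test_function_def)
    obtain A B where AB: "?K \<subseteq> cbox A B"
      using bounded_subset_cbox_symmetric compact_imp_bounded K'(1) by metis
    have z1: "w x * frechet_derivative \<phi> (at x) b = 0" and z2: "(G x \<bullet> b) * \<phi> x = 0" and z3: "w x * \<phi> x = 0"
      if "x \<notin> ?K" for x
      using test_function_derivative_eq_0[OF that] test_function_not_in_support[OF that] by auto
    have c1: "continuous_on UNIV (\<lambda>x. w x * frechet_derivative \<phi> (at x) b)"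
      and c2: "continuous_on UNIV (\<lambda>x. (G x \<bullet> b) * \<phi> x)"
      by (intro continuous_intros w G smooth_continuous_derivative smooth_continuous sm)+
    have "(LINT x|lborel. w x * frechet_derivative \<phi> (at x) b + (G x \<bullet> b) * \<phi> x) = 0"
    proof (rule integral_directional_derivative_eq_0)
      show "((\<lambda>s. w (x + s *\<^sub>R b) * \<phi> (x + s *\<^sub>R b)) has_real_derivative
          w (x + s *\<^sub>R b) * frechet_derivative \<phi> (at (x + s *\<^sub>R b)) b + (G (x + s *\<^sub>R b) \<bullet> b) * \<phi> (x + s *\<^sub>R b)) (at s)" for x s
        using DERIV_mult'[OF der[of x b s] smooth_DERIV_line[OF sm, of x b s]] .
      show "w x * \<phi> x = 0" if "x \<notin> ?K" for x using z3[OF that] .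
      show "bounded ?K" using K'(1) by (rule compact_imp_bounded)
    qed (intro continuous_intros w smooth_continuous sm c1 c2)+
    also have "(LINT x|lborel. w x * frechet_derivative \<phi> (at x) b + (G x \<bullet> b) * \<phi> x)
      = (LINT x|lborel. w x * frechet_derivative \<phi> (at x) b) + (LINT x|lborel. (G x \<bullet> b) * \<phi> x)"
      by (intro Bochner_Integration.integral_add continuous_compact_support_integrable(1)[where A=A and B=B] c1 c2)
        (use z1 z2 AB in blast)+
    finally show "(LINT x|lebesgue_on \<Omega>. w x * frechet_derivative \<phi> (at x) b)
        = - (LINT x|lebesgue_on \<Omega>. (G x \<bullet> b) * \<phi> x)"
      using integral_lebesgue_on_eq_lborel[OF \<Omega> borel_measurable_continuous_onI[OF c1]]
        integral_lebesgue_on_eq_lborel[OF \<Omega> borel_measurable_continuous_onI[OF c2]] z1 z2 K'(2)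
      by (smt (verit) subsetD)
  qed
  have meas: "h \<in> borel_measurable (lebesgue_on \<Omega>)" if "continuous_on UNIV h" for h :: "'a \<Rightarrow> 'b::euclidean_space"
    using \<Omega> that by (intro continuous_imp_measurable_on_sets_lebesgue) (auto intro: continuous_on_subset)
  have "bounded (w ` K)"
    using K(1) w by (intro compact_imp_bounded compact_continuous_image) (auto intro: continuous_on_subset)
  then obtain C where C: "\<And>x. x \<in> K \<Longrightarrow> norm (w x) \<le> C" by (auto simp: bounded_iff)
  have wC: "norm (w x) \<le> max C 0" for x
    using C[of x] K(3)[of x] by (cases "x \<in> K") auto
  have Linf: "h \<in> Linf \<Omega>" "Linf_norm \<Omega> h \<le> ereal c" if "continuous_on UNIV h" "\<And>x. norm (h x) \<le> c"
    for h :: "'a \<Rightarrow> 'b::euclidean_space" and c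
  proof -
    show *: "Linf_norm \<Omega> h \<le> ereal c"
      unfolding Linf_norm_def using meas[OF that(1)] that(2) by (intro esssup_I) auto
    show "h \<in> Linf \<Omega>" using meas[OF that(1)] * by (auto simp: Linf_def intro: le_less_trans)
  qed
  have W: "w \<in> W1inf \<Omega>"
    unfolding W1inf_def using Linf(1)[OF w wC] Linf(1)[OF G] grad by auto
  show W0: "w \<in> W1inf0 \<Omega>"
    unfolding W1inf0_def
  proof (intro CollectI conjI exI[of _ w] W)
    show "continuous_on (closure \<Omega>) w" using w by (rule continuous_on_subset) auto
    show "\<forall>x\<in>frontier \<Omega>. w x = 0" using K(2,3) \<Omega> by (auto simp: frontier_def interior_open)
  qed auto
  have "has_weak_gradient \<Omega> w (weak_gradient \<Omega> w)"
    unfolding weak_gradient_def using grad by (rule someI[of "has_weak_gradient \<Omega> w"])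
  then have ae: "AE x in lebesgue_on \<Omega>. G x = weak_gradient \<Omega> w x"
    by (rule weak_gradient_unique[OF \<Omega> grad])
  have "(\<lambda>x. if x \<in> \<Omega> then G x else 0) \<in> borel_measurable lebesgue"
    using meas[OF G(1)] \<Omega> by (simp add: borel_measurable_if)
  moreover have "AE x in lebesgue. (if x \<in> \<Omega> then G x else 0) = (if x \<in> \<Omega> then weak_gradient \<Omega> w x else 0)"
    using ae \<Omega> by (simp add: AE_restrict_space_iff)
  ultimately have "(\<lambda>x. if x \<in> \<Omega> then weak_gradient \<Omega> w x else 0) \<in> borel_measurable lebesgue"
    by (rule borel_measurable_AE)
  then have "weak_gradient \<Omega> w \<in> borel_measurable (lebesgue_on \<Omega>)"
    by (rule borel_measurable_if_D)
  then have "Linf_norm \<Omega> (weak_gradient \<Omega> w) \<le> ereal L"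
    unfolding Linf_norm_def
  proof (intro esssup_I)
    show "AE x in lebesgue_on \<Omega>. ereal (norm (weak_gradient \<Omega> w x)) \<le> ereal L"
      using ae by eventually_elim (use G(2) in \<open>metis ereal_less_eq(3)\<close>)
  qed auto
  then show "grad_sup_functional \<Omega> w \<le> ereal L"
    using W0 by (simp add: grad_sup_functional_def)
qed

text \<open>
  Soft thresholding, which moves every value towards \<open>0\<close> by up to \<open>\<delta>\<close>, makes the function vanish
  near the complement of \<open>\<Omega>\<close>; a mollification of small radius then has compact support in \<open>\<Omega>\<close>.
  Neither operation increases the Lipschitz constant.
\<close>

lemma lipschitz_approximation:
  fixes v :: "'a::euclidean_space \<Rightarrow> real"
  assumes \<Omega>: "open \<Omega>" "bounded \<Omega>" and v: "L-lipschitz_on UNIV v" "\<And>x. x \<notin> \<Omega> \<Longrightarrow> v x = 0"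
    and "\<epsilon> > 0"
  obtains w where "w \<in> W1inf0 \<Omega>" "grad_sup_functional \<Omega> w \<le> ereal L" "continuous_on UNIV w"
    "\<And>x. \<bar>w x - v x\<bar> \<le> \<epsilon>"
proof -
  define \<delta> where "\<delta> = \<epsilon> / 2"
  have "\<delta> > 0" using \<open>\<epsilon> > 0\<close> by (simp add: \<delta>_def)
  have L: "L \<ge> 0" using v(1) by (rule lipschitz_on_nonneg)
  define S where "S x = v x - max (- \<delta>) (min \<delta> (v x))" for x
  have SL: "L-lipschitz_on UNIV S"
  proof (rule lipschitz_onI[OF _ L])
    fix x y
    have "\<bar>S x - S y\<bar> \<le> \<bar>v x - v y\<bar>" using \<open>\<delta> > 0\<close> by (auto simp: S_def max_def min_def)
    then show "dist (S x) (S y) \<le> L * dist x y"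
      using lipschitz_onD[OF v(1), of x y] by (simp add: dist_real_def)
  qed
  have Sv: "\<bar>S x - v x\<bar> \<le> \<delta>" for x using \<open>\<delta> > 0\<close> by (auto simp: S_def)
  have S0: "S x = 0" if "\<bar>v x\<bar> \<le> \<delta>" for x using that by (auto simp: S_def)
  have Scont: "continuous_on UNIV S" using SL by (rule lipschitz_on_continuous_on)
  have vcont: "continuous_on UNIV v" using v(1) by (rule lipschitz_on_continuous_on)
  \<comment> \<open>Small enough for a mollification to move values by at most half the threshold.\<close>
  define \<rho> where "\<rho> = \<delta> / (2 * (L + 1))"
  have \<rho>: "\<rho> > 0" "L * \<rho> \<le> \<delta> / 2"
    using \<open>\<delta> > 0\<close> L by (auto simp: \<rho>_def field_simps)
  define \<eta> where "\<eta> = (ball_bump \<rho> :: 'a \<Rightarrow> real)"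
  note \<eta>s = ball_bump_smooth[of \<rho>, where 'a='a, folded \<eta>_def]
  define I where "I = (LINT y|lborel. \<eta> y)"
  have "I > 0" unfolding I_def \<eta>_def by (rule ball_bump_integral_pos) fact
  obtain A B where AB: "\<Omega> \<subseteq> cbox A B"
    using bounded_subset_cbox_symmetric[OF \<Omega>(2)] by metis
  have Szero: "S y = 0" if "y \<notin> cbox A B" for y
  proof -
    have "v y = 0" using that AB v(2) by blast
    then show ?thesis using S0[of y] \<open>\<delta> > 0\<close> by simp
  qed
  define w where "w x = mollify \<eta> S x / I" for x
  define D where "D e x = - mollify (\<lambda>z. frechet_derivative \<eta> (at z) e) S x / I" for e x
  \<comment> \<open>Linearity of the directional derivatives makes this vector the gradient.\<close>
  define G where "G x = (\<Sum>b\<in>Basis. D b x *\<^sub>R b)" for x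
  define K where "K = {x. \<delta> / 2 \<le> \<bar>v x\<bar>}"
  have close: "\<bar>w x - S x\<bar> \<le> L * \<rho>" for x
  proof -
    have "\<bar>mollify \<eta> S x - S x * I\<bar> \<le> L * \<rho> * I"
      unfolding \<eta>_def I_def
    proof (rule mollify_close[OF Scont])
      fix y assume "y \<in> cball x \<rho>"
      then have "L * dist x y \<le> L * \<rho>" using L by (intro mult_left_mono) auto
      then show "\<bar>S y - S x\<bar> \<le> L * \<rho>"
        using lipschitz_onD[OF SL, of y x] by (simp add: dist_real_def dist_commute)
    qed
    moreover have "w x - S x = (mollify \<eta> S x - S x * I) / I" using \<open>I > 0\<close> by (simp add: w_def field_simps)
    ultimately show ?thesis using \<open>I > 0\<close> by (simp add: abs_divide divide_le_eq)
  qed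
  have "K \<subseteq> \<Omega>"
  proof
    fix x assume "x \<in> K"
    then have "v x \<noteq> 0" using \<open>\<delta> > 0\<close> by (auto simp: K_def)
    then show "x \<in> \<Omega>" using v(2) by blast
  qed
  moreover have "closed K"
    unfolding K_def by (intro closed_Collect_le continuous_intros vcont)
  ultimately have K: "compact K" "K \<subseteq> \<Omega>"
    using \<Omega>(2) by (auto simp: compact_eq_bounded_closed intro: bounded_subset)
  have wK: "w x = 0" if "x \<notin> K" for x
  proof -
    have "S y * \<eta> (y - x) = 0" for y
    proof (cases "y \<in> cball x \<rho>")
      case True
      then have "L * dist x y \<le> L * \<rho>" using L by (intro mult_left_mono) auto
      then have "\<bar>v y\<bar> \<le> \<delta>"
        using lipschitz_onD[OF v(1), of y x] \<rho>(2) that by (simp add: dist_real_def dist_commute K_def)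
      then show ?thesis using S0 by simp
    next
      case False
      then have "\<eta> (y - x) = 0" unfolding \<eta>_def
        by (intro ball_bump_eq_0) (simp add: dist_norm norm_minus_commute)
      then show ?thesis by simp
    qed
    then show ?thesis by (simp only: w_def mollify_def integral_zero div_0)
  qed
  have wcont: "continuous_on UNIV w"
    unfolding w_def using \<open>I > 0\<close>
    by (intro continuous_intros continuous_on_mollify[OF Scont Szero] smooth_continuous \<eta>s) auto
  have Dcont: "continuous_on UNIV (D e)" for e
    unfolding D_def[abs_def] using \<open>I > 0\<close>
    by (intro continuous_intros continuous_on_mollify[OF Scont Szero] smooth_continuous_derivative \<eta>s) auto
  have Dlin: "D e x = G x \<bullet> e" for e x
  proof -
    have "mollify (\<lambda>z. frechet_derivative \<eta> (at z) e) S x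
        = (LINT y|lborel. (\<Sum>b\<in>Basis. (e \<bullet> b) * (S y * frechet_derivative \<eta> (at (y - x)) b)))"
      unfolding mollify_def
      by (subst frechet_derivative_basis_expansion[OF smooth_linear_derivative[OF \<eta>s]])
        (simp add: sum_distrib_left algebra_simps)
    also have "\<dots> = (\<Sum>b\<in>Basis. (e \<bullet> b) * mollify (\<lambda>z. frechet_derivative \<eta> (at z) b) S x)"
    proof -
      have "integrable lborel (\<lambda>y. S y * frechet_derivative \<eta> (at (y - x)) b)" for b
        by (rule continuous_compact_support_integrable(1)[of _ A B])
          (use Szero in \<open>auto intro!: continuous_intros Scont continuous_on_compose2[OF smooth_continuous_derivative[OF \<eta>s]]\<close>)
      then show ?thesis
        by (subst Bochner_Integration.integral_sum) (auto simp: mollify_def)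
    qed
    finally have "D e x = (\<Sum>b\<in>Basis. (e \<bullet> b) * D b x)"
      by (simp add: D_def sum_divide_distrib sum_negf)
    also have "\<dots> = G x \<bullet> e"
      by (simp add: G_def inner_sum_left mult.commute inner_commute[of e])
    finally show ?thesis .
  qed
  have der: "((\<lambda>s. w (x + s *\<^sub>R e)) has_real_derivative G (x + s *\<^sub>R e) \<bullet> e) (at s)" for x s e
    using DERIV_cdivide[OF mollify_DERIV_line[OF \<eta>s Scont Szero, where x=x and e=e and s=s], where c=I]
    unfolding Dlin[symmetric] by (simp add: w_def D_def mollify_def)
  have wlip: "\<bar>w x - w y\<bar> \<le> L * dist x y" for x y
  proof -
    have "w x - w y = (mollify \<eta> S x - mollify \<eta> S y) / I"
      by (simp add: w_def diff_divide_distrib)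
    then show ?thesis
      using mollify_lipschitz[OF SL, of \<rho> x y] \<open>I > 0\<close>
      by (simp add: abs_divide divide_le_eq \<eta>_def I_def)
  qed
  have Gle: "norm (G x) \<le> L" for x
  proof -
    have "\<bar>G (x + 0 *\<^sub>R G x) \<bullet> G x\<bar> \<le> L * norm (G x)"
    proof (rule DERIV_abs_le_of_lipschitz[OF der])
      fix t
      show "\<bar>w (x + t *\<^sub>R G x) - w (x + 0 *\<^sub>R G x)\<bar> \<le> L * norm (G x) * \<bar>t - 0\<bar>"
        using wlip[of "x + t *\<^sub>R G x" x] by (simp add: dist_norm mult_ac)
    qed
    then have "norm (G x) * norm (G x) \<le> L * norm (G x)"
      by (simp add: power2_norm_eq_inner[symmetric] power2_eq_square)
    then show ?thesis using L by (cases "G x = 0") auto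
  qed
  have Gcont: "continuous_on UNIV G"
    unfolding G_def[abs_def] by (intro continuous_intros Dcont)
  note W = C1_compact_support_W1inf0[OF \<Omega>(1) K wK wcont Gcont Gle der]
  have "\<bar>w x - v x\<bar> \<le> \<epsilon>" for x
    using close[of x] Sv[of x] \<rho>(2) \<open>\<delta> > 0\<close> unfolding \<delta>_def by linarith
  then show ?thesis using that W wcont by blast
qed

section \<open>Square-integrable functions and the subdifferential\<close>

lemma L2_measurable [measurable_dest]: "u \<in> L2 \<Omega> \<Longrightarrow> u \<in> borel_measurable (lebesgue_on \<Omega>)"
  by (simp add: L2_def)

lemma L2_mult_integrable:
  assumes "u \<in> L2 \<Omega>" "v \<in> L2 \<Omega>"
  shows "integrable (lebesgue_on \<Omega>) (\<lambda>x. u x * v x)"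
proof (rule Bochner_Integration.integrable_bound)
  show "integrable (lebesgue_on \<Omega>) (\<lambda>x. (u x)\<^sup>2 + (v x)\<^sup>2)"
    using assms by (auto simp: L2_def)
  show "(\<lambda>x. u x * v x) \<in> borel_measurable (lebesgue_on \<Omega>)"
    using assms by (intro borel_measurable_times L2_measurable)
  show "AE x in lebesgue_on \<Omega>. norm (u x * v x) \<le> norm ((u x)\<^sup>2 + (v x)\<^sup>2)"
  proof (rule AE_I2)
    fix x
    have "2 * \<bar>u x\<bar> * \<bar>v x\<bar> \<le> \<bar>u x\<bar>\<^sup>2 + \<bar>v x\<bar>\<^sup>2" by (rule sum_squares_bound)
    moreover have "0 \<le> \<bar>u x\<bar> * \<bar>v x\<bar>" by simp
    ultimately have "\<bar>u x\<bar> * \<bar>v x\<bar> \<le> (u x)\<^sup>2 + (v x)\<^sup>2" by (simp only: power2_abs mult.assoc)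
    then show "norm (u x * v x) \<le> norm ((u x)\<^sup>2 + (v x)\<^sup>2)"
      by (simp add: abs_mult)
  qed
qed

lemma L2_scale: "u \<in> L2 \<Omega> \<Longrightarrow> (\<lambda>x. c * u x) \<in> L2 \<Omega>"
  by (auto simp: L2_def power_mult_distrib)

lemma L2_add:
  assumes "u \<in> L2 \<Omega>" "v \<in> L2 \<Omega>"
  shows "(\<lambda>x. u x + v x) \<in> L2 \<Omega>"
proof -
  have "integrable (lebesgue_on \<Omega>) (\<lambda>x. (u x)\<^sup>2 + (v x)\<^sup>2 + 2 * (u x * v x))"
    using assms L2_mult_integrable[OF assms] by (auto simp: L2_def)
  moreover have "(\<lambda>x. (u x)\<^sup>2 + (v x)\<^sup>2 + 2 * (u x * v x)) = (\<lambda>x. (u x + v x)\<^sup>2)"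
    by (simp add: power2_sum mult.assoc)
  ultimately show ?thesis using assms by (auto simp: L2_def)
qed

lemma L2_uminus: "u \<in> L2 \<Omega> \<Longrightarrow> (\<lambda>x. - u x) \<in> L2 \<Omega>"
  using L2_scale[of u \<Omega> "-1"] by simp

lemma L2_diff: "u \<in> L2 \<Omega> \<Longrightarrow> v \<in> L2 \<Omega> \<Longrightarrow> (\<lambda>x. u x - v x) \<in> L2 \<Omega>"
  using L2_add[OF _ L2_uminus, of u \<Omega> v] by simp

lemma L2_divide: "u \<in> L2 \<Omega> \<Longrightarrow> (\<lambda>x. u x / c) \<in> L2 \<Omega>"
  using L2_scale[of u \<Omega> "1 / c"] by simp

lemma continuous_L2:
  fixes v :: "'a::euclidean_space \<Rightarrow> real"
  assumes "open \<Omega>" "bounded \<Omega>" "continuous_on UNIV v"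
  shows "v \<in> L2 \<Omega>"
proof -
  have m: "h \<in> borel_measurable (lebesgue_on \<Omega>)" if "continuous_on UNIV h" for h :: "'a \<Rightarrow> real"
    using assms(1) that by (intro continuous_imp_measurable_on_sets_lebesgue) (auto intro: continuous_on_subset)
  have "\<Omega> \<in> lmeasurable" using assms(1,2) by (simp add: lmeasurable_open)
  then interpret finite_measure "lebesgue_on \<Omega>" by (rule finite_measure_lebesgue_on)
  have "bounded (v ` closure \<Omega>)"
    using assms by (intro compact_imp_bounded compact_continuous_image) (auto intro: continuous_on_subset)
  then obtain C where C: "\<And>x. x \<in> closure \<Omega> \<Longrightarrow> norm (v x) \<le> C" by (auto simp: bounded_iff)
  have "integrable (lebesgue_on \<Omega>) (\<lambda>x. (v x)\<^sup>2)"
  proof (rule integrable_const_bound[where B="C\<^sup>2"])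
    show "AE x in lebesgue_on \<Omega>. norm ((v x)\<^sup>2) \<le> C\<^sup>2"
    proof (rule AE_I2)
      fix x assume "x \<in> space (lebesgue_on \<Omega>)"
      then have "\<bar>v x\<bar> \<le> C" using C[of x] closure_subset by auto
      then show "norm ((v x)\<^sup>2) \<le> C\<^sup>2" using power_mono[of "\<bar>v x\<bar>" C 2] by simp
    qed
  qed (use m assms in \<open>auto intro!: continuous_intros\<close>)
  then show ?thesis using m assms(3) by (simp add: L2_def)
qed

lemma L2_inner_commute: "L2_inner \<Omega> u v = L2_inner \<Omega> v u"
  by (simp add: L2_inner_def mult.commute)

lemma L2_inner_diff_left:
  "u \<in> L2 \<Omega> \<Longrightarrow> v \<in> L2 \<Omega> \<Longrightarrow> w \<in> L2 \<Omega> \<Longrightarrow>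
    L2_inner \<Omega> (\<lambda>x. u x - v x) w = L2_inner \<Omega> u w - L2_inner \<Omega> v w"
  by (simp add: L2_inner_def left_diff_distrib Bochner_Integration.integral_diff L2_mult_integrable)

lemma L2_inner_scale_left: "L2_inner \<Omega> (\<lambda>x. c * u x) w = c * L2_inner \<Omega> u w"
  by (simp add: L2_inner_def mult.assoc)

lemma L2_inner_divide_left: "L2_inner \<Omega> (\<lambda>x. u x / c) w = L2_inner \<Omega> u w / c"
  using L2_inner_scale_left[of \<Omega> "1 / c" u w] by simp

lemma L2_inner_uminus_left: "L2_inner \<Omega> (\<lambda>x. - u x) w = - L2_inner \<Omega> u w"
  by (simp add: L2_inner_def)

lemma L2_inner_diff_right:
  "u \<in> L2 \<Omega> \<Longrightarrow> v \<in> L2 \<Omega> \<Longrightarrow> w \<in> L2 \<Omega> \<Longrightarrow>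
    L2_inner \<Omega> w (\<lambda>x. u x - v x) = L2_inner \<Omega> w u - L2_inner \<Omega> w v"
  by (simp add: L2_inner_commute[of \<Omega> w] L2_inner_diff_left)

lemma L2_inner_scale_right: "L2_inner \<Omega> w (\<lambda>x. c * u x) = c * L2_inner \<Omega> w u"
  by (simp add: L2_inner_commute[of \<Omega> w] L2_inner_scale_left)

lemma L2_norm_nonneg: "0 \<le> L2_norm \<Omega> u"
  by (simp add: L2_norm_def)

lemma L2_norm_power2: "(L2_norm \<Omega> u)\<^sup>2 = L2_inner \<Omega> u u"
  by (simp add: L2_norm_def L2_inner_def power2_eq_square[symmetric])

lemma L2_inner_self_nonneg: "0 \<le> L2_inner \<Omega> u u"
  by (simp add: L2_norm_power2[symmetric])

lemma L2_norm_diff_power2: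
  assumes "u \<in> L2 \<Omega>" "v \<in> L2 \<Omega>"
  shows "(L2_norm \<Omega> (\<lambda>x. u x - v x))\<^sup>2 = L2_inner \<Omega> u u - 2 * L2_inner \<Omega> u v + L2_inner \<Omega> v v"
  using assms by (simp add: L2_norm_power2 L2_inner_diff_left L2_inner_diff_right L2_diff L2_inner_commute[of \<Omega> v u])

lemma L2_Cauchy_Schwarz:
  assumes "u \<in> L2 \<Omega>" "v \<in> L2 \<Omega>"
  shows "\<bar>L2_inner \<Omega> u v\<bar> \<le> L2_norm \<Omega> u * L2_norm \<Omega> v"
proof -
  let ?a = "L2_inner \<Omega> u u" and ?b = "L2_inner \<Omega> v v" and ?c = "L2_inner \<Omega> u v"
  have q: "0 \<le> ?a - 2 * t * ?c + t\<^sup>2 * ?b" for t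
  proof -
    have "(L2_norm \<Omega> (\<lambda>x. u x - t * v x))\<^sup>2 = ?a - 2 * t * ?c + t\<^sup>2 * ?b"
      unfolding L2_norm_diff_power2[OF assms(1) L2_scale[OF assms(2)]]
      by (simp add: L2_inner_scale_left L2_inner_scale_right power2_eq_square)
    then show ?thesis using zero_le_power2 by metis
  qed
  have "?c\<^sup>2 \<le> ?a * ?b"
  proof (cases "?b = 0")
    case True
    have "?c = 0"
    proof (rule ccontr)
      assume "?c \<noteq> 0"
      then show False using q[of "(?a + 1) / (2 * ?c)"] True by (simp add: field_simps)
    qed
    then show ?thesis using True by simp
  next
    case False
    then have "?b > 0" using L2_inner_self_nonneg[of \<Omega> v] by simp
    have "0 \<le> (?a - 2 * (?c / ?b) * ?c + (?c / ?b)\<^sup>2 * ?b) * ?b"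
      using q[of "?c / ?b"] \<open>?b > 0\<close> by simp
    also have "\<dots> = ?a * ?b - ?c\<^sup>2" using False by (simp add: field_simps power2_eq_square)
    finally show ?thesis by simp
  qed
  also have "\<dots> = (L2_norm \<Omega> u * L2_norm \<Omega> v)\<^sup>2" by (simp add: power_mult_distrib L2_norm_power2)
  finally have "\<bar>?c\<bar>\<^sup>2 \<le> (L2_norm \<Omega> u * L2_norm \<Omega> v)\<^sup>2" by simp
  then show ?thesis
    by (rule power2_le_imp_le) (simp add: L2_norm_nonneg)
qed

lemma L2_inner_cong_AE:
  assumes "u \<in> borel_measurable (lebesgue_on \<Omega>)" "u' \<in> borel_measurable (lebesgue_on \<Omega>)"
    "w \<in> borel_measurable (lebesgue_on \<Omega>)" "AE x in lebesgue_on \<Omega>. u x = u' x"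
  shows "L2_inner \<Omega> u w = L2_inner \<Omega> u' w"
  unfolding L2_inner_def
  by (rule Bochner_Integration.integral_cong_AE) (use assms in auto)

lemma L2_norm_eq_0_iff:
  assumes "u \<in> L2 \<Omega>"
  shows "L2_norm \<Omega> u = 0 \<longleftrightarrow> (AE x in lebesgue_on \<Omega>. u x = 0)"
  using assms integral_nonneg_eq_0_iff_AE[of "lebesgue_on \<Omega>" "\<lambda>x. (u x)\<^sup>2"]
  by (simp add: L2_norm_def L2_def)

lemma L2_inner_uniform_close:
  assumes \<Omega>: "open \<Omega>" "bounded (\<Omega> :: 'a::euclidean_space set)" and p: "p \<in> L2 \<Omega>" and "w \<in> L2 \<Omega>" "v \<in> L2 \<Omega>"
    and close: "\<And>x. \<bar>w x - v x\<bar> \<le> \<epsilon>"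
  shows "\<bar>L2_inner \<Omega> p w - L2_inner \<Omega> p v\<bar> \<le> \<epsilon> * (LINT x|lebesgue_on \<Omega>. \<bar>p x\<bar>)"
proof -
  have "(\<lambda>x. 1) \<in> L2 \<Omega>" using \<Omega> by (intro continuous_L2) auto
  from L2_mult_integrable[OF p this] have pint: "integrable (lebesgue_on \<Omega>) (\<lambda>x. \<bar>p x\<bar>)" by simp
  have "\<bar>L2_inner \<Omega> p w - L2_inner \<Omega> p v\<bar> = \<bar>LINT x|lebesgue_on \<Omega>. p x * (w x - v x)\<bar>"
    using L2_inner_diff_right[OF assms(4,5) p] by (simp add: L2_inner_def)
  also have "\<dots> \<le> (LINT x|lebesgue_on \<Omega>. \<bar>p x * (w x - v x)\<bar>)" by (rule integral_abs_bound)
  also have "\<dots> \<le> (LINT x|lebesgue_on \<Omega>. \<epsilon> * \<bar>p x\<bar>)"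
  proof (rule integral_mono)
    show "integrable (lebesgue_on \<Omega>) (\<lambda>x. \<bar>p x * (w x - v x)\<bar>)"
      using assms by (intro integrable_abs L2_mult_integrable L2_diff)
    show "\<bar>p x * (w x - v x)\<bar> \<le> \<epsilon> * \<bar>p x\<bar>" for x
      using mult_right_mono[OF close[of x] abs_ge_zero[of "p x"]] by (simp add: abs_mult mult.commute)
  qed (use pint in simp)
  finally show ?thesis by simp
qed

text \<open>
  Up to null sets and restriction to \<open>\<Omega>\<close>, these functions form the sublevel set at level \<open>L\<close> of
  \<open>grad_sup_functional \<Omega>\<close>.
\<close>

definition lip0 :: "'a::euclidean_space set \<Rightarrow> real \<Rightarrow> ('a \<Rightarrow> real) \<Rightarrow> bool" where
  "lip0 \<Omega> L z \<longleftrightarrow> L-lipschitz_on UNIV z \<and> (\<forall>x. x \<notin> \<Omega> \<longrightarrow> z x = 0)"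

lemma lip0_continuous: "lip0 \<Omega> L z \<Longrightarrow> continuous_on UNIV z"
  by (auto simp: lip0_def intro: lipschitz_on_continuous_on)

lemma lip0_L2: "open \<Omega> \<Longrightarrow> bounded \<Omega> \<Longrightarrow> lip0 \<Omega> L z \<Longrightarrow> z \<in> L2 \<Omega>"
  by (intro continuous_L2 lip0_continuous)

text \<open>
  Testing the subgradient inequality with approximations of \<open>0\<close> gives \<open>J \<le> \<langle>p, u\<rangle>\<close> for the value
  \<open>J\<close> of the functional at \<open>u\<close>, and with approximations of twice the representative of \<open>u\<close> it
  gives \<open>\<langle>p, u\<rangle> \<le> J\<close>.  Then the inequality for general test functions reduces to \<open>\<langle>p, z\<rangle> \<le> M\<close>.
\<close>

lemma subgradient_lipschitz_characterization:
  fixes u :: "'a::euclidean_space \<Rightarrow> real"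
  assumes \<Omega>: "open \<Omega>" "bounded \<Omega>" "\<Omega> \<noteq> {}" and u: "u \<in> L2 \<Omega>"
    and p: "p \<in> subdifferential \<Omega> (grad_sup_functional \<Omega>) u"
  shows "\<exists>v. lip0 \<Omega> (L2_inner \<Omega> p u) v \<and> (AE x in lebesgue_on \<Omega>. u x = v x)"
    and "\<And>M z. lip0 \<Omega> M z \<Longrightarrow> L2_inner \<Omega> p z \<le> M"
proof -
  have pL2: "p \<in> L2 \<Omega>"
    and sub: "\<And>w. w \<in> L2 \<Omega> \<Longrightarrow> grad_sup_functional \<Omega> u + ereal (L2_inner \<Omega> p w - L2_inner \<Omega> p u) \<le> grad_sup_functional \<Omega> w"
    using p u by (auto simp: subdifferential_def L2_inner_diff_right)
  define C where "C = (LINT x|lebesgue_on \<Omega>. \<bar>p x\<bar>)"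
  have C: "C \<ge> 0" by (simp add: C_def)
  have key: "grad_sup_functional \<Omega> u + ereal (L2_inner \<Omega> p z - L2_inner \<Omega> p u - \<epsilon>) \<le> ereal M"
    if z: "lip0 \<Omega> M z" and "\<epsilon> > 0" for M z \<epsilon>
  proof -
    have "\<epsilon> / (C + 1) > 0" using C \<open>\<epsilon> > 0\<close> by simp
    then obtain w where w: "grad_sup_functional \<Omega> w \<le> ereal M" "continuous_on UNIV w" "\<And>x. \<bar>w x - z x\<bar> \<le> \<epsilon> / (C + 1)"
      using lipschitz_approximation[OF \<Omega>(1,2), of M z "\<epsilon> / (C + 1)"] z unfolding lip0_def by metis
    have wL2: "w \<in> L2 \<Omega>" by (rule continuous_L2[OF \<Omega>(1,2) w(2)])
    have "\<bar>L2_inner \<Omega> p w - L2_inner \<Omega> p z\<bar> \<le> \<epsilon> / (C + 1) * C"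
      unfolding C_def
      by (rule L2_inner_uniform_close[OF \<Omega>(1,2) pL2 wL2 lip0_L2[OF \<Omega>(1,2) z]]) (use w(3) in \<open>simp add: C_def\<close>)
    also have "\<dots> \<le> \<epsilon>" using C \<open>\<epsilon> > 0\<close> by (simp add: field_simps)
    finally have "L2_inner \<Omega> p z - L2_inner \<Omega> p u - \<epsilon> \<le> L2_inner \<Omega> p w - L2_inner \<Omega> p u" by linarith
    then have "grad_sup_functional \<Omega> u + ereal (L2_inner \<Omega> p z - L2_inner \<Omega> p u - \<epsilon>)
        \<le> grad_sup_functional \<Omega> u + ereal (L2_inner \<Omega> p w - L2_inner \<Omega> p u)"
      by (intro add_left_mono) simp
    also have "\<dots> \<le> grad_sup_functional \<Omega> w" by (rule sub[OF wL2])
    finally show ?thesis using w(1) by (rule order_trans)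
  qed
  have "lip0 \<Omega> 0 (\<lambda>_. 0)" by (simp add: lip0_def lipschitz_on_constant)
  from key[OF this, of 1] have fin: "grad_sup_functional \<Omega> u \<noteq> \<infinity>" by auto
  then have W: "u \<in> W1inf0 \<Omega>" by (auto simp: grad_sup_functional_def split: if_splits)
  then have eqJ: "grad_sup_functional \<Omega> u = Linf_norm \<Omega> (weak_gradient \<Omega> u)"
    by (simp add: grad_sup_functional_def)
  have "0 \<le> grad_sup_functional \<Omega> u"
  proof (rule ccontr)
    assume neg: "\<not> 0 \<le> grad_sup_functional \<Omega> u"
    have "AE x in lebesgue_on \<Omega>. ereal (norm (weak_gradient \<Omega> u x)) \<le> grad_sup_functional \<Omega> u"
      unfolding eqJ Linf_norm_def by (rule esssup_AE)
    then have "AE x in lebesgue_on \<Omega>. False"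
    proof eventually_elim
      fix x assume "ereal (norm (weak_gradient \<Omega> u x)) \<le> grad_sup_functional \<Omega> u"
      moreover have "0 \<le> ereal (norm (weak_gradient \<Omega> u x))" by simp
      ultimately show False using neg order_trans by blast
    qed
    then have "AE x in lebesgue. x \<notin> \<Omega>" using \<Omega>(1) by (simp add: AE_restrict_space_iff)
    then have "negligible \<Omega>"
      using \<Omega>(1) by (simp add: negligible_iff_null_sets AE_iff_null_sets)
    then show False using open_not_negligible \<Omega>(1,3) by blast
  qed
  then obtain J where J: "grad_sup_functional \<Omega> u = ereal J" "0 \<le> J"
    using fin by (cases "grad_sup_functional \<Omega> u") auto
  obtain v where v: "J-lipschitz_on UNIV v" "\<And>x. x \<notin> \<Omega> \<Longrightarrow> v x = 0" "AE x in lebesgue_on \<Omega>. u x = v x"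
    using W1inf0_lipschitz_representative[OF \<Omega>(1,2) W, of J] J eqJ by auto
  then have lipv: "lip0 \<Omega> J v" by (simp add: lip0_def)
  have key': "J + L2_inner \<Omega> p z - L2_inner \<Omega> p u \<le> M" if "lip0 \<Omega> M z" for M z
  proof (rule field_le_epsilon)
    fix \<epsilon> :: real assume "\<epsilon> > 0"
    then show "J + L2_inner \<Omega> p z - L2_inner \<Omega> p u \<le> M + \<epsilon>"
      using key[OF that, of \<epsilon>] by (simp add: J)
  qed
  have vL2: "v \<in> L2 \<Omega>" using lipv \<Omega> by (intro lip0_L2)
  have puv: "L2_inner \<Omega> p v = L2_inner \<Omega> p u"
    unfolding L2_inner_commute[of \<Omega> p]
    by (rule L2_inner_cong_AE) (use v(3) u vL2 pL2 in \<open>auto simp: L2_def\<close>)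
  have "J \<le> L2_inner \<Omega> p u"
    using key'[OF \<open>lip0 \<Omega> 0 (\<lambda>_. 0)\<close>] by (simp add: L2_inner_def)
  moreover have "L2_inner \<Omega> p u \<le> J"
  proof -
    have "lip0 \<Omega> (2 * J) (\<lambda>x. 2 * v x)"
      using v lipschitz_on_cmult_real[OF v(1), of 2] by (simp add: lip0_def)
    from key'[OF this] show ?thesis by (simp add: L2_inner_scale_right puv)
  qed
  ultimately have JJ: "L2_inner \<Omega> p u = J" by simp
  show "\<exists>v. lip0 \<Omega> (L2_inner \<Omega> p u) v \<and> (AE x in lebesgue_on \<Omega>. u x = v x)"
    using lipv v(3) JJ by auto
  show "L2_inner \<Omega> p z \<le> M" if "lip0 \<Omega> M z" for M z
    using key'[OF that] JJ by simp
qed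

section \<open>Concentration on the distance function\<close>

lemma lip0_infdist:
  assumes "\<Omega> \<noteq> (UNIV :: 'a::euclidean_space set)"
  shows "lip0 \<Omega> 1 (\<lambda>x. infdist x (- \<Omega>))"
  unfolding lip0_def
proof (intro conjI allI impI lipschitz_onI)
  fix x y :: 'a
  show "dist (infdist x (- \<Omega>)) (infdist y (- \<Omega>)) \<le> 1 * dist x y"
    using infdist_triangle_abs[of x "- \<Omega>" y] by (simp add: dist_real_def)
qed auto

lemma infdist_complement_pos:
  assumes "open \<Omega>" "\<Omega> \<noteq> (UNIV :: 'a::euclidean_space set)" "x \<in> \<Omega>"
  shows "0 < infdist x (- \<Omega>)"
  using assms in_closed_iff_infdist_zero[of "- \<Omega>" x] infdist_nonneg[of x "- \<Omega>"]
  by (auto simp: closed_Compl less_le)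

text \<open>
  The distance to the complement dominates every \<open>1\<close>-Lipschitz function vanishing there.
\<close>

lemma lip0_le_infdist:
  fixes z :: "'a::euclidean_space \<Rightarrow> real"
  assumes "open \<Omega>" "\<Omega> \<noteq> UNIV" and z: "lip0 \<Omega> L z"
  shows "\<bar>z x\<bar> \<le> L * infdist x (- \<Omega>)"
proof -
  obtain y where y: "y \<in> - \<Omega>" "infdist x (- \<Omega>) = dist x y"
    using infdist_attains_inf[of "- \<Omega>" x] assms by (auto simp: closed_Compl)
  then have "z y = 0" using z by (simp add: lip0_def)
  then show ?thesis
    using z lipschitz_onD[of L UNIV z x y] y(2) by (simp add: lip0_def dist_real_def)
qed

lemma integral_ball_lower_bound:
  fixes h :: "'a::euclidean_space \<Rightarrow> real"
  assumes \<Omega>: "open \<Omega>" and h: "integrable (lebesgue_on \<Omega>) h" "\<And>y. y \<in> \<Omega> \<Longrightarrow> 0 \<le> h y"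
    and ball: "ball x r \<subseteq> \<Omega>" "0 < r" and lower: "\<And>y. y \<in> ball x r \<Longrightarrow> c \<le> h y"
  shows "c * (unit_ball_vol (real DIM('a)) * r ^ DIM('a)) \<le> (LINT y|lebesgue_on \<Omega>. h y)"
proof -
  have "integrable lebesgue (\<lambda>y. indicator (ball x r) y * c)"
    by (intro integrable_mult_left integrable_real_indicator) (use emeasure_bounded_finite[OF bounded_ball] in auto)
  then have "integrable lebesgue (\<lambda>y. indicator \<Omega> y *\<^sub>R (indicator (ball x r) y * c))"
    using \<Omega> by (intro integrable_mult_indicator) auto
  then have int: "integrable (lebesgue_on \<Omega>) (\<lambda>y. indicator (ball x r) y * c)"
    using \<Omega> by (subst integrable_restrict_space) auto
  have "(LINT y|lebesgue_on \<Omega>. indicator (ball x r) y * c) = (LINT y|lebesgue. indicator \<Omega> y *\<^sub>R (indicator (ball x r) y * c))"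
    using \<Omega> by (intro integral_restrict_space) auto
  also have "(\<lambda>y. indicator \<Omega> y *\<^sub>R (indicator (ball x r) y * c)) = (\<lambda>y. indicator (ball x r) y * c)"
    using ball(1) by (auto simp: fun_eq_iff indicator_def)
  also have "(LINT y|lebesgue. indicator (ball x r) y * c) = c * measure lebesgue (ball x r)"
    by simp
  also have "measure lebesgue (ball x r) = unit_ball_vol (real DIM('a)) * r ^ DIM('a)"
    using ball(2) by (simp add: content_ball)
  finally have "c * (unit_ball_vol (real DIM('a)) * r ^ DIM('a)) = (LINT y|lebesgue_on \<Omega>. indicator (ball x r) y * c)" ..
  also have "\<dots> \<le> (LINT y|lebesgue_on \<Omega>. h y)"
    by (rule integral_mono[OF int h(1)]) (use lower h(2) in \<open>auto simp: indicator_def\<close>)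
  finally show ?thesis .
qed

text \<open>
  The function \<open>h k = w k * (\<Lambda> k * d - w k)\<close> is nonnegative, Lipschitz with a constant independent
  of \<open>k\<close>, and its integral tends to \<open>0\<close>; so it tends to \<open>0\<close> uniformly where \<open>d\<close> is bounded away
  from \<open>0\<close>.  On a path in \<open>\<Omega>\<close> the value \<open>\<Lambda> k * d / 2\<close>, where \<open>h k\<close> is not small, is then
  avoided by \<open>w k\<close>, and therefore \<open>w k\<close> is close to \<open>0\<close> at all points or close to \<open>\<Lambda> k * d\<close> at
  all points.  The first alternative contradicts \<open>\<parallel>w k\<parallel> = 1\<close>.
\<close>

lemma concentration_on_distance_function:
  fixes \<Omega> :: "'a::euclidean_space set" and w :: "nat \<Rightarrow> 'a \<Rightarrow> real" and \<Lambda> :: "nat \<Rightarrow> real"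
  assumes d: "\<And>x. d x = infdist x (- \<Omega>)"
  assumes \<Omega>: "open \<Omega>" "bounded \<Omega>" "connected \<Omega>" "\<Omega> \<noteq> {}"
    and w: "\<And>k. lip0 \<Omega> (\<Lambda> k) (w k)" "\<And>k x. 0 \<le> w k x" "\<And>k. L2_inner \<Omega> (w k) (w k) = 1"
    and C: "\<And>k. \<Lambda> k \<le> C"
    and lim: "(\<lambda>k. \<Lambda> k * L2_inner \<Omega> (w k) d) \<longlonglongrightarrow> 1"
  shows "(\<lambda>k. (\<Lambda> k)\<^sup>2 * L2_inner \<Omega> d d) \<longlonglongrightarrow> 1"
proof -
  have d_def: "d = (\<lambda>x. infdist x (- \<Omega>))" using d by auto
  have nU: "\<Omega> \<noteq> UNIV" using \<Omega>(2) not_bounded_UNIV by blast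
  have d1: "lip0 \<Omega> 1 d" unfolding d_def by (rule lip0_infdist[OF nU])
  have dpos: "0 < d x" if "x \<in> \<Omega>" for x unfolding d_def by (rule infdist_complement_pos[OF \<Omega>(1) nU that])
  have d0: "0 \<le> d x" for x by (simp add: d_def infdist_nonneg)
  have ddist: "\<bar>d x - d y\<bar> \<le> dist x y" for x y
    using d1 lipschitz_onD[of 1 UNIV d x y] by (simp add: lip0_def dist_real_def)
  have \<Lambda>0: "0 \<le> \<Lambda> k" for k using w(1)[of k] by (auto simp: lip0_def intro: lipschitz_on_nonneg)
  have C0: "0 \<le> C" using \<Lambda>0[of 0] C[of 0] by simp
  have wdist: "\<bar>w k x - w k y\<bar> \<le> \<Lambda> k * dist x y" for k x y
    using w(1)[of k] lipschitz_onD[of "\<Lambda> k" UNIV "w k" x y] by (simp add: lip0_def dist_real_def)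
  have wle: "w k x \<le> \<Lambda> k * d x" for k x
    using lip0_le_infdist[OF \<Omega>(1) nU w(1), of k x] by (simp add: d_def)
  have dL2: "d \<in> L2 \<Omega>" and wL2: "w k \<in> L2 \<Omega>" for k
    using lip0_L2[OF \<Omega>(1,2)] d1 w(1) by auto
  define N where "N = L2_inner \<Omega> d d"
  have "bounded (d ` closure \<Omega>)"
    using \<Omega>(2) lip0_continuous[OF d1]
    by (intro compact_imp_bounded compact_continuous_image) (auto intro: continuous_on_subset)
  then obtain D0 where D0: "\<And>x. x \<in> closure \<Omega> \<Longrightarrow> \<bar>d x\<bar> \<le> D0" by (auto simp: bounded_iff)
  define D where "D = max D0 0"
  have D: "d x \<le> D" "0 \<le> D" for x
    using D0[of x] d1 closure_subset[of \<Omega>] by (cases "x \<in> \<Omega>"; force simp: D_def lip0_def)+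
  have norm_le: "1 \<le> (\<Lambda> k)\<^sup>2 * N" for k
  proof -
    have "L2_inner \<Omega> (w k) (w k) \<le> L2_inner \<Omega> (\<lambda>x. \<Lambda> k * d x) (\<lambda>x. \<Lambda> k * d x)"
      unfolding L2_inner_def
    proof (rule integral_mono)
      show "w k x * w k x \<le> \<Lambda> k * d x * (\<Lambda> k * d x)" for x
        using wle[of k x] w(2)[of k x] by (intro mult_mono) auto
    qed (intro L2_mult_integrable L2_scale dL2 wL2)+
    then show ?thesis using w(3)[of k]
      by (simp add: L2_inner_scale_left L2_inner_scale_right N_def power2_eq_square mult.assoc)
  qed
  have Npos: "N > 0"
    using norm_le[of 0] L2_inner_self_nonneg[of \<Omega> d] by (cases "N = 0") (auto simp: N_def)
  define h where "h k x = w k x * (\<Lambda> k * d x - w k x)" for k x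
  have h0: "0 \<le> h k x" for k x using w(2) wle by (simp add: h_def)
  have hint: "integrable (lebesgue_on \<Omega>) (h k)" for k
    unfolding h_def[abs_def] by (intro L2_mult_integrable L2_diff L2_scale wL2 dL2)
  define I where "I k = (LINT x|lebesgue_on \<Omega>. h k x)" for k
  have Ieq: "I k = \<Lambda> k * L2_inner \<Omega> (w k) d - 1" for k
  proof -
    have "I k = L2_inner \<Omega> (w k) (\<lambda>x. \<Lambda> k * d x - w k x)" by (simp add: I_def h_def L2_inner_def)
    then show ?thesis using w(3)[of k]
      by (simp add: L2_inner_diff_right[OF L2_scale[OF dL2] wL2 wL2] L2_inner_scale_right)
  qed
  have Ilim: "I \<longlonglongrightarrow> 0"
    unfolding Ieq[abs_def] using tendsto_diff[OF lim tendsto_const[of 1]] by simp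
  \<comment> \<open>A Lipschitz constant of every \<open>h k\<close>.\<close>
  define K where "K = 3 * C\<^sup>2 * D"
  have K0: "K \<ge> 0" using D(2) by (simp add: K_def)
  have hlip: "h k y \<ge> h k x - K * dist x y" for k x y
  proof -
    have a: "\<bar>\<Lambda> k * d x - w k x\<bar> \<le> C * D"
    proof -
      have "\<bar>\<Lambda> k * d x - w k x\<bar> \<le> \<Lambda> k * d x" using wle[of k x] w(2)[of k x] by simp
      also have "\<dots> \<le> C * D" using C[of k] D d0 C0 by (intro mult_mono) auto
      finally show ?thesis .
    qed
    have b: "\<bar>w k y\<bar> \<le> C * D"
    proof -
      have "\<bar>w k y\<bar> \<le> \<Lambda> k * d y" using wle[of k y] w(2)[of k y] by simp
      also have "\<dots> \<le> C * D" using C[of k] D d0 C0 by (intro mult_mono) auto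
      finally show ?thesis .
    qed
    have c: "\<bar>w k x - w k y\<bar> \<le> C * dist x y"
      using wdist[of k x y] mult_right_mono[OF C[of k], of "dist x y"] by simp
    have e: "\<bar>\<Lambda> k * (d x - d y)\<bar> \<le> C * dist x y"
      using ddist[of x y] C[of k] C0 \<Lambda>0[of k] by (auto simp: abs_mult intro!: mult_mono)
    have "h k x - h k y = (w k x - w k y) * (\<Lambda> k * d x - w k x) + w k y * (\<Lambda> k * (d x - d y) - (w k x - w k y))"
      by (simp add: h_def algebra_simps)
    also have "\<dots> \<le> \<bar>w k x - w k y\<bar> * \<bar>\<Lambda> k * d x - w k x\<bar> + \<bar>w k y\<bar> * \<bar>\<Lambda> k * (d x - d y) - (w k x - w k y)\<bar>"
      by (simp add: abs_mult[symmetric] add_mono)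
    also have "\<dots> \<le> (C * dist x y) * (C * D) + (C * D) * (2 * (C * dist x y))"
      using a b c e C0 D(2) by (intro add_mono mult_mono) auto
    also have "\<dots> = K * dist x y" by (simp add: K_def power2_eq_square algebra_simps)
    finally show ?thesis by simp
  qed
  have unif: "\<forall>\<^sub>F k in sequentially. \<forall>x. \<rho> \<le> d x \<longrightarrow> h k x < \<epsilon>" if "\<rho> > 0" "\<epsilon> > 0" for \<rho> \<epsilon>
  proof -
    define r where "r = min \<rho> (\<epsilon> / (2 * (K + 1)))"
    have r: "r > 0" "r \<le> \<rho>" using that K0 by (auto simp: r_def)
    have "K * r \<le> (K + 1) * (\<epsilon> / (2 * (K + 1)))" using K0 that by (intro mult_mono) (auto simp: r_def)
    also have "\<dots> = \<epsilon> / 2"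
    proof -
      have "c * (\<epsilon> / (2 * c)) = \<epsilon> / 2" if "c > 0" for c using that by simp
      from this[of "K + 1"] show ?thesis using K0 by (simp only:)
    qed
    finally have Kr: "K * r \<le> \<epsilon> / 2" .
    define V where "V = unit_ball_vol (real DIM('a)) * r ^ DIM('a)"
    have V: "V > 0" using r by (simp add: V_def unit_ball_vol_pos)
    have "\<forall>\<^sub>F k in sequentially. I k < \<epsilon> / 2 * V"
      using Ilim V that by (intro order_tendstoD(2)) auto
    then show ?thesis
    proof eventually_elim
      case (elim k)
      show ?case
      proof (intro allI impI)
        fix x assume x: "\<rho> \<le> d x"
        have "(h k x - K * r) * V \<le> I k"
          unfolding I_def V_def
        proof (rule integral_ball_lower_bound[OF \<Omega>(1) hint h0 _ r(1)])
          show "ball x r \<subseteq> \<Omega>"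
          proof
            fix y assume "y \<in> ball x r"
            then have "d x - d y < r" using ddist[of x y] by simp
            then have "d y \<noteq> 0" using x r by simp
            then show "y \<in> \<Omega>" using d1 by (auto simp: lip0_def)
          qed
          fix y assume "y \<in> ball x r"
          then have "K * dist x y \<le> K * r" using K0 by (intro mult_left_mono) auto
          then show "h k x - K * r \<le> h k y" using hlip[of k x y] by simp
        qed
        then have "(h k x - K * r) * V < \<epsilon> / 2 * V" using elim by simp
        then have "h k x - K * r < \<epsilon> / 2" using V by simp
        then show "h k x < \<epsilon>" using Kr by simp
      qed
    qed
  qed
  obtain x0 where x0: "x0 \<in> \<Omega>" using \<Omega>(4) by blast
  \<comment> \<open>The sign of \<open>f\<close> decides between the two alternatives.\<close>
  define f where "f k x = w k x - \<Lambda> k * d x / 2" for k x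
  have same: "\<forall>\<^sub>F k in sequentially. (0 \<le> f k x \<longleftrightarrow> 0 \<le> f k x0)" if x: "x \<in> \<Omega>" for x
  proof -
    obtain g where g: "path g" "path_image g \<subseteq> \<Omega>" "pathstart g = x0" "pathfinish g = x"
      using connected_open_path_connected[OF \<Omega>(1,3)] x x0 unfolding path_connected_def by metis
    let ?P = "path_image g"
    have P: "compact ?P" "connected ?P" "x0 \<in> ?P" "x \<in> ?P"
      using g by (auto intro: compact_path_image connected_path_image simp flip: g(3,4))
    obtain m where m: "m \<in> ?P" "\<And>y. y \<in> ?P \<Longrightarrow> d m \<le> d y"
      using continuous_attains_inf[OF P(1), of d] P(3) lip0_continuous[OF d1] continuous_on_subset by blast
    have dm: "d m > 0" using m(1) g(2) dpos by blast
    have "\<forall>\<^sub>F k in sequentially. \<forall>y. d m \<le> d y \<longrightarrow> h k y < (d m)\<^sup>2 / (4 * N)"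
      using dm Npos by (intro unif) auto
    then show ?thesis
    proof eventually_elim
      case (elim k)
      have nz: "f k y \<noteq> 0" if "y \<in> ?P" for y
      proof
        assume "f k y = 0"
        then have "w k y = \<Lambda> k * d y / 2" by (simp add: f_def)
        then have "h k y = (\<Lambda> k * d y)\<^sup>2 / 4" by (simp only: h_def power2_eq_square) simp
        moreover have "(d m)\<^sup>2 / N \<le> (\<Lambda> k * d y)\<^sup>2"
        proof -
          have "(d m)\<^sup>2 * 1 \<le> (d y)\<^sup>2 * ((\<Lambda> k)\<^sup>2 * N)"
            using m(2)[OF that] dm norm_le[of k] by (intro mult_mono power_mono) auto
          then show ?thesis using Npos by (simp add: divide_le_eq power_mult_distrib mult_ac)
        qed
        ultimately have "(d m)\<^sup>2 / (4 * N) \<le> h k y" by simp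
        then show False using elim m(2)[OF that] by fastforce
      qed
      have "continuous_on ?P (f k)"
        unfolding f_def using lip0_continuous[OF w(1)] lip0_continuous[OF d1]
        by (intro continuous_intros) (auto intro: continuous_on_subset)
      then have conn: "connected (f k ` ?P)" using P(2) by (rule connected_continuous_image)
      have "0 \<notin> f k ` ?P" using nz by force
      moreover have "f k x0 \<in> f k ` ?P" "f k x \<in> f k ` ?P" using P by auto
      ultimately show ?case
        using connected_contains_Icc[OF conn, of "f k x" "f k x0"] connected_contains_Icc[OF conn, of "f k x0" "f k x"]
        by (meson atLeastAtMost_iff in_mono linear)
    qed
  qed
  \<comment> \<open>The alternative selected at the base point \<open>x0\<close>.\<close>
  define z where "z k x = (if 0 \<le> f k x0 then \<Lambda> k * d x else 0)" for k x
  have zL2: "z k \<in> L2 \<Omega>" for k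
    unfolding z_def[abs_def] using L2_scale[OF dL2, of "\<Lambda> k"] L2_scale[OF dL2, of 0] by (cases "0 \<le> f k x0") auto
  have ptw: "(\<lambda>k. w k x - z k x) \<longlonglongrightarrow> 0" if x: "x \<in> \<Omega>" for x
  proof -
    have dx: "d x > 0" by (rule dpos[OF x])
    have bound: "\<forall>\<^sub>F k in sequentially. \<bar>w k x - z k x\<bar> \<le> 2 * sqrt N / d x * h k x"
      using same[OF x]
    proof eventually_elim
      case (elim k)
      have "1 \<le> sqrt ((\<Lambda> k)\<^sup>2 * N)" using norm_le[of k] by simp
      then have "1 \<le> \<Lambda> k * sqrt N" using \<Lambda>0[of k] by (simp add: real_sqrt_mult)
      then have one: "d x \<le> sqrt N * (\<Lambda> k * d x)" using dx by (simp add: mult_ac)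
      have "\<bar>w k x - z k x\<bar> * (\<Lambda> k * d x) \<le> 2 * h k x"
      proof (cases "0 \<le> f k x0")
        case True
        then have half: "\<Lambda> k * d x \<le> 2 * w k x" using elim by (simp add: f_def)
        have "(\<Lambda> k * d x - w k x) * (\<Lambda> k * d x) \<le> (\<Lambda> k * d x - w k x) * (2 * w k x)"
          using half wle[of k x] by (intro mult_left_mono) auto
        then show ?thesis using True wle[of k x] by (simp add: z_def h_def mult_ac)
      next
        case False
        then have half: "2 * w k x \<le> \<Lambda> k * d x" using elim by (simp add: f_def)
        have "w k x * (\<Lambda> k * d x) \<le> w k x * (2 * (\<Lambda> k * d x - w k x))"
          using half w(2)[of k x] by (intro mult_left_mono) auto
        then show ?thesis using False w(2)[of k x] by (simp add: z_def h_def algebra_simps)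
      qed
      then have "sqrt N * (\<bar>w k x - z k x\<bar> * (\<Lambda> k * d x)) \<le> sqrt N * (2 * h k x)"
        using Npos by (intro mult_left_mono) auto
      moreover have "\<bar>w k x - z k x\<bar> * d x \<le> \<bar>w k x - z k x\<bar> * (sqrt N * (\<Lambda> k * d x))"
        using one by (intro mult_left_mono) auto
      ultimately have "\<bar>w k x - z k x\<bar> * d x \<le> 2 * sqrt N * h k x" by (simp add: mult_ac)
      then show ?case using dx by (simp add: field_simps)
    qed
    have "(\<lambda>k. h k x) \<longlonglongrightarrow> 0"
    proof (rule order_tendstoI)
      fix a :: real assume "a < 0"
      then show "\<forall>\<^sub>F k in sequentially. a < h k x" by (intro always_eventually allI less_le_trans[OF _ h0])
    next
      fix a :: real assume "0 < a"
      then show "\<forall>\<^sub>F k in sequentially. h k x < a"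
        using eventually_mono[OF unif[OF dx \<open>0 < a\<close>], of "\<lambda>k. h k x < a"] by blast
    qed
    then have "(\<lambda>k. 2 * sqrt N / d x * h k x) \<longlonglongrightarrow> 0" by (rule tendsto_mult_right_zero)
    then show ?thesis by (rule Lim_null_comparison[rotated]) (use bound in simp)
  qed
  have bnd: "0 \<le> w k x" "w k x \<le> C * D" "0 \<le> z k x" "z k x \<le> C * D" for k x
  proof -
    have le: "\<Lambda> k * d x \<le> C * D" using C[of k] D d0 C0 by (intro mult_mono) auto
    then show "0 \<le> w k x" "w k x \<le> C * D" "0 \<le> z k x" "z k x \<le> C * D"
      using w(2)[of k x] wle[of k x] \<Lambda>0[of k] d0[of x] C0 D(2) by (auto simp: z_def)
  qed
  have "(\<lambda>k. LINT x|lebesgue_on \<Omega>. w k x * w k x - z k x * z k x) \<longlonglongrightarrow> (LINT x|lebesgue_on \<Omega>. 0)"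
  proof (rule integral_dominated_convergence)
    have "\<Omega> \<in> lmeasurable" using \<Omega>(1,2) by (simp add: lmeasurable_open)
    then interpret finite_measure "lebesgue_on \<Omega>" by (rule finite_measure_lebesgue_on)
    show "integrable (lebesgue_on \<Omega>) (\<lambda>x. (C * D) * (C * D) + (C * D) * (C * D))" by simp
    show "(\<lambda>x. w k x * w k x - z k x * z k x) \<in> borel_measurable (lebesgue_on \<Omega>)" for k
      using L2_measurable[OF wL2[of k]] L2_measurable[OF zL2[of k]] by auto
    show "AE x in lebesgue_on \<Omega>. norm (w k x * w k x - z k x * z k x) \<le> (C * D) * (C * D) + (C * D) * (C * D)" for k
    proof (rule AE_I2)
      fix x
      have "w k x * w k x \<le> (C * D) * (C * D)" "z k x * z k x \<le> (C * D) * (C * D)"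
        "0 \<le> w k x * w k x" "0 \<le> z k x * z k x"
        using bnd[where k=k and x=x] C0 D(2) by (auto intro!: mult_mono)
      then show "norm (w k x * w k x - z k x * z k x) \<le> (C * D) * (C * D) + (C * D) * (C * D)"
        by (simp only: real_norm_def abs_le_iff) linarith
    qed
    show "AE x in lebesgue_on \<Omega>. (\<lambda>k. w k x * w k x - z k x * z k x) \<longlonglongrightarrow> 0"
    proof (rule AE_I2)
      fix x assume "x \<in> space (lebesgue_on \<Omega>)"
      then have "(\<lambda>k. \<bar>w k x - z k x\<bar> * (2 * (C * D))) \<longlonglongrightarrow> 0"
        using tendsto_mult_left_zero[OF tendsto_rabs_zero[OF ptw]] by simp
      then show "(\<lambda>k. w k x * w k x - z k x * z k x) \<longlonglongrightarrow> 0"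
      proof (rule Lim_null_comparison[rotated], intro always_eventually allI)
        fix k
        have "\<bar>w k x + z k x\<bar> \<le> 2 * (C * D)" using bnd[where k=k and x=x] by simp
        then have "\<bar>w k x - z k x\<bar> * \<bar>w k x + z k x\<bar> \<le> \<bar>w k x - z k x\<bar> * (2 * (C * D))"
          by (intro mult_left_mono) auto
        moreover have "w k x * w k x - z k x * z k x = (w k x - z k x) * (w k x + z k x)"
          by (simp add: algebra_simps)
        ultimately show "norm (w k x * w k x - z k x * z k x) \<le> \<bar>w k x - z k x\<bar> * (2 * (C * D))"
          by (simp add: abs_mult)
      qed
    qed
  qed simp
  moreover have "(LINT x|lebesgue_on \<Omega>. w k x * w k x - z k x * z k x) = 1 - (if 0 \<le> f k x0 then (\<Lambda> k)\<^sup>2 * N else 0)" for k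
  proof -
    have "(LINT x|lebesgue_on \<Omega>. w k x * w k x - z k x * z k x) = L2_inner \<Omega> (w k) (w k) - L2_inner \<Omega> (z k) (z k)"
      unfolding L2_inner_def by (rule Bochner_Integration.integral_diff; intro L2_mult_integrable wL2 zL2)
    moreover have "L2_inner \<Omega> (z k) (z k) = (if 0 \<le> f k x0 then (\<Lambda> k)\<^sup>2 * N else 0)"
      by (simp add: z_def[abs_def] L2_inner_scale_left L2_inner_scale_right N_def power2_eq_square)
        (simp add: L2_inner_def)
    ultimately show ?thesis using w(3) by simp
  qed
  ultimately have l: "(\<lambda>k. 1 - (if 0 \<le> f k x0 then (\<Lambda> k)\<^sup>2 * N else 0)) \<longlonglongrightarrow> 0" by simp
  then have "\<forall>\<^sub>F k in sequentially. 1 - (if 0 \<le> f k x0 then (\<Lambda> k)\<^sup>2 * N else 0) < 1"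
    by (rule order_tendstoD) simp
  then have "\<forall>\<^sub>F k in sequentially. 1 - (1 - (if 0 \<le> f k x0 then (\<Lambda> k)\<^sup>2 * N else 0)) = (\<Lambda> k)\<^sup>2 * N"
    by eventually_elim (auto split: if_splits)
  moreover have "(\<lambda>k. 1 - (1 - (if 0 \<le> f k x0 then (\<Lambda> k)\<^sup>2 * N else 0))) \<longlonglongrightarrow> 1"
    using tendsto_diff[OF tendsto_const[of 1] l] by simp
  ultimately show ?thesis unfolding N_def[symmetric] by (rule Lim_transform_eventually[rotated])
qed

section \<open>The flow and its monotone quantities\<close>

text \<open>
  Tilting \<open>\<phi>\<close> by a small negative slope makes the right derivatives strictly negative; then the
  last point at which the tilted function does not exceed its initial value must be \<open>b\<close>.
\<close>

lemma nonincreasing_of_right_derivative: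
  fixes \<phi> :: "real \<Rightarrow> real"
  assumes "a \<le> b" and cont: "continuous_on {a..b} \<phi>"
    and der: "\<And>t. a < t \<Longrightarrow> t < b \<Longrightarrow> \<exists>D\<le>0. (\<phi> has_real_derivative D) (at_right t)"
  shows "\<phi> b \<le> \<phi> a"
proof (cases "a = b")
  case False
  then have "a < b" using assms(1) by simp
  have from_inside: "\<phi> b \<le> \<phi> s" if s: "a < s" "s < b" for s
  proof (rule field_le_epsilon)
    fix e :: real assume "e > 0"
    define \<epsilon> where "\<epsilon> = e / (b - s)"
    have \<epsilon>: "\<epsilon> > 0" using \<open>e > 0\<close> s by (simp add: \<epsilon>_def)
    define \<psi> where "\<psi> t = \<phi> t - \<epsilon> * t" for t
    have cont\<psi>: "continuous_on {s..b} \<psi>"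
      unfolding \<psi>_def using s by (intro continuous_intros continuous_on_subset[OF cont]) auto
    define A where "A = {t \<in> {s..b}. \<psi> t \<le> \<psi> s}"
    have "closed A"
      unfolding A_def using continuous_on_closed_Collect_le[OF cont\<psi> continuous_on_const] by simp
    moreover have "bounded A" unfolding A_def by (rule bounded_subset[of "{s..b}"]) auto
    moreover have "s \<in> A" using s by (simp add: A_def)
    ultimately obtain c where c: "c \<in> A" "\<And>t. t \<in> A \<Longrightarrow> t \<le> c"
      using compact_attains_sup[of A] by (auto simp: compact_eq_bounded_closed)
    have "c = b"
    proof (rule ccontr)
      assume "c \<noteq> b"
      then have cb: "a < c" "c < b" using c(1) s by (auto simp: A_def)
      obtain D where D: "D \<le> 0" "(\<phi> has_real_derivative D) (at_right c)" using der[OF cb] by blast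
      then have "(\<psi> has_real_derivative D - \<epsilon>) (at_right c)"
        unfolding \<psi>_def by (auto intro!: derivative_eq_intros)
      then have "((\<lambda>t. (\<psi> t - \<psi> c) / (t - c)) \<longlongrightarrow> D - \<epsilon>) (at_right c)"
        by (simp add: has_field_derivative_iff)
      moreover have "D - \<epsilon> < 0" using D(1) \<epsilon> by simp
      ultimately have "\<forall>\<^sub>F t in at_right c. (\<psi> t - \<psi> c) / (t - c) < 0"
        by (rule order_tendstoD(2))
      moreover have "\<forall>\<^sub>F t in at_right c. c < t \<and> t < b"
        using cb(2) by (auto simp: eventually_at_right intro!: exI[of _ b])
      ultimately have "\<forall>\<^sub>F t in at_right c. c < t \<and> t < b \<and> \<psi> t < \<psi> c"
        by eventually_elim (auto simp: divide_less_0_iff)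
      then obtain t where t: "c < t" "t < b" "\<psi> t < \<psi> c"
        using eventually_happens[of _ "at_right c"] by (auto simp: trivial_limit_at_right_real)
      then have "t \<in> A" using c(1) by (auto simp: A_def)
      then show False using c(2) t(1) by fastforce
    qed
    then have "\<psi> b \<le> \<psi> s" using c(1) by (simp add: A_def)
    then have "\<phi> b \<le> \<phi> s + \<epsilon> * (b - s)" by (simp add: \<psi>_def algebra_simps)
    then show "\<phi> b \<le> \<phi> s + e" using s by (simp add: \<epsilon>_def)
  qed
  have "(\<phi> \<longlongrightarrow> \<phi> a) (at_right a)"
    using cont \<open>a < b\<close> by (simp add: continuous_on_Icc_at_rightD)
  then show ?thesis
  proof (rule tendsto_lowerbound)
    show "\<forall>\<^sub>F s in at_right a. \<phi> b \<le> \<phi> s"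
      using from_inside \<open>a < b\<close> by (auto simp: eventually_at_right intro!: exI[of _ b])
  qed simp
qed simp

lemma has_right_derivative_iff:
  fixes \<phi> :: "real \<Rightarrow> real"
  shows "(\<phi> has_real_derivative D) (at_right t) \<longleftrightarrow> ((\<lambda>h. (\<phi> (t + h) - \<phi> t) / h) \<longlongrightarrow> D) (at_right 0)"
  unfolding has_field_derivative_iff
  by (subst at_right_to_0) (simp add: filterlim_filtermap add.commute)

text \<open>
  A flow whose velocity \<open>- p t\<close> is characterised by Lipschitz functions alone: the assumptions
  \<open>u_rep\<close> and \<open>p_le\<close> say that \<open>p t\<close> is a subgradient at \<open>u t\<close> of the Lipschitz constant.
\<close>

locale lipschitz_flow =
  fixes \<Omega> :: "'a::euclidean_space set" and u p :: "real \<Rightarrow> 'a \<Rightarrow> real"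
  assumes \<Omega>: "open \<Omega>" "bounded \<Omega>" "connected \<Omega>" "\<Omega> \<noteq> {}"
    and u_L2: "0 \<le> t \<Longrightarrow> u t \<in> L2 \<Omega>"
    and u_cont: "0 \<le> t \<Longrightarrow> ((\<lambda>s. L2_norm \<Omega> (\<lambda>x. u s x - u t x)) \<longlongrightarrow> 0) (at t within {0..})"
    and u_lip: "0 < \<delta> \<Longrightarrow> \<exists>L. \<forall>s\<ge>\<delta>. \<forall>t\<ge>\<delta>. L2_norm \<Omega> (\<lambda>x. u s x - u t x) \<le> L * \<bar>s - t\<bar>"
    and p_L2: "0 < t \<Longrightarrow> p t \<in> L2 \<Omega>"
    and u_deriv: "0 < t \<Longrightarrow> ((\<lambda>h. L2_norm \<Omega> (\<lambda>x. (u (t + h) x - u t x) / h - - p t x)) \<longlongrightarrow> 0) (at_right 0)"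
    and u_rep: "0 < t \<Longrightarrow> \<exists>v. lip0 \<Omega> (L2_inner \<Omega> (p t) (u t)) v \<and> (AE x in lebesgue_on \<Omega>. u t x = v x)"
    and p_le: "0 < t \<Longrightarrow> lip0 \<Omega> M z \<Longrightarrow> L2_inner \<Omega> (p t) z \<le> M"
    and u0_nonneg: "AE x in lebesgue_on \<Omega>. 0 \<le> u 0 x"
    and u0_nonzero: "\<not> (AE x in lebesgue_on \<Omega>. u 0 x = 0)"
begin

abbreviation ip where "ip \<equiv> L2_inner \<Omega>"

abbreviation nrm where "nrm \<equiv> L2_norm \<Omega>"

text \<open>
  By homogeneity, the value of the functional at \<open>u t\<close>.
\<close>

definition J :: "real \<Rightarrow> real" where "J t = L2_inner \<Omega> (p t) (u t)"

definition y :: "real \<Rightarrow> real" where "y t = L2_inner \<Omega> (u t) (u t)"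

definition d :: "'a \<Rightarrow> real" where "d x = infdist x (- \<Omega>)"

definition N :: real where "N = L2_inner \<Omega> d d"

lemma not_UNIV: "\<Omega> \<noteq> UNIV"
  using \<Omega>(2) not_bounded_UNIV by blast

lemma lip0_d: "lip0 \<Omega> 1 d"
  unfolding d_def[abs_def] by (rule lip0_infdist[OF not_UNIV])

lemma d_L2: "d \<in> L2 \<Omega>"
  by (rule lip0_L2[OF \<Omega>(1,2) lip0_d])

lemma J_nonneg: "0 < t \<Longrightarrow> 0 \<le> J t"
  using u_rep[of t] by (auto simp: J_def lip0_def intro: lipschitz_on_nonneg)

lemma y_nonneg: "0 \<le> y t"
  by (simp add: y_def L2_inner_self_nonneg)

lemma L2_norm_u: "nrm (u t) = sqrt (y t)"
  by (simp add: y_def L2_norm_def L2_inner_def power2_eq_square)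

text \<open>
  Along the flow, \<open>\<Phi>\<close> agrees with its linearisation \<open>g t\<close> up to the squared distance.  This makes
  \<open>\<Phi>\<close> continuous with right derivative \<open>- \<langle>p t, g t\<rangle>\<close>, and it covers linear functionals, the
  squared norm and the squared norm of the negative part.
\<close>

definition quadratic_along :: "(real \<Rightarrow> real) \<Rightarrow> (real \<Rightarrow> 'a \<Rightarrow> real) \<Rightarrow> bool" where
  "quadratic_along \<Phi> g \<longleftrightarrow> (\<forall>t\<ge>0. g t \<in> L2 \<Omega> \<and>
     (\<forall>s\<ge>0. \<bar>\<Phi> s - \<Phi> t - ip (\<lambda>x. u s x - u t x) (g t)\<bar> \<le> (nrm (\<lambda>x. u s x - u t x))\<^sup>2))"

lemma quadratic_along_continuous:
  assumes "quadratic_along \<Phi> g"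
  shows "continuous_on {0..} \<Phi>"
  unfolding continuous_on_def
proof
  fix t :: real assume "t \<in> {0..}"
  then have t: "0 \<le> t" by simp
  let ?n = "\<lambda>s. nrm (\<lambda>x. u s x - u t x)"
  have g: "g t \<in> L2 \<Omega>" using assms t by (simp add: quadratic_along_def)
  have "((\<lambda>s. ?n s * nrm (g t) + (?n s)\<^sup>2) \<longlongrightarrow> 0 * nrm (g t) + 0\<^sup>2) (at t within {0..})"
    by (intro tendsto_intros u_cont t)
  then have lim: "((\<lambda>s. ?n s * nrm (g t) + (?n s)\<^sup>2) \<longlongrightarrow> 0) (at t within {0..})" by simp
  have "((\<lambda>s. \<Phi> s - \<Phi> t) \<longlongrightarrow> 0) (at t within {0..})"
  proof (rule Lim_null_comparison[OF _ lim])
    show "\<forall>\<^sub>F s in at t within {0..}. norm (\<Phi> s - \<Phi> t) \<le> ?n s * nrm (g t) + (?n s)\<^sup>2"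
    proof (rule eventually_mono)
      show "\<forall>\<^sub>F s in at t within {0..}. s \<in> {0..}" by (simp add: eventually_at_filter)
      fix s :: real assume "s \<in> {0..}"
      then have s: "0 \<le> s" by simp
      have "\<bar>ip (\<lambda>x. u s x - u t x) (g t)\<bar> \<le> ?n s * nrm (g t)"
        by (intro L2_Cauchy_Schwarz L2_diff u_L2 s t g)
      moreover have "\<bar>\<Phi> s - \<Phi> t - ip (\<lambda>x. u s x - u t x) (g t)\<bar> \<le> (?n s)\<^sup>2"
        using assms s t by (simp add: quadratic_along_def)
      ultimately show "norm (\<Phi> s - \<Phi> t) \<le> ?n s * nrm (g t) + (?n s)\<^sup>2"
        unfolding real_norm_def by linarith
    qed
  qed
  then show "(\<Phi> \<longlongrightarrow> \<Phi> t) (at t within {0..})" by (simp add: LIM_zero_iff)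
qed

lemma quotient_inner_tendsto:
  assumes t: "0 < t" and g: "g \<in> L2 \<Omega>"
  shows "((\<lambda>h. ip (\<lambda>x. u (t + h) x - u t x) g / h) \<longlongrightarrow> - ip (p t) g) (at_right 0)"
proof -
  let ?r = "\<lambda>h x. (u (t + h) x - u t x) / h - - p t x"
  have "((\<lambda>h. nrm (?r h) * nrm g) \<longlongrightarrow> 0 * nrm g) (at_right 0)"
    by (intro tendsto_intros u_deriv t)
  then have lim: "((\<lambda>h. nrm (?r h) * nrm g) \<longlongrightarrow> 0) (at_right 0)" by simp
  have "((\<lambda>h. ip (\<lambda>x. u (t + h) x - u t x) g / h - - ip (p t) g) \<longlongrightarrow> 0) (at_right 0)"
  proof (rule Lim_null_comparison[OF _ lim])
    show "\<forall>\<^sub>F h in at_right 0. norm (ip (\<lambda>x. u (t + h) x - u t x) g / h - - ip (p t) g)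
        \<le> nrm (?r h) * nrm g"
      using eventually_at_right_less[of 0]
    proof eventually_elim
      fix h :: real assume h: "0 < h"
      have q: "(\<lambda>x. (u (t + h) x - u t x) / h) \<in> L2 \<Omega>"
        using t h by (intro L2_divide L2_diff u_L2) auto
      have "ip (?r h) g = ip (\<lambda>x. u (t + h) x - u t x) g / h - - ip (p t) g"
        using L2_inner_diff_left[OF q L2_uminus[OF p_L2[OF t]] g]
        by (simp add: L2_inner_divide_left L2_inner_uminus_left)
      then show "norm (ip (\<lambda>x. u (t + h) x - u t x) g / h - - ip (p t) g)
        \<le> nrm (?r h) * nrm g"
        using L2_Cauchy_Schwarz[OF L2_diff[OF q L2_uminus[OF p_L2[OF t]]] g] by simp
    qed
  qed
  then show ?thesis using LIM_zero_iff by blast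
qed

lemma quadratic_along_right_derivative:
  assumes \<Phi>: "quadratic_along \<Phi> g" and t: "0 < t"
  shows "(\<Phi> has_real_derivative - ip (p t) (g t)) (at_right t)"
proof -
  let ?n = "\<lambda>h. nrm (\<lambda>x. u (t + h) x - u t x)"
  have g: "g t \<in> L2 \<Omega>" using \<Phi> t by (simp add: quadratic_along_def)
  obtain L where L: "\<And>s. s \<ge> t \<Longrightarrow> nrm (\<lambda>x. u s x - u t x) \<le> L * \<bar>s - t\<bar>"
    using u_lip[OF t] by blast
  have "((\<lambda>h. L\<^sup>2 * h) \<longlongrightarrow> L\<^sup>2 * 0) (at_right 0)"
    by (intro tendsto_intros)
  then have lim: "((\<lambda>h. L\<^sup>2 * h) \<longlongrightarrow> 0) (at_right 0)" by simp
  have "((\<lambda>h. (\<Phi> (t + h) - \<Phi> t) / h - ip (\<lambda>x. u (t + h) x - u t x) (g t) / h) \<longlongrightarrow> 0) (at_right 0)"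
  proof (rule Lim_null_comparison[OF _ lim])
    show "\<forall>\<^sub>F h in at_right 0. norm ((\<Phi> (t + h) - \<Phi> t) / h - ip (\<lambda>x. u (t + h) x - u t x) (g t) / h) \<le> L\<^sup>2 * h"
      using eventually_at_right_less[of 0]
    proof eventually_elim
      fix h :: real assume h: "0 < h"
      have "\<bar>\<Phi> (t + h) - \<Phi> t - ip (\<lambda>x. u (t + h) x - u t x) (g t)\<bar> \<le> (?n h)\<^sup>2"
        using \<Phi> t h by (simp add: quadratic_along_def)
      also have "\<dots> \<le> (L * h)\<^sup>2"
        using L[of "t + h"] h by (intro power_mono) (auto simp: L2_norm_nonneg)
      finally have "\<bar>\<Phi> (t + h) - \<Phi> t - ip (\<lambda>x. u (t + h) x - u t x) (g t)\<bar> / h \<le> L\<^sup>2 * h"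
        using h by (simp add: divide_le_eq power_mult_distrib power2_eq_square mult_ac)
      then show "norm ((\<Phi> (t + h) - \<Phi> t) / h - ip (\<lambda>x. u (t + h) x - u t x) (g t) / h) \<le> L\<^sup>2 * h"
        using h by (simp add: diff_divide_distrib[symmetric])
    qed
  qed
  from tendsto_add[OF this quotient_inner_tendsto[OF t g]]
  show ?thesis by (simp add: has_right_derivative_iff)
qed

lemma quadratic_along_inner:
  assumes z: "z \<in> L2 \<Omega>"
  shows "quadratic_along (\<lambda>s. ip (u s) z) (\<lambda>_. z)"
  using z by (simp add: quadratic_along_def L2_inner_diff_left u_L2)

lemma quadratic_along_y: "quadratic_along y (\<lambda>s x. 2 * u s x)"
  unfolding quadratic_along_def
proof (intro allI impI conjI)
  fix t s :: real assume "0 \<le> t" "0 \<le> s"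
  then have U: "u t \<in> L2 \<Omega>" "u s \<in> L2 \<Omega>" by (auto intro: u_L2)
  show "\<bar>y s - y t - ip (\<lambda>x. u s x - u t x) (\<lambda>x. 2 * u t x)\<bar> \<le> (nrm (\<lambda>x. u s x - u t x))\<^sup>2"
    using L2_norm_diff_power2[OF U(2,1)] L2_inner_diff_left[OF U(2,1) U(1)]
      zero_le_power2[of "nrm (\<lambda>x. u s x - u t x)"]
    by (simp add: y_def L2_inner_scale_right)
qed (auto intro: L2_scale u_L2)

lemma y_continuous: "continuous_on {0..} y"
  by (rule quadratic_along_continuous[OF quadratic_along_y])

lemma y_right_derivative: "0 < t \<Longrightarrow> (y has_real_derivative - 2 * J t) (at_right t)"
  using quadratic_along_right_derivative[OF quadratic_along_y, of t]
  unfolding J_def L2_inner_scale_right by simp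

lemma L2_min_0:
  assumes "v \<in> L2 \<Omega>"
  shows "(\<lambda>x. min (v x) 0) \<in> L2 \<Omega>"
proof -
  have "integrable (lebesgue_on \<Omega>) (\<lambda>x. (min (v x) 0)\<^sup>2)"
  proof (rule Bochner_Integration.integrable_bound)
    show "integrable (lebesgue_on \<Omega>) (\<lambda>x. (v x)\<^sup>2)" using assms by (simp add: L2_def)
    show "(\<lambda>x. (min (v x) 0)\<^sup>2) \<in> borel_measurable (lebesgue_on \<Omega>)"
      using L2_measurable[OF assms] by simp
    show "AE x in lebesgue_on \<Omega>. norm ((min (v x) 0)\<^sup>2) \<le> norm ((v x)\<^sup>2)"
      by (intro AE_I2) (simp add: min_def)
  qed
  then show ?thesis using L2_measurable[OF assms] by (simp add: L2_def)
qed

definition neg_energy :: "real \<Rightarrow> real" where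
  "neg_energy t = (LINT x|lebesgue_on \<Omega>. (min (u t x) 0)\<^sup>2)"

text \<open>
  The real function \<open>(min a 0)\<^sup>2\<close> has a derivative with Lipschitz constant \<open>2\<close>, so it deviates from
  its tangents by at most a square.
\<close>

lemma quadratic_along_neg_energy: "quadratic_along neg_energy (\<lambda>t x. 2 * min (u t x) 0)"
  unfolding quadratic_along_def
proof (intro allI impI conjI)
  fix t :: real assume t: "0 \<le> t"
  show "(\<lambda>x. 2 * min (u t x) 0) \<in> L2 \<Omega>" by (intro L2_scale L2_min_0 u_L2 t)
  fix s :: real assume s: "0 \<le> s"
  let ?D = "\<lambda>x. u s x - u t x"
  let ?m = "\<lambda>s x. min (u s x) 0"
  have i: "integrable (lebesgue_on \<Omega>) (\<lambda>x. (?m s x)\<^sup>2)" "integrable (lebesgue_on \<Omega>) (\<lambda>x. (?m t x)\<^sup>2)"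
    "integrable (lebesgue_on \<Omega>) (\<lambda>x. ?D x * (2 * ?m t x))" "integrable (lebesgue_on \<Omega>) (\<lambda>x. (?D x)\<^sup>2)"
  proof -
    have U: "u s \<in> L2 \<Omega>" "u t \<in> L2 \<Omega>" using s t by (auto intro: u_L2)
    have sq: "integrable (lebesgue_on \<Omega>) (\<lambda>x. (h x)\<^sup>2)" if "h \<in> L2 \<Omega>" for h
      using that by (simp add: L2_def)
    show "integrable (lebesgue_on \<Omega>) (\<lambda>x. (?m s x)\<^sup>2)" by (rule sq[OF L2_min_0[OF U(1)]])
    show "integrable (lebesgue_on \<Omega>) (\<lambda>x. (?m t x)\<^sup>2)" by (rule sq[OF L2_min_0[OF U(2)]])
    show "integrable (lebesgue_on \<Omega>) (\<lambda>x. ?D x * (2 * ?m t x))"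
      by (rule L2_mult_integrable[OF L2_diff[OF U] L2_scale[OF L2_min_0[OF U(2)]]])
    show "integrable (lebesgue_on \<Omega>) (\<lambda>x. (?D x)\<^sup>2)" by (rule sq[OF L2_diff[OF U]])
  qed
  have i12: "integrable (lebesgue_on \<Omega>) (\<lambda>x. (?m s x)\<^sup>2 - (?m t x)\<^sup>2)"
    by (rule Bochner_Integration.integrable_diff[OF i(1) i(2)])
  have i123: "integrable (lebesgue_on \<Omega>) (\<lambda>x. (?m s x)\<^sup>2 - (?m t x)\<^sup>2 - ?D x * (2 * ?m t x))"
    by (rule Bochner_Integration.integrable_diff[OF i12 i(3)])
  have eq: "neg_energy s - neg_energy t - ip ?D (\<lambda>x. 2 * ?m t x)
      = (LINT x|lebesgue_on \<Omega>. (?m s x)\<^sup>2 - (?m t x)\<^sup>2 - ?D x * (2 * ?m t x))"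
  proof -
    have "(LINT x|lebesgue_on \<Omega>. (?m s x)\<^sup>2 - (?m t x)\<^sup>2)
        = (LINT x|lebesgue_on \<Omega>. (?m s x)\<^sup>2) - (LINT x|lebesgue_on \<Omega>. (?m t x)\<^sup>2)"
      by (rule Bochner_Integration.integral_diff[OF i(1) i(2)])
    moreover have "(LINT x|lebesgue_on \<Omega>. (?m s x)\<^sup>2 - (?m t x)\<^sup>2 - ?D x * (2 * ?m t x))
        = (LINT x|lebesgue_on \<Omega>. (?m s x)\<^sup>2 - (?m t x)\<^sup>2) - (LINT x|lebesgue_on \<Omega>. ?D x * (2 * ?m t x))"
      by (rule Bochner_Integration.integral_diff[OF i12 i(3)])
    ultimately show ?thesis unfolding neg_energy_def L2_inner_def by (simp only:)
  qed
  have "\<bar>neg_energy s - neg_energy t - ip ?D (\<lambda>x. 2 * ?m t x)\<bar>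
      \<le> (LINT x|lebesgue_on \<Omega>. \<bar>(?m s x)\<^sup>2 - (?m t x)\<^sup>2 - ?D x * (2 * ?m t x)\<bar>)"
    unfolding eq by (rule integral_abs_bound)
  also have "\<dots> \<le> (LINT x|lebesgue_on \<Omega>. (?D x)\<^sup>2)"
  proof (rule integral_mono)
    show "integrable (lebesgue_on \<Omega>) (\<lambda>x. \<bar>(?m s x)\<^sup>2 - (?m t x)\<^sup>2 - ?D x * (2 * ?m t x)\<bar>)"
      by (rule integrable_abs[OF i123])
    fix x
    have "\<bar>(min b 0)\<^sup>2 - (min a 0)\<^sup>2 - (b - a) * (2 * min a 0)\<bar> \<le> (b - a)\<^sup>2" for a b :: real
    proof (cases "a \<le> 0"; cases "b \<le> 0")
      assume ab: "a \<le> 0" "\<not> b \<le> 0"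
      then have "a * b \<le> 0" by (intro mult_nonpos_nonneg) auto
      then have "\<bar>a\<^sup>2 - 2 * (a * b)\<bar> \<le> a\<^sup>2 - 2 * (a * b)" using zero_le_power2[of a] by linarith
      also have "\<dots> \<le> (b - a)\<^sup>2" by (simp add: power2_eq_square algebra_simps)
      finally have "\<bar>a\<^sup>2 - 2 * (a * b)\<bar> \<le> (b - a)\<^sup>2" .
      moreover have "a\<^sup>2 - 2 * (a * b) = (min b 0)\<^sup>2 - (min a 0)\<^sup>2 - (b - a) * (2 * min a 0)"
        using ab by (simp add: power2_eq_square algebra_simps)
      ultimately show ?thesis by (simp only:)
    next
      assume ab: "\<not> a \<le> 0" "b \<le> 0"
      then have "b\<^sup>2 \<le> (b - a)\<^sup>2" by (intro abs_le_square_iff[THEN iffD1]) auto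
      then show ?thesis using ab by simp
    next
      assume ab: "a \<le> 0" "b \<le> 0"
      then have "(min b 0)\<^sup>2 - (min a 0)\<^sup>2 - (b - a) * (2 * min a 0) = (b - a)\<^sup>2"
        by (simp add: power2_eq_square algebra_simps)
      then show ?thesis by simp
    qed simp
    then show "\<bar>(?m s x)\<^sup>2 - (?m t x)\<^sup>2 - ?D x * (2 * ?m t x)\<bar> \<le> (?D x)\<^sup>2" .
  qed (rule i(4))
  finally show "\<bar>neg_energy s - neg_energy t - ip ?D (\<lambda>x. 2 * ?m t x)\<bar> \<le> (nrm ?D)\<^sup>2"
    unfolding L2_norm_power2 by (simp add: L2_inner_def power2_eq_square)
qed

lemma L2_inner_rep:
  assumes "w \<in> L2 \<Omega>" "v \<in> L2 \<Omega>" "0 \<le> t" "AE x in lebesgue_on \<Omega>. u t x = v x"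
  shows "ip (u t) w = ip v w"
  by (rule L2_inner_cong_AE) (use assms u_L2[of t] in \<open>auto simp: L2_measurable\<close>)

text \<open>
  The positive part \<open>u\<^sup>+\<close> has no larger Lipschitz constant than \<open>u\<close>, so \<open>\<langle>p, u\<^sup>+\<rangle> \<le> J = \<langle>p, u\<rangle>\<close>.
\<close>

lemma p_neg_part:
  assumes t: "0 < t"
  shows "0 \<le> ip (p t) (\<lambda>x. min (u t x) 0)"
proof -
  obtain v where v: "lip0 \<Omega> (J t) v" "AE x in lebesgue_on \<Omega>. u t x = v x"
    using u_rep[OF t] by (auto simp: J_def)
  have U: "u t \<in> L2 \<Omega>" using t by (simp add: u_L2)
  have pos: "lip0 \<Omega> (J t) (\<lambda>x. max (v x) 0)"
    unfolding lip0_def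
  proof (intro conjI allI impI lipschitz_onI)
    fix x y :: 'a
    have "\<bar>max (v x) 0 - max (v y) 0\<bar> \<le> \<bar>v x - v y\<bar>" by (auto simp: max_def)
    then show "dist (max (v x) 0) (max (v y) 0) \<le> J t * dist x y"
      using v(1) lipschitz_onD[of "J t" UNIV v x y] by (simp add: lip0_def dist_real_def)
  qed (use v(1) J_nonneg[OF t] in \<open>auto simp: lip0_def\<close>)
  have "ip (p t) (\<lambda>x. max (v x) 0) = ip (p t) (\<lambda>x. u t x - min (u t x) 0)"
    unfolding L2_inner_commute[of \<Omega> "p t"]
  proof (rule L2_inner_cong_AE)
    show "AE x in lebesgue_on \<Omega>. max (v x) 0 = u t x - min (u t x) 0"
      using v(2) by eventually_elim (auto simp: max_def min_def)
  qed (use lip0_L2[OF \<Omega>(1,2) pos] L2_diff[OF U L2_min_0[OF U]] p_L2[OF t] in \<open>auto simp: L2_measurable\<close>)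
  also have "\<dots> = J t - ip (p t) (\<lambda>x. min (u t x) 0)"
    by (simp add: L2_inner_diff_right[OF U L2_min_0[OF U] p_L2[OF t]] J_def)
  finally show ?thesis using p_le[OF t pos] by simp
qed

lemma u_nonneg:
  assumes t: "0 \<le> t"
  shows "AE x in lebesgue_on \<Omega>. 0 \<le> u t x"
proof -
  have int: "integrable (lebesgue_on \<Omega>) (\<lambda>x. (min (u s x) 0)\<^sup>2)" if "0 \<le> s" for s
    using L2_min_0[OF u_L2[OF that]] by (simp add: L2_def)
  have "neg_energy t \<le> neg_energy 0"
  proof (rule nonincreasing_of_right_derivative[OF t])
    show "continuous_on {0..t} neg_energy"
      by (rule continuous_on_subset[OF quadratic_along_continuous[OF quadratic_along_neg_energy]]) auto
    fix s :: real assume "0 < s"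
    then show "\<exists>D\<le>0. (neg_energy has_real_derivative D) (at_right s)"
      using quadratic_along_right_derivative[OF quadratic_along_neg_energy, of s] p_neg_part[of s]
      by (intro exI[of _ "- ip (p s) (\<lambda>x. 2 * min (u s x) 0)"]) (simp add: L2_inner_scale_right)
  qed
  also have "neg_energy 0 = 0"
    unfolding neg_energy_def
  proof (rule integral_eq_zero_AE)
    show "AE x in lebesgue_on \<Omega>. (min (u 0 x) 0)\<^sup>2 = 0"
      using u0_nonneg by eventually_elim simp
  qed
  finally have "neg_energy t = 0"
    unfolding neg_energy_def by (intro antisym) auto
  then have "AE x in lebesgue_on \<Omega>. (min (u t x) 0)\<^sup>2 = 0"
    using integral_nonneg_eq_0_iff_AE[OF int[OF t]] by (simp add: neg_energy_def)
  then show ?thesis by eventually_elim (simp add: min_def split: if_splits)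
qed

lemma u_nonneg_rep:
  assumes t: "0 < t"
  obtains v where "lip0 \<Omega> (J t) v" "AE x in lebesgue_on \<Omega>. u t x = v x" "\<And>x. 0 \<le> v x" "\<And>x. v x \<le> J t * d x"
proof -
  obtain v where v: "lip0 \<Omega> (J t) v" "AE x in lebesgue_on \<Omega>. u t x = v x"
    using u_rep[OF t] by (auto simp: J_def)
  have lip: "lip0 \<Omega> (J t) (\<lambda>x. \<bar>v x\<bar>)"
    unfolding lip0_def
  proof (intro conjI allI impI lipschitz_onI)
    fix x y :: 'a
    show "dist \<bar>v x\<bar> \<bar>v y\<bar> \<le> J t * dist x y"
      using v(1) lipschitz_onD[of "J t" UNIV v x y] by (simp add: lip0_def dist_real_def)
  qed (use v(1) J_nonneg[OF t] in \<open>auto simp: lip0_def\<close>)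
  show ?thesis
  proof (rule that[OF lip])
    have "AE x in lebesgue_on \<Omega>. 0 \<le> u t x" using t by (intro u_nonneg) simp
    then show "AE x in lebesgue_on \<Omega>. u t x = \<bar>v x\<bar>"
      using v(2) by eventually_elim simp
    show "\<bar>v x\<bar> \<le> J t * d x" for x
      using lip0_le_infdist[OF \<Omega>(1) not_UNIV v(1)] by (simp add: d_def)
  qed simp
qed

text \<open>
  Both inequalities integrate \<open>0 \<le> u \<le> J * d\<close>, against \<open>u\<close> and against \<open>d\<close>.
\<close>

lemma y_le_inner_d:
  assumes t: "0 < t"
  shows "y t \<le> J t * ip (u t) d" "J t * ip (u t) d \<le> (J t)\<^sup>2 * N"
proof -
  obtain v where v: "lip0 \<Omega> (J t) v" "AE x in lebesgue_on \<Omega>. u t x = v x" "\<And>x. 0 \<le> v x" "\<And>x. v x \<le> J t * d x"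
    using u_nonneg_rep[OF t] by blast
  have vL2: "v \<in> L2 \<Omega>" by (rule lip0_L2[OF \<Omega>(1,2) v(1)])
  have t0: "0 \<le> t" using t by simp
  have U: "u t \<in> L2 \<Omega>" by (rule u_L2[OF t0])
  have yv: "y t = ip v v"
    unfolding y_def L2_inner_rep[OF U vL2 t0 v(2)]
    by (subst L2_inner_commute) (rule L2_inner_rep[OF vL2 vL2 t0 v(2)])
  have ud: "ip (u t) d = ip v d"
    by (rule L2_inner_rep[OF d_L2 vL2 t0 v(2)])
  have "ip v v \<le> ip v (\<lambda>x. J t * d x)"
    unfolding L2_inner_def
    by (rule integral_mono; (intro L2_mult_integrable L2_scale vL2 d_L2)?) (use v(3,4) in \<open>auto intro: mult_left_mono\<close>)
  then show "y t \<le> J t * ip (u t) d" by (simp add: yv ud L2_inner_scale_right)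
  have "d x \<ge> 0" for x by (simp add: d_def infdist_nonneg)
  then have "ip v d \<le> ip (\<lambda>x. J t * d x) d"
    unfolding L2_inner_def
    by (intro integral_mono; (intro L2_mult_integrable L2_scale vL2 d_L2)?) (use v(3,4) in \<open>auto intro: mult_right_mono\<close>)
  then have "J t * ip v d \<le> J t * (J t * N)"
    using J_nonneg[OF t] by (intro mult_left_mono) (auto simp: L2_inner_scale_left N_def)
  then show "J t * ip (u t) d \<le> (J t)\<^sup>2 * N" by (simp add: ud power2_eq_square)
qed

lemma p_inner_u_le:
  assumes "0 < s" "0 < t"
  shows "ip (p s) (u t) \<le> J t"
proof -
  obtain v where v: "lip0 \<Omega> (J t) v" "AE x in lebesgue_on \<Omega>. u t x = v x"
    using u_rep[OF assms(2)] by (auto simp: J_def)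
  have "ip (u t) (p s) = ip v (p s)"
    by (rule L2_inner_rep[OF p_L2[OF assms(1)] lip0_L2[OF \<Omega>(1,2) v(1)] _ v(2)]) (use assms in simp)
  then show ?thesis using p_le[OF assms(1) v(1)] by (simp add: L2_inner_commute[of \<Omega> "p s"])
qed

text \<open>
  The right derivative inherits the Lipschitz bound of the flow.
\<close>

lemma p_bounded:
  assumes "0 < \<delta>"
  obtains L where "0 \<le> L" "\<And>s t. \<delta> \<le> s \<Longrightarrow> \<delta> \<le> t \<Longrightarrow> nrm (\<lambda>x. u s x - u t x) \<le> L * \<bar>s - t\<bar>"
    "\<And>t. \<delta> \<le> t \<Longrightarrow> nrm (p t) \<le> L"
proof -
  obtain L where L: "\<And>s t. \<delta> \<le> s \<Longrightarrow> \<delta> \<le> t \<Longrightarrow> nrm (\<lambda>x. u s x - u t x) \<le> L * \<bar>s - t\<bar>"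
    using u_lip[OF assms] by blast
  have "0 \<le> L * \<bar>\<delta> + 1 - \<delta>\<bar>"
    by (rule order_trans[OF L2_norm_nonneg L]) (use assms in auto)
  then have L0: "0 \<le> L" by simp
  show ?thesis
  proof (rule that[OF L0 L])
    fix t assume "\<delta> \<le> t"
    then have t: "0 < t" using assms by simp
    let ?P = "nrm (p t)"
    have "- ip (p t) (p t) \<ge> - (L * ?P)"
    proof (rule tendsto_lowerbound[OF quotient_inner_tendsto[OF t p_L2[OF t]]])
      show "\<forall>\<^sub>F h in at_right 0. - (L * ?P) \<le> ip (\<lambda>x. u (t + h) x - u t x) (p t) / h"
        using eventually_at_right_less[of 0]
      proof eventually_elim
        fix h :: real assume h: "0 < h"
        have "\<bar>ip (\<lambda>x. u (t + h) x - u t x) (p t)\<bar> \<le> nrm (\<lambda>x. u (t + h) x - u t x) * ?P"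
          using t h by (intro L2_Cauchy_Schwarz L2_diff u_L2 p_L2) auto
        also have "\<dots> \<le> (L * h) * ?P"
          using L[of "t + h" t] h \<open>\<delta> \<le> t\<close> by (intro mult_right_mono) (auto simp: L2_norm_nonneg)
        finally have "- (L * ?P) * h \<le> ip (\<lambda>x. u (t + h) x - u t x) (p t)"
          by (simp add: abs_le_iff mult_ac)
        then show "- (L * ?P) \<le> ip (\<lambda>x. u (t + h) x - u t x) (p t) / h"
          using h by (simp add: le_divide_eq)
      qed
    qed simp
    then have "?P * ?P \<le> L * ?P" by (simp add: L2_norm_power2[symmetric] power2_eq_square)
    then show "?P \<le> L" using L2_norm_nonneg[of \<Omega> "p t"] L0 by (cases "?P = 0") auto
  qed auto
qed

lemma J_diff_le:
  assumes "0 < s" "0 < t"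
  shows "J s - J t \<le> nrm (p s) * nrm (\<lambda>x. u s x - u t x)"
proof -
  have U: "u s \<in> L2 \<Omega>" "u t \<in> L2 \<Omega>" using assms by (auto intro: u_L2)
  have "J s - J t \<le> ip (p s) (\<lambda>x. u s x - u t x)"
    using p_inner_u_le[OF assms] by (simp add: L2_inner_diff_right[OF U p_L2[OF assms(1)]] J_def)
  also have "\<dots> \<le> nrm (p s) * nrm (\<lambda>x. u s x - u t x)"
    using L2_Cauchy_Schwarz[OF p_L2[OF assms(1)] L2_diff[OF U]] by linarith
  finally show ?thesis .
qed

lemma J_continuous:
  assumes "0 < \<delta>"
  shows "continuous_on {\<delta>..} J"
proof -
  obtain L where L: "0 \<le> L" "\<And>s t. \<delta> \<le> s \<Longrightarrow> \<delta> \<le> t \<Longrightarrow> nrm (\<lambda>x. u s x - u t x) \<le> L * \<bar>s - t\<bar>"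
    "\<And>t. \<delta> \<le> t \<Longrightarrow> nrm (p t) \<le> L"
    using p_bounded[OF assms] by metis
  have le: "J s - J t \<le> (L * L) * \<bar>s - t\<bar>" if "\<delta> \<le> s" "\<delta> \<le> t" for s t
  proof -
    have "J s - J t \<le> nrm (p s) * nrm (\<lambda>x. u s x - u t x)"
      using that assms by (intro J_diff_le) auto
    also have "\<dots> \<le> L * (L * \<bar>s - t\<bar>)"
      using that L by (intro mult_mono) (auto simp: L2_norm_nonneg)
    finally show ?thesis by (simp add: mult.assoc)
  qed
  have "(L * L)-lipschitz_on {\<delta>..} J"
  proof (rule lipschitz_onI)
    fix s t assume "s \<in> {\<delta>..}" "t \<in> {\<delta>..}"
    then show "dist (J s) (J t) \<le> L * L * dist s t"
      using le[of s t] le[of t s] by (simp add: dist_real_def abs_le_iff abs_minus_commute)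
  qed (use L in simp)
  then show ?thesis by (rule lipschitz_on_continuous_on)
qed

text \<open>
  If \<open>J\<close> rose from \<open>s\<close> to \<open>t\<close>, let \<open>c\<close> be the last time with \<open>J c \<le> J s\<close>.  After \<open>c\<close> the
  subgradient inequality makes the distance from \<open>u c\<close> nonincreasing, so the flow would not move
  at all.
\<close>

lemma J_nonincreasing:
  assumes s: "0 < s" and "s \<le> t"
  shows "J t \<le> J s"
proof (rule ccontr)
  assume neg: "\<not> J t \<le> J s"
  define A where "A = {r \<in> {s..t}. J r \<le> J s}"
  have contJ: "continuous_on {s..t} J"
    using J_continuous[OF s] by (rule continuous_on_subset) auto
  have "closed A"
    unfolding A_def using continuous_on_closed_Collect_le[OF contJ continuous_on_const] by simp
  moreover have "bounded A" unfolding A_def by (rule bounded_subset[of "{s..t}"]) auto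
  moreover have "s \<in> A" using assms by (simp add: A_def)
  ultimately obtain c where c: "c \<in> A" "\<And>r. r \<in> A \<Longrightarrow> r \<le> c"
    using compact_attains_sup[of A] by (auto simp: compact_eq_bounded_closed)
  have c': "s \<le> c" "c \<le> t" "J c \<le> J s" "0 < c" using c(1) s by (auto simp: A_def)
  have above: "J c \<le> J r" if "c < r" "r \<le> t" for r
    using c(2)[of r] that c' by (force simp: A_def)
  have Uc: "u c \<in> L2 \<Omega>" and Ut: "u t \<in> L2 \<Omega>" using c' by (auto intro: u_L2)
  define \<phi> where "\<phi> r = y r - 2 * ip (u r) (u c)" for r
  have "\<phi> t \<le> \<phi> c"
  proof (rule nonincreasing_of_right_derivative[of c t \<phi>])
    show "continuous_on {c..t} \<phi>"
      unfolding \<phi>_def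
      by (intro continuous_intros continuous_on_subset[OF y_continuous]
          continuous_on_subset[OF quadratic_along_continuous[OF quadratic_along_inner[OF Uc]]])
        (use c' in auto)
    fix r assume r: "c < r" "r < t"
    then have r0: "0 < r" using c' by simp
    have "(\<phi> has_real_derivative - 2 * J r - 2 * (- ip (p r) (u c))) (at_right r)"
      unfolding \<phi>_def
      by (intro DERIV_diff DERIV_cmult y_right_derivative r0 quadratic_along_right_derivative[OF quadratic_along_inner[OF Uc] r0])
    moreover have "- 2 * J r - 2 * (- ip (p r) (u c)) \<le> 0"
      using p_inner_u_le[OF r0 c'(4)] above[of r] r by simp
    ultimately show "\<exists>D\<le>0. (\<phi> has_real_derivative D) (at_right r)" by blast
  qed (use c' in simp)
  then have "(nrm (\<lambda>x. u t x - u c x))\<^sup>2 \<le> 0"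
    by (simp add: L2_norm_diff_power2[OF Ut Uc] \<phi>_def y_def)
  then have "nrm (\<lambda>x. u t x - u c x) = 0" by simp
  then have "J t \<le> J c" using J_diff_le[of t c] c' s by simp
  then show False using neg c' by simp
qed

lemma y_0_pos: "0 < y 0"
proof -
  have "nrm (u 0) \<noteq> 0" using u0_nonzero L2_norm_eq_0_iff[OF u_L2[of 0]] by simp
  then show ?thesis using y_nonneg[of 0] by (simp add: L2_norm_u less_le)
qed

text \<open>
  If \<open>d\<close> had norm \<open>0\<close>, then \<open>\<parallel>u\<parallel>\<^sup>2 \<le> J\<^sup>2 * N\<close> would make the flow vanish immediately,
  against continuity at \<open>0\<close>.
\<close>

lemma N_pos: "0 < N"
proof (rule ccontr)
  assume "\<not> 0 < N"
  then have N0: "N = 0" using L2_inner_self_nonneg[of \<Omega> d] by (simp add: N_def)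
  have "y t = 0" if "0 < t" for t
    using y_le_inner_d[OF that] N0 y_nonneg[of t] by simp
  then have "\<forall>\<^sub>F t in at_right 0. y t = 0"
    by (auto simp: eventually_at_filter)
  then have "(y \<longlongrightarrow> 0) (at_right 0)" by (rule tendsto_eventually)
  moreover have "(y \<longlongrightarrow> y 0) (at_right 0)"
    using continuous_on_Icc_at_rightD[of 0 1 y] continuous_on_subset[OF y_continuous, of "{0..1}"] by auto
  ultimately have "y 0 = 0" using tendsto_unique[OF trivial_limit_at_right_real] by blast
  then show False using y_0_pos by simp
qed

lemma sqrt_y_le: "0 < t \<Longrightarrow> sqrt (y t) \<le> J t * sqrt N"
  using real_sqrt_le_mono[of "y t" "(J t)\<^sup>2 * N"] y_le_inner_d[of t] J_nonneg[of t]
  by (simp add: real_sqrt_mult)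

section \<open>Extinction\<close>

text \<open>
  The norm has derivative \<open>- J / \<parallel>u\<parallel>\<close>, which is at most \<open>- 1 / \<parallel>d\<parallel>\<close> since \<open>u \<le> J * d\<close>.
\<close>

lemma norm_decay:
  assumes "0 \<le> a" "a \<le> b" and pos: "\<And>t. a < t \<Longrightarrow> t < b \<Longrightarrow> 0 < y t"
  shows "sqrt (y b) + b / sqrt N \<le> sqrt (y a) + a / sqrt N"
proof (rule nonincreasing_of_right_derivative[OF assms(2), of "\<lambda>t. sqrt (y t) + t / sqrt N"])
  have "continuous_on {a..b} y" by (rule continuous_on_subset[OF y_continuous]) (use assms in auto)
  then show "continuous_on {a..b} (\<lambda>t. sqrt (y t) + t / sqrt N)"
    using N_pos by (intro continuous_intros) auto
  fix t assume t: "a < t" "t < b"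
  then have t0: "0 < t" and yt: "0 < y t" using assms pos by auto
  have "((\<lambda>t. sqrt (y t) + t / sqrt N) has_real_derivative
      inverse (sqrt (y t)) / 2 * (- 2 * J t) + 1 / sqrt N) (at_right t)"
    by (intro DERIV_add DERIV_cdivide DERIV_ident DERIV_chain2[where f=sqrt and g=y and x=t, OF DERIV_real_sqrt[OF yt]] y_right_derivative t0)
  moreover have "inverse (sqrt (y t)) / 2 * (- 2 * J t) + 1 / sqrt N \<le> 0"
    using sqrt_y_le[OF t0] yt N_pos by (simp add: field_simps)
  ultimately show "\<exists>D\<le>0. ((\<lambda>t. sqrt (y t) + t / sqrt N) has_real_derivative D) (at_right t)" by blast
qed

definition T :: real where "T = Inf {t. 0 \<le> t \<and> y t = 0}"

lemma T_attained: "0 < T" "y T = 0" "0 \<le> t \<Longrightarrow> t < T \<Longrightarrow> 0 < y t"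
proof -
  let ?Z = "{t. 0 \<le> t \<and> y t = 0}"
  have "?Z \<noteq> {}"
  proof
    assume "?Z = {}"
    then have pos: "0 < y t" if "0 \<le> t" for t using that y_nonneg[of t] by (auto simp: less_le)
    define b where "b = sqrt N * (sqrt (y 0) + 1)"
    have "0 \<le> b" using N_pos y_nonneg[of 0] by (simp add: b_def)
    then have "sqrt (y b) + b / sqrt N \<le> sqrt (y 0) + 0 / sqrt N"
      by (intro norm_decay) (auto intro: pos)
    moreover have "b / sqrt N = sqrt (y 0) + 1" using N_pos by (simp add: b_def)
    ultimately show False using y_nonneg[of b] real_sqrt_ge_zero[of "y b"] by linarith
  qed
  moreover have "closed ?Z"
  proof -
    have "closed {t \<in> {0..}. y t \<le> 0}"
      by (rule continuous_on_closed_Collect_le[OF y_continuous continuous_on_const]) simp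
    moreover have "{t \<in> {0..}. y t \<le> 0} = ?Z" using y_nonneg by (auto intro: antisym)
    ultimately show ?thesis by simp
  qed
  moreover have bdd: "bdd_below ?Z" by (rule bdd_belowI[of _ 0]) auto
  ultimately have "T \<in> ?Z" unfolding T_def by (intro closed_contains_Inf)
  then show T: "y T = 0" and "0 < T" using y_0_pos by (auto simp: less_le)
  show "0 < y t" if "0 \<le> t" "t < T"
  proof -
    have "t \<notin> ?Z" using that cInf_lower[OF _ bdd, of t] by (auto simp: T_def)
    then show ?thesis using that y_nonneg[of t] by (auto simp: less_le)
  qed
qed

text \<open>
  The function \<open>u t\<close> is the integral of \<open>p\<close> over the time remaining until extinction, and each \<open>p s\<close>
  satisfies \<open>\<langle>p s, z\<rangle> \<le> M\<close>.
\<close>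

lemma inner_le_remaining_time:
  assumes z: "lip0 \<Omega> M z" and t: "0 < t" "t \<le> T"
  shows "ip (u t) z \<le> M * (T - t)"
proof -
  have zL2: "z \<in> L2 \<Omega>" by (rule lip0_L2[OF \<Omega>(1,2) z])
  have "\<bar>ip (u T) z\<bar> \<le> nrm (u T) * nrm z"
    using T_attained by (intro L2_Cauchy_Schwarz u_L2 zL2) simp
  then have uT: "ip (u T) z = 0" by (simp add: L2_norm_u T_attained)
  have "- ip (u T) z - M * T \<le> - ip (u t) z - M * t"
  proof (rule nonincreasing_of_right_derivative[OF t(2), of "\<lambda>s. - ip (u s) z - M * s"])
    show "continuous_on {t..T} (\<lambda>s. - ip (u s) z - M * s)"
      by (intro continuous_intros continuous_on_subset[OF quadratic_along_continuous[OF quadratic_along_inner[OF zL2]]])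
        (use t in auto)
    fix s assume "t < s"
    then have s: "0 < s" using t by simp
    have "((\<lambda>s. - ip (u s) z - M * s) has_real_derivative - (- ip (p s) z) - M * 1) (at_right s)"
      by (intro DERIV_diff DERIV_minus DERIV_cmult DERIV_ident quadratic_along_right_derivative[OF quadratic_along_inner[OF zL2] s])
    then show "\<exists>D\<le>0. ((\<lambda>s. - ip (u s) z - M * s) has_real_derivative D) (at_right s)"
      using p_le[OF s z] by (intro exI[of _ "- (- ip (p s) z) - M * 1"]) simp
  qed
  then show ?thesis using uT by (simp add: algebra_simps)
qed

lemma inner_d_le: "0 < t \<Longrightarrow> t \<le> T \<Longrightarrow> ip (u t) d \<le> T - t"
  using inner_le_remaining_time[OF lip0_d] by simp

lemma y_le_J:
  assumes "0 < t" "t \<le> T"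
  shows "y t \<le> J t * (T - t)"
  using y_le_inner_d(1)[OF assms(1)] mult_left_mono[OF inner_d_le[OF assms] J_nonneg[OF assms(1)]] by linarith

lemma y_lower:
  assumes "0 \<le> t" "t \<le> T"
  shows "(T - t)\<^sup>2 \<le> N * y t"
proof -
  have "sqrt (y T) + T / sqrt N \<le> sqrt (y t) + t / sqrt N"
    by (rule norm_decay) (use assms in \<open>auto intro: T_attained(3)\<close>)
  then have "(T - t) / sqrt N \<le> sqrt (y t)" by (simp add: T_attained diff_divide_distrib)
  then have "T - t \<le> sqrt N * sqrt (y t)" using N_pos by (simp add: divide_le_eq mult.commute)
  then have "(T - t)\<^sup>2 \<le> (sqrt N * sqrt (y t))\<^sup>2" using assms by (intro power_mono) auto
  then show ?thesis using N_pos y_nonneg[of t] by (simp add: power_mult_distrib)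
qed

section \<open>The asymptotic profile\<close>

definition Q :: "real \<Rightarrow> real" where "Q t = y t / (T - t)\<^sup>2"

lemma Q_right_derivative:
  assumes "0 < t" "t < T"
  shows "(Q has_real_derivative 2 * (y t - J t * (T - t)) / (T - t) ^ 3) (at_right t)"
proof -
  have "((\<lambda>s. y s / (T - s)\<^sup>2) has_real_derivative
      (- 2 * J t * (T - t)\<^sup>2 - y t * (2 * (T - t) * - 1)) / ((T - t)\<^sup>2 * (T - t)\<^sup>2)) (at_right t)"
    by (rule DERIV_divide[OF y_right_derivative]) (use assms in \<open>auto intro!: derivative_eq_intros\<close>)
  moreover have "(- 2 * J t * (T - t)\<^sup>2 - y t * (2 * (T - t) * - 1)) / ((T - t)\<^sup>2 * (T - t)\<^sup>2)
      = 2 * (y t - J t * (T - t)) / (T - t) ^ 3"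
  proof -
    define r where "r = T - t"
    have "r > 0" using assms by (simp add: r_def)
    then have "(- 2 * J t * r\<^sup>2 - y t * (2 * r * - 1)) / (r\<^sup>2 * r\<^sup>2) = 2 * (y t - J t * r) / r ^ 3"
      by (simp add: field_simps power2_eq_square power3_eq_cube)
    then show ?thesis by (simp add: r_def)
  qed
  ultimately show ?thesis unfolding Q_def[abs_def] by simp
qed

lemma Q_continuous:
  assumes "0 \<le> s" "t < T"
  shows "continuous_on {s..t} Q"
  unfolding Q_def
  by (intro continuous_intros continuous_on_subset[OF y_continuous]) (use assms in auto)

lemma Q_nonincreasing:
  assumes "0 < s" "s \<le> t" "t < T"
  shows "Q t \<le> Q s"
proof (rule nonincreasing_of_right_derivative[OF assms(2) Q_continuous])
  fix r assume "s < r" "r < t"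
  then have r: "0 < r" "r < T" using assms by auto
  have "2 * (y r - J r * (T - r)) / (T - r) ^ 3 \<le> 0"
    using y_le_J[of r] r by (intro divide_nonpos_pos) auto
  then show "\<exists>D\<le>0. (Q has_real_derivative D) (at_right r)" using Q_right_derivative[OF r] by blast
qed (use assms in auto)

text \<open>
  Otherwise the derivative of \<open>Q\<close> would be at most \<open>- c / (T - t)\<close> for some \<open>c > 0\<close>, and \<open>Q\<close> would
  tend to \<open>- \<infinity>\<close> logarithmically.
\<close>

lemma nearly_eigen_time:
  assumes "0 < t0" "t0 < T" "0 < \<epsilon>"
  shows "\<exists>t>t0. t < T \<and> J t * (T - t) \<le> (1 + \<epsilon>) * y t"
proof (rule ccontr)
  assume "\<not> ?thesis"
  then have big: "(1 + \<epsilon>) * y t < J t * (T - t)" if "t0 < t" "t < T" for t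
    using that by force
  define c where "c = 2 * \<epsilon> / N"
  have c: "c > 0" using assms N_pos by (simp add: c_def)
  have le: "- c * ln (T - t) \<le> Q t0 - c * ln (T - t0)" if t: "t0 < t" "t < T" for t
  proof -
    have "Q t - c * ln (T - t) \<le> Q t0 - c * ln (T - t0)"
    proof (rule nonincreasing_of_right_derivative[of t0 t "\<lambda>t. Q t - c * ln (T - t)"])
      show "continuous_on {t0..t} (\<lambda>t. Q t - c * ln (T - t))"
        by (intro continuous_intros Q_continuous) (use assms t in auto)
      fix r assume r: "t0 < r" "r < t"
      then have r0: "0 < r" "r < T" using assms t by auto
      define e where "e = T - r"
      have e: "e > 0" using r0 by (simp add: e_def)
      have "((\<lambda>t. Q t - c * ln (T - t)) has_real_derivative
          2 * (y r - J r * (T - r)) / (T - r) ^ 3 - c * (inverse (T - r) * - 1)) (at_right r)"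
        by (intro DERIV_diff Q_right_derivative r0 DERIV_cmult
            DERIV_chain2[where f=ln and g="\<lambda>t. T - t" and x=r, OF DERIV_ln])
          (use r0 in \<open>auto intro!: derivative_eq_intros\<close>)
      moreover have "2 * (y r - J r * (T - r)) / (T - r) ^ 3 - c * (inverse (T - r) * - 1) \<le> 0"
      proof -
        have "y r - J r * e \<le> - (\<epsilon> * y r)"
          using big[of r] r r0 by (simp add: algebra_simps e_def)
        also have "\<dots> \<le> - (\<epsilon> * (e\<^sup>2 / N))"
          using y_lower[of r] r0 N_pos assms(3) by (simp add: divide_le_eq e_def mult.commute)
        finally have "2 * (y r - J r * e) \<le> - (c * e\<^sup>2)" by (simp add: c_def)
        then have "2 * (y r - J r * e) / e ^ 3 \<le> - (c * e\<^sup>2) / e ^ 3"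
          using e by (intro divide_right_mono) auto
        also have "- (c * e\<^sup>2) / e ^ 3 = - (c * inverse e)"
          using e by (simp add: field_simps power2_eq_square power3_eq_cube)
        finally show ?thesis by (simp add: e_def)
      qed
      ultimately show "\<exists>D\<le>0. ((\<lambda>t. Q t - c * ln (T - t)) has_real_derivative D) (at_right r)" by blast
    qed (use t in simp)
    moreover have "0 \<le> Q t" by (simp add: Q_def y_nonneg)
    ultimately show ?thesis by simp
  qed
  \<comment> \<open>A time \<open>T - r\<close> so late that \<open>- ln r\<close> exceeds the bound just found.\<close>
  define X where "X = (Q t0 - c * ln (T - t0)) / c"
  define r where "r = min ((T - t0) / 2) (exp (- X - 1))"
  have r: "0 < r" "r < T - t0" using assms by (auto simp: r_def min_less_iff_disj)
  have "- c * ln r \<le> c * X" using le[of "T - r"] r c by (simp add: X_def)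
  then have "c * - ln r \<le> c * X" by simp
  then have "- ln r \<le> X" using c by (simp only: mult_le_cancel_left_pos)
  moreover have "ln r \<le> ln (exp (- X - 1))"
    using r by (intro ln_mono) (auto simp: r_def)
  ultimately show False by simp
qed

text \<open>
  At nearly extremal times \<open>Q\<close> is close to \<open>1 / N\<close> by concentration, and monotonicity extends
  this to all later times.
\<close>

lemma Q_limit:
  assumes "0 < \<epsilon>"
  shows "\<exists>t0. 0 < t0 \<and> t0 < T \<and> (\<forall>t. t0 < t \<longrightarrow> t < T \<longrightarrow> N * Q t \<le> 1 + \<epsilon>)"
proof -
  have T: "0 < T / 2" "T / 2 < T" using T_attained(1) by auto
  have "\<exists>t. T / 2 < t \<and> t < T \<and> J t * (T - t) \<le> (1 + inverse (real (Suc k))) * y t" for k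
    using nearly_eigen_time[OF T, of "inverse (real (Suc k))"] by auto
  then obtain \<tau> where \<tau>: "\<And>k. T / 2 < \<tau> k" "\<And>k. \<tau> k < T"
    "\<And>k. J (\<tau> k) * (T - \<tau> k) \<le> (1 + inverse (real (Suc k))) * y (\<tau> k)" by metis
  have \<tau>0: "0 < \<tau> k" for k using \<tau>(1)[of k] T by simp
  have ypos: "0 < y (\<tau> k)" for k using T_attained(3) \<tau>0[of k] \<tau>(2)[of k] by simp
  have "\<exists>v. lip0 \<Omega> (J (\<tau> k)) v \<and> (AE x in lebesgue_on \<Omega>. u (\<tau> k) x = v x) \<and> (\<forall>x. 0 \<le> v x)" for k
    using u_nonneg_rep[OF \<tau>0[of k]] by metis
  then obtain v where v: "\<And>k. lip0 \<Omega> (J (\<tau> k)) (v k)" "\<And>k. AE x in lebesgue_on \<Omega>. u (\<tau> k) x = v k x"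
    "\<And>k x. 0 \<le> v k x" by metis
  have vL2: "v k \<in> L2 \<Omega>" for k by (rule lip0_L2[OF \<Omega>(1,2) v(1)])
  have rep: "ip (u (\<tau> k)) z = ip (v k) z" if "z \<in> L2 \<Omega>" for k z
    by (rule L2_inner_rep[OF that vL2 _ v(2)]) (use \<tau>0[of k] in simp)
  define S where "S k = sqrt (y (\<tau> k))" for k
  have S: "0 < S k" "S k * S k = y (\<tau> k)" for k using ypos[of k] by (auto simp: S_def)
  define w where "w k x = v k x / S k" for k x
  define \<Lambda> where "\<Lambda> k = J (\<tau> k) / S k" for k
  have wlip: "lip0 \<Omega> (\<Lambda> k) (w k)" for k
    unfolding lip0_def
  proof (intro conjI allI impI lipschitz_onI)
    fix a b :: 'a
    have "\<bar>v k a - v k b\<bar> \<le> J (\<tau> k) * dist a b"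
      using v(1)[of k] lipschitz_onD[of "J (\<tau> k)" UNIV "v k" a b] by (simp add: lip0_def dist_real_def)
    moreover have "dist (w k a) (w k b) = \<bar>v k a - v k b\<bar> / S k"
      using S(1)[of k] by (simp add: w_def dist_real_def diff_divide_distrib[symmetric])
    ultimately show "dist (w k a) (w k b) \<le> \<Lambda> k * dist a b"
      using divide_right_mono[of "\<bar>v k a - v k b\<bar>" "J (\<tau> k) * dist a b" "S k"] S(1)[of k] by (simp add: \<Lambda>_def)
  qed (use v(1)[of k] J_nonneg[OF \<tau>0[of k]] S(1)[of k] in \<open>auto simp: lip0_def w_def \<Lambda>_def\<close>)
  have w1: "ip (w k) (w k) = 1" for k
  proof -
    have "ip (v k) (v k) = ip (v k) (u (\<tau> k))"
      by (subst (2) L2_inner_commute) (rule rep[OF vL2, symmetric])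
    also have "\<dots> = y (\<tau> k)"
      unfolding y_def by (rule rep[symmetric]) (use \<tau>0[of k] in \<open>simp add: u_L2\<close>)
    finally have vv: "ip (v k) (v k) = S k * S k" by (simp add: S(2))
    have "ip (w k) (w k) = ip (v k) (v k) / S k / S k"
      unfolding w_def by (simp add: L2_inner_divide_left L2_inner_commute[of _ _ "\<lambda>x. v k x / S k"])
    then show ?thesis using S(1)[of k] vv by simp
  qed
  have wd: "\<Lambda> k * ip (w k) d = J (\<tau> k) * ip (u (\<tau> k)) d / y (\<tau> k)" for k
    unfolding w_def \<Lambda>_def by (simp add: L2_inner_divide_left rep[OF d_L2] S(2))
  have lower: "1 \<le> \<Lambda> k * ip (w k) d" for k
    unfolding wd using y_le_inner_d(1)[OF \<tau>0[of k]] ypos[of k] by (simp add: le_divide_eq)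
  have upper: "\<Lambda> k * ip (w k) d \<le> 1 + inverse (real (Suc k))" for k
  proof -
    have "J (\<tau> k) * ip (u (\<tau> k)) d \<le> J (\<tau> k) * (T - \<tau> k)"
      using inner_d_le[of "\<tau> k"] \<tau>0[of k] \<tau>(2)[of k] J_nonneg[OF \<tau>0[of k]] by (intro mult_left_mono) auto
    also note \<tau>(3)[of k]
    finally show ?thesis unfolding wd using ypos[of k] by (simp add: divide_le_eq)
  qed
  have lim: "(\<lambda>k. \<Lambda> k * ip (w k) d) \<longlonglongrightarrow> 1"
  proof (rule tendsto_sandwich[where f="\<lambda>_. 1" and h="\<lambda>k. 1 + inverse (real (Suc k))"])
    show "(\<lambda>k. 1 + inverse (real (Suc k))) \<longlonglongrightarrow> 1"
      using tendsto_add[OF tendsto_const[of "1::real"] LIMSEQ_inverse_real_of_nat] by simp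
  qed (use lower upper in auto)
  have bound: "\<Lambda> k \<le> 2 * sqrt (Q (T / 2))" for k
  proof -
    have r: "0 < T - \<tau> k" using \<tau>(2)[of k] by simp
    have "inverse (real (Suc k)) \<le> 1" by (simp add: inverse_le_1_iff)
    then have "(1 + inverse (real (Suc k))) * y (\<tau> k) \<le> 2 * y (\<tau> k)"
      using ypos[of k] by (intro mult_right_mono) auto
    then have "J (\<tau> k) * (T - \<tau> k) \<le> 2 * (S k * S k)" using \<tau>(3)[of k] by (simp add: S(2))
    then have "\<Lambda> k \<le> 2 * (S k / (T - \<tau> k))"
      using r S(1)[of k] by (simp add: \<Lambda>_def field_simps)
    also have "S k / (T - \<tau> k) = sqrt (Q (\<tau> k))"
      using r by (simp add: Q_def S_def real_sqrt_divide)
    also have "sqrt (Q (\<tau> k)) \<le> sqrt (Q (T / 2))"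
      using \<tau>(1,2)[of k] T by (intro real_sqrt_le_mono Q_nonincreasing) auto
    finally show ?thesis by simp
  qed
  have "(\<lambda>k. (\<Lambda> k)\<^sup>2 * ip d d) \<longlonglongrightarrow> 1"
    by (rule concentration_on_distance_function[OF d_def \<Omega> wlip _ w1 bound lim])
      (use v(3) S(1) in \<open>simp add: w_def less_imp_le\<close>)
  then have "\<forall>\<^sub>F k in sequentially. (\<Lambda> k)\<^sup>2 * N < 1 + \<epsilon>"
    using assms by (intro order_tendstoD(2)) (auto simp: N_def)
  then obtain k where k: "(\<Lambda> k)\<^sup>2 * N < 1 + \<epsilon>" by (auto simp: eventually_sequentially)
  have "N * Q (\<tau> k) \<le> 1 + \<epsilon>"
  proof -
    have r: "0 < T - \<tau> k" using \<tau>(2)[of k] by simp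
    have "S k * S k \<le> J (\<tau> k) * (T - \<tau> k)"
      using y_le_J[of "\<tau> k"] \<tau>0[of k] \<tau>(2)[of k] by (simp add: S(2))
    then have "S k / (T - \<tau> k) \<le> \<Lambda> k"
      using r S(1)[of k] by (simp add: \<Lambda>_def field_simps)
    then have "(S k / (T - \<tau> k))\<^sup>2 \<le> (\<Lambda> k)\<^sup>2"
      using r S(1)[of k] by (intro power_mono) auto
    then have "Q (\<tau> k) \<le> (\<Lambda> k)\<^sup>2"
      by (simp add: Q_def power_divide power2_eq_square[of "S k"] S(2))
    then have "N * Q (\<tau> k) \<le> N * (\<Lambda> k)\<^sup>2" using N_pos by (intro mult_left_mono) auto
    then show ?thesis using k by (simp add: mult.commute)
  qed
  moreover have "N * Q t \<le> N * Q (\<tau> k)" if "\<tau> k < t" "t < T" for t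
    using N_pos that \<tau>0[of k] by (intro mult_left_mono Q_nonincreasing) auto
  ultimately show ?thesis
    using \<tau>0[of k] \<tau>(2)[of k] by (intro exI[of _ "\<tau> k"]) force
qed

lemma y_drop:
  assumes "0 < s" "s \<le> t"
  shows "y t + 2 * J t * (t - s) \<le> y s"
proof -
  have "y t + 2 * J t * t \<le> y s + 2 * J t * s"
  proof (rule nonincreasing_of_right_derivative[OF assms(2), of "\<lambda>r. y r + 2 * J t * r"])
    show "continuous_on {s..t} (\<lambda>r. y r + 2 * J t * r)"
      by (intro continuous_intros continuous_on_subset[OF y_continuous]) (use assms in auto)
    fix r assume r: "s < r" "r < t"
    then have r0: "0 < r" using assms by simp
    have "((\<lambda>r. y r + 2 * J t * r) has_real_derivative - 2 * J r + 2 * J t * 1) (at_right r)"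
      by (intro DERIV_add DERIV_cmult DERIV_ident y_right_derivative r0)
    then show "\<exists>D\<le>0. ((\<lambda>r. y r + 2 * J t * r) has_real_derivative D) (at_right r)"
      using J_nonincreasing[OF r0, of t] r by (intro exI[of _ "- 2 * J r + 2 * J t * 1"]) simp
  qed
  then show ?thesis by (simp add: algebra_simps)
qed

text \<open>
  As \<open>J\<close> is nonincreasing, \<open>2 * J t * (t - s) \<le> y s - y t\<close> for \<open>s < t\<close>.  The choice
  \<open>t - s = \<theta> * (T - t)\<close> turns the quadratic asymptotics of \<open>y\<close> into a bound for \<open>J t\<close> with a
  relative error of order \<open>\<theta>\<close>.
\<close>

lemma J_limit:
  assumes "0 < \<epsilon>"
  shows "\<exists>t0. 0 < t0 \<and> t0 < T \<and> (\<forall>t. t0 < t \<longrightarrow> t < T \<longrightarrow> N * J t \<le> (1 + \<epsilon>) * (T - t))"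
proof -
  define \<theta> where "\<theta> = min 1 (\<epsilon> / 3)"
  have \<theta>: "0 < \<theta>" "\<theta> \<le> 1" "3 * \<theta> \<le> \<epsilon>" using assms by (auto simp: \<theta>_def)
  obtain q where q: "0 < q" "q < T" "\<And>t. q < t \<Longrightarrow> t < T \<Longrightarrow> N * Q t \<le> 1 + \<theta>\<^sup>2"
    using Q_limit[of "\<theta>\<^sup>2"] \<theta> by auto
  have "N * J t \<le> (1 + \<epsilon>) * (T - t)" if t: "(q + T) / 2 < t" "t < T" for t
  proof -
    define r where "r = T - t"
    have r: "0 < r" "2 * r < T - q" using t by (auto simp: r_def)
    define s where "s = t - \<theta> * r"
    have "\<theta> * r \<le> r" using \<theta> r by (simp add: mult_left_le_one_le)
    moreover have "0 < \<theta> * r" and Tr: "T = t + r" using \<theta> r by (auto simp: r_def)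
    ultimately have s: "q < s" "s \<le> t" "s < T"
      using r unfolding s_def by linarith+
    have Ts: "T - s = (1 + \<theta>) * r" by (simp add: s_def r_def algebra_simps)
    have "N * y s = N * Q s * ((1 + \<theta>) * r)\<^sup>2"
      unfolding Ts[symmetric] using s(3) by (simp add: Q_def)
    also have "\<dots> \<le> (1 + \<theta>\<^sup>2) * ((1 + \<theta>) * r)\<^sup>2"
      using q(3)[OF s(1,3)] by (intro mult_right_mono) auto
    finally have up: "N * y s \<le> ((1 + \<theta>\<^sup>2) * (1 + \<theta>)\<^sup>2) * r\<^sup>2" by (simp add: power_mult_distrib mult.assoc)
    have low: "r\<^sup>2 \<le> N * y t" using y_lower[of t] t q by (simp add: r_def)
    have "N * (y t + 2 * J t * (\<theta> * r)) \<le> N * y s"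
      using y_drop[of s t] s q N_pos by (intro mult_left_mono) (auto simp: s_def)
    then have "r\<^sup>2 + N * (2 * J t * (\<theta> * r)) \<le> ((1 + \<theta>\<^sup>2) * (1 + \<theta>)\<^sup>2) * r\<^sup>2"
      using up low by (simp add: distrib_left)
    also have "\<dots> \<le> (1 + 2 * \<theta> * (1 + 3 * \<theta>)) * r\<^sup>2"
    proof (rule mult_right_mono)
      have "\<theta> ^ 3 \<le> \<theta>\<^sup>2" "\<theta> ^ 4 \<le> \<theta>\<^sup>2" using \<theta> by (auto intro: power_decreasing)
      moreover have "(1 + \<theta>\<^sup>2) * (1 + \<theta>)\<^sup>2 = 1 + 2 * \<theta> + 2 * \<theta>\<^sup>2 + 2 * \<theta> ^ 3 + \<theta> ^ 4"
        by (simp add: power2_eq_square power3_eq_cube power4_eq_xxxx algebra_simps)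
      moreover have "1 + 2 * \<theta> * (1 + 3 * \<theta>) = 1 + 2 * \<theta> + 6 * \<theta>\<^sup>2"
        by (simp add: power2_eq_square algebra_simps)
      ultimately show "(1 + \<theta>\<^sup>2) * (1 + \<theta>)\<^sup>2 \<le> 1 + 2 * \<theta> * (1 + 3 * \<theta>)"
        using zero_le_power2[of \<theta>] by linarith
    qed simp
    finally have "(2 * \<theta> * r) * (N * J t) \<le> (2 * \<theta> * r) * ((1 + 3 * \<theta>) * r)"
      by (simp add: power2_eq_square algebra_simps)
    moreover have "0 < 2 * \<theta> * r" using \<theta> r by simp
    ultimately have "N * J t \<le> (1 + 3 * \<theta>) * r" by (simp only: mult_le_cancel_left_pos)
    also have "\<dots> \<le> (1 + \<epsilon>) * r" using \<theta> r by (intro mult_right_mono) auto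
    finally show ?thesis by (simp add: r_def)
  qed
  moreover have "0 < (q + T) / 2" "(q + T) / 2 < T" using q by auto
  ultimately show ?thesis by blast
qed

text \<open>
  The squared distance of two unit vectors is \<open>2\<close> minus twice their inner product, which here is
  at least \<open>\<parallel>u\<parallel> / (J * \<parallel>d\<parallel>)\<close> because \<open>\<parallel>u\<parallel>\<^sup>2 \<le> J * \<langle>u, d\<rangle>\<close>.
\<close>

lemma profile_distance:
  assumes t: "0 < t" "t < T" and \<epsilon>: "0 < \<epsilon>" "N * J t \<le> (1 + \<epsilon>) * (T - t)"
  shows "(nrm (\<lambda>x. u t x / nrm (u t) - 1 / sqrt N * d x))\<^sup>2 \<le> 2 * \<epsilon>"
proof -
  define S where "S = sqrt (y t)"
  have y: "0 < y t" using t T_attained(3) by simp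
  then have S: "0 < S" "S * S = y t" by (auto simp: S_def)
  have U: "(\<lambda>x. u t x / S) \<in> L2 \<Omega>" using t by (intro L2_divide u_L2) simp
  have D: "(\<lambda>x. 1 / sqrt N * d x) \<in> L2 \<Omega>" by (intro L2_scale d_L2)
  have Jpos: "0 < J t"
    using y_le_J[of t] t y J_nonneg[of t] by (cases "J t = 0") auto
  have uu: "ip (\<lambda>x. u t x / S) (\<lambda>x. u t x / S) = 1"
  proof -
    have "ip (\<lambda>x. u t x / S) (\<lambda>x. u t x / S) = y t / S / S"
      by (simp add: L2_inner_divide_left L2_inner_commute[of _ _ "\<lambda>x. u t x / S"] y_def)
    then show ?thesis unfolding S(2)[symmetric] using S(1) by simp
  qed
  have dd: "ip (\<lambda>x. 1 / sqrt N * d x) (\<lambda>x. 1 / sqrt N * d x) = 1"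
  proof -
    have "1 / sqrt N * (1 / sqrt N * N) = N / (sqrt N * sqrt N)" by simp
    also have "\<dots> = 1" using N_pos by (simp only: real_sqrt_mult_self) simp
    finally show ?thesis unfolding L2_inner_scale_left L2_inner_scale_right N_def[symmetric] .
  qed
  have ud: "1 / (1 + \<epsilon>) \<le> ip (\<lambda>x. u t x / S) (\<lambda>x. 1 / sqrt N * d x)"
  proof -
    have "T - t \<le> sqrt N * S"
    proof -
      have "(T - t)\<^sup>2 \<le> (sqrt N * S)\<^sup>2"
        using y_lower[of t] t N_pos y by (simp add: power_mult_distrib S_def)
      then show ?thesis by (rule power2_le_imp_le) (use N_pos S in simp)
    qed
    then have "N * J t \<le> (1 + \<epsilon>) * (sqrt N * S)"
      using \<epsilon> by (meson add_pos_pos less_imp_le mult_left_mono order_trans zero_less_one)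
    moreover have "sqrt N * (sqrt N * J t) = N * J t"
      using N_pos by (simp only: mult.assoc[symmetric] real_sqrt_mult_self abs_of_pos)
    ultimately have "sqrt N * (sqrt N * J t) \<le> sqrt N * ((1 + \<epsilon>) * S)"
      by (simp only: mult.left_commute)
    then have "sqrt N * J t \<le> (1 + \<epsilon>) * S" using N_pos by simp
    moreover have "0 < sqrt N * J t" "0 < 1 + \<epsilon>" using N_pos Jpos \<epsilon> by auto
    ultimately have "1 / (1 + \<epsilon>) \<le> S / (sqrt N * J t)"
      by (simp only: pos_divide_le_eq pos_le_divide_eq times_divide_eq_left mult_1 mult.commute)
    also have "\<dots> = (S * S / J t) / (sqrt N * S)" using S(1) N_pos Jpos by (simp add: field_simps)
    also have "\<dots> \<le> ip (u t) d / (sqrt N * S)"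
      unfolding S(2) using y_le_inner_d(1)[OF t(1)] Jpos S(1) N_pos
      by (intro divide_right_mono) (auto simp: divide_le_eq mult.commute)
    also have "\<dots> = ip (\<lambda>x. u t x / S) (\<lambda>x. 1 / sqrt N * d x)"
      unfolding L2_inner_scale_right L2_inner_divide_left by simp
    finally show ?thesis .
  qed
  have "(nrm (\<lambda>x. u t x / S - 1 / sqrt N * d x))\<^sup>2 \<le> 2 - 2 * (1 / (1 + \<epsilon>))"
    using ud unfolding L2_norm_diff_power2[OF U D] uu dd by simp
  also have "\<dots> \<le> 2 * \<epsilon>" using \<epsilon> by (simp add: field_simps)
  finally show ?thesis by (simp add: L2_norm_u S_def)
qed

lemma profile_limit:
  "((\<lambda>t. nrm (\<lambda>x. u t x / nrm (u t) - 1 / sqrt N * d x)) \<longlongrightarrow> 0) (at_left T)"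
proof (rule order_tendstoI)
  fix a :: real assume "a < 0"
  then show "\<forall>\<^sub>F t in at_left T. a < nrm (\<lambda>x. u t x / nrm (u t) - 1 / sqrt N * d x)"
    by (intro always_eventually allI less_le_trans[OF _ L2_norm_nonneg])
next
  fix a :: real assume a: "0 < a"
  define \<epsilon> where "\<epsilon> = a\<^sup>2 / 4"
  have \<epsilon>: "0 < \<epsilon>" using a by (simp add: \<epsilon>_def)
  obtain t0 where t0: "0 < t0" "t0 < T" "\<And>t. t0 < t \<Longrightarrow> t < T \<Longrightarrow> N * J t \<le> (1 + \<epsilon>) * (T - t)"
    using J_limit[OF \<epsilon>] by blast
  have "nrm (\<lambda>x. u t x / nrm (u t) - 1 / sqrt N * d x) < a" if "t0 < t" "t < T" for t
  proof (rule power_less_imp_less_base)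
    have "(nrm (\<lambda>x. u t x / nrm (u t) - 1 / sqrt N * d x))\<^sup>2 \<le> 2 * \<epsilon>"
      using that t0(1) by (intro profile_distance \<epsilon> t0(3)) auto
    also have "\<dots> < a\<^sup>2" using a by (simp add: \<epsilon>_def)
    finally show "(nrm (\<lambda>x. u t x / nrm (u t) - 1 / sqrt N * d x))\<^sup>2 < a\<^sup>2" .
  qed (use a in simp)
  then show "\<forall>\<^sub>F t in at_left T. nrm (\<lambda>x. u t x / nrm (u t) - 1 / sqrt N * d x) < a"
    using t0(2) by (auto simp: eventually_at_left)
qed

end

section \<open>Convergence to the distance function\<close>

text \<open>
  A segment from \<open>x\<close> to a point of the complement meets the frontier.
\<close>

lemma infdist_frontier_eq:
  assumes "open \<Omega>" "x \<in> (\<Omega> :: 'a::euclidean_space set)" "\<Omega> \<noteq> UNIV"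
  shows "infdist x (frontier \<Omega>) = infdist x (- \<Omega>)"
proof (rule antisym)
  obtain z where z: "z \<in> - \<Omega>" "infdist x (- \<Omega>) = dist x z"
    using infdist_attains_inf[of "- \<Omega>" x] assms by (auto simp: closed_Compl)
  have "closed_segment x z \<inter> frontier \<Omega> \<noteq> {}"
    by (rule connected_Int_frontier) (use assms z in auto)
  then obtain b where b: "b \<in> closed_segment x z" "b \<in> frontier \<Omega>" by blast
  have "infdist x (frontier \<Omega>) \<le> dist x b" by (rule infdist_le[OF b(2)])
  also have "\<dots> \<le> dist x z" using dist_in_closed_segment[OF b(1)] by (simp add: dist_commute)
  finally show "infdist x (frontier \<Omega>) \<le> infdist x (- \<Omega>)" by (simp add: z)
  have "frontier \<Omega> \<subseteq> - \<Omega>" using assms(1) by (auto simp: frontier_def interior_open)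
  then show "infdist x (- \<Omega>) \<le> infdist x (frontier \<Omega>)"
    using b(2) by (intro infdist_mono) auto
qed

theorem theorem2p82:
  fixes \<Omega> :: "(real ^ 'n) set"
    and f u_inf :: "real ^ 'n \<Rightarrow> real"
    and u :: "real \<Rightarrow> real ^ 'n \<Rightarrow> real"
  assumes "open \<Omega>" and "connected \<Omega>" and "bounded \<Omega>"
    and "piecewise_smooth_boundary \<Omega>"
    and "f \<in> L2_closure \<Omega> (eff_dom \<Omega> (grad_sup_functional \<Omega>))"
    and "\<not> (AE x in lebesgue_on \<Omega>. f x = 0)"
    and "AE x in lebesgue_on \<Omega>. 0 \<le> f x"
    and "is_gradient_flow \<Omega> (grad_sup_functional \<Omega>) f u"
    and "L2_tendsto \<Omega> u u_inf at_top"
    and "AE x in lebesgue_on \<Omega>. u_inf x = 0"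
  shows "\<exists>T::real. extinction_time \<Omega> u u_inf = ereal T \<and>
           (\<exists>c::real. L2_tendsto \<Omega> (\<lambda>t x. u t x / L2_norm \<Omega> (u t))
              (\<lambda>x. c * infdist x (frontier \<Omega>)) (at_left T))"
proof -
  note \<Omega> = assms(1,3,2)
  have ne: "\<Omega> \<noteq> {}"
  proof
    assume "\<Omega> = {}"
    then have "AE x in lebesgue_on \<Omega>. f x = 0" by (intro AE_I2) simp
    then show False using assms(6) by simp
  qed
  have flow: "\<And>t. 0 \<le> t \<Longrightarrow> u t \<in> L2 \<Omega>"
    "\<And>t. 0 \<le> t \<Longrightarrow> L2_tendsto \<Omega> u (u t) (at t within {0..})"
    "AE x in lebesgue_on \<Omega>. u 0 x = f x"
    "\<And>\<delta>. 0 < \<delta> \<Longrightarrow> \<exists>L. \<forall>s\<ge>\<delta>. \<forall>t\<ge>\<delta>. L2_norm \<Omega> (\<lambda>x. u s x - u t x) \<le> L * \<bar>s - t\<bar>"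
    "\<And>t. 0 < t \<Longrightarrow> \<exists>w. L2_has_right_derivative \<Omega> u w t \<and>
        minimal_norm_element \<Omega> (subdifferential \<Omega> (grad_sup_functional \<Omega>) (u t)) (\<lambda>x. - w x)"
    using assms(8) unfolding is_gradient_flow_def by blast+
  have "\<forall>t. \<exists>w. 0 < t \<longrightarrow> L2_has_right_derivative \<Omega> u w t \<and>
        (\<lambda>x. - w x) \<in> subdifferential \<Omega> (grad_sup_functional \<Omega>) (u t)"
    using flow(5) unfolding minimal_norm_element_def by blast
  then obtain w where w: "\<And>t. 0 < t \<Longrightarrow> L2_has_right_derivative \<Omega> u (w t) t"
      "\<And>t. 0 < t \<Longrightarrow> (\<lambda>x. - w t x) \<in> subdifferential \<Omega> (grad_sup_functional \<Omega>) (u t)"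
    by metis
  define p where "p t x = - w t x" for t x
  have p: "p t \<in> subdifferential \<Omega> (grad_sup_functional \<Omega>) (u t)" if "0 < t" for t
    using w(2)[OF that] by (simp add: p_def[abs_def])
  interpret lipschitz_flow \<Omega> u p
  proof
    fix t :: real assume t: "0 < t"
    have U: "u t \<in> L2 \<Omega>" using t flow(1) by simp
    show "p t \<in> L2 \<Omega>" using p[OF t] by (simp add: subdifferential_def)
    show "((\<lambda>h. L2_norm \<Omega> (\<lambda>x. (u (t + h) x - u t x) / h - - p t x)) \<longlongrightarrow> 0) (at_right 0)"
      using w(1)[OF t] by (simp add: L2_has_right_derivative_def L2_tendsto_def p_def)
    show "\<exists>v. lip0 \<Omega> (L2_inner \<Omega> (p t) (u t)) v \<and> (AE x in lebesgue_on \<Omega>. u t x = v x)"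
      by (rule subgradient_lipschitz_characterization(1)[OF \<Omega>(1,2) ne U p[OF t]])
    show "L2_inner \<Omega> (p t) z \<le> M" if "lip0 \<Omega> M z" for M z
      by (rule subgradient_lipschitz_characterization(2)[OF \<Omega>(1,2) ne U p[OF t] that])
  next
    show "AE x in lebesgue_on \<Omega>. 0 \<le> u 0 x"
      using flow(3) assms(7) by eventually_elim simp
    show "\<not> (AE x in lebesgue_on \<Omega>. u 0 x = 0)"
    proof
      assume "AE x in lebesgue_on \<Omega>. u 0 x = 0"
      then have "AE x in lebesgue_on \<Omega>. f x = 0" using flow(3) by eventually_elim simp
      then show False using assms(6) by simp
    qed
  qed (use \<Omega> ne flow in \<open>auto simp: L2_tendsto_def\<close>)
  have extinct: "(AE x in lebesgue_on \<Omega>. u t x = u_inf x) \<longleftrightarrow> y t = 0" if "0 < t" for t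
  proof -
    have "(AE x in lebesgue_on \<Omega>. u t x = u_inf x) \<longleftrightarrow> (AE x in lebesgue_on \<Omega>. u t x = 0)"
    proof
      assume "AE x in lebesgue_on \<Omega>. u t x = u_inf x"
      then show "AE x in lebesgue_on \<Omega>. u t x = 0" using assms(10) by eventually_elim simp
    next
      assume "AE x in lebesgue_on \<Omega>. u t x = 0"
      then show "AE x in lebesgue_on \<Omega>. u t x = u_inf x" using assms(10) by eventually_elim simp
    qed
    also have "\<dots> \<longleftrightarrow> y t = 0"
      using L2_norm_eq_0_iff[OF flow(1), of t] that by (simp add: L2_norm_u)
    finally show ?thesis .
  qed
  have "extinction_time \<Omega> u u_inf = ereal T"
    unfolding extinction_time_def
  proof (rule antisym)
    show "Inf (ereal ` {t. 0 < t \<and> (AE x in lebesgue_on \<Omega>. u t x = u_inf x)}) \<le> ereal T"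
      by (intro Inf_lower imageI) (use T_attained extinct in simp)
    show "ereal T \<le> Inf (ereal ` {t. 0 < t \<and> (AE x in lebesgue_on \<Omega>. u t x = u_inf x)})"
    proof (rule Inf_greatest)
      fix e assume "e \<in> ereal ` {t. 0 < t \<and> (AE x in lebesgue_on \<Omega>. u t x = u_inf x)}"
      then obtain t where t: "e = ereal t" "0 < t" "y t = 0" using extinct by auto
      then have "\<not> t < T" using T_attained(3)[of t] by force
      then show "ereal T \<le> e" using t(1) by simp
    qed
  qed
  moreover have "L2_tendsto \<Omega> (\<lambda>t x. u t x / L2_norm \<Omega> (u t)) (\<lambda>x. 1 / sqrt N * infdist x (frontier \<Omega>)) (at_left T)"
    unfolding L2_tendsto_def
  proof (intro conjI)
    have eq: "infdist x (frontier \<Omega>) = d x" if "x \<in> \<Omega>" for x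
      using infdist_frontier_eq[OF \<Omega>(1) that not_UNIV] by (simp add: d_def)
    have "continuous_on UNIV (\<lambda>x::real ^ 'n. 1 / sqrt N * infdist x (frontier \<Omega>))"
      by (intro continuous_intros)
    then show "(\<lambda>x. 1 / sqrt N * infdist x (frontier \<Omega>)) \<in> L2 \<Omega>"
      by (rule continuous_L2[OF \<Omega>(1,2)])
    have "\<forall>\<^sub>F t in at_left T. 0 < t"
      using T_attained(1) by (auto simp: eventually_at_left intro!: exI[of _ 0])
    then show "\<forall>\<^sub>F t in at_left T. (\<lambda>x. u t x / L2_norm \<Omega> (u t)) \<in> L2 \<Omega>"
      by eventually_elim (intro L2_divide flow(1), simp)
    have "L2_norm \<Omega> (\<lambda>x. u t x / L2_norm \<Omega> (u t) - 1 / sqrt N * infdist x (frontier \<Omega>))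
        = L2_norm \<Omega> (\<lambda>x. u t x / L2_norm \<Omega> (u t) - 1 / sqrt N * d x)" for t
      unfolding L2_norm_def
      by (intro arg_cong[where f=sqrt] Bochner_Integration.integral_cong) (auto simp: eq)
    then show "((\<lambda>t. L2_norm \<Omega> (\<lambda>x. u t x / L2_norm \<Omega> (u t) - 1 / sqrt N * infdist x (frontier \<Omega>))) \<longlongrightarrow> 0) (at_left T)"
      using profile_limit by simp
  qed
  ultimately show ?thesis by blast
qed

end
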